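(* Let $\Delta$ be a non-perfect profinite $F$-group with signature $(g,r;\{n_1,\dots,n_k\})$. Then $\Delta$ contains a torsion-free open characteristic subgroup whose quotient has derived length at most $3$. Furthermore, one can choose a torsion-free open characteristic subgroup of $\Delta$ with a quotient that is (i) abelian if and only if either $r\ge1$, or $r=0$ and $\Delta$ satisfies the abelian-period condition; (ii) of derived length at most $2$ if and only if either $(g,r)\ne(0,0)$, or $(g,r)=(0,0)$ and $\Delta^{(1)}$ satisfies the abelian-period condition. The equivalences (i) and (ii) with the same numerical conditions also hold if the subgroup is only assumed to be normal instead of characteristic.
   Context: A profinite group $\Delta$ is a profinite $F$-group if it admits a topological presentation $$\Bigl\langle \alpha_1,\beta_1,\dots,\alpha_g,\beta_g,\gamma_1,\dots,\gamma_r,\delta_1,\dots,\delta_k\ \Bigm|\ \prod_{i=1}^g[\alpha_i,\beta_i]\prod_{j=1}^r\gamma_j\prod_{\ell=1}^k\delta_\ell=1,\ \delta_1^{n_1}=\cdots=\delta_k^{n_k}=1\Bigr\rangle$$ with integers $g,r,k\ge0$ and $n_i\ge2$; the tuple $(g,r;\{n_1,\dots,n_k\})$ is its signature. Abelian-period condition: if $k\ge2$, $\Delta$ satisfies it when for all $i$, $n_i$ divides $\operatorname{lcm}(n_j\mid j\ne i)$. By convention it is satisfied if $k=0$ and not satisfied if $k=1$. An open subgroup $H$ of $\Delta$ is again a profinite $F$-group, considered with the signature induced from $\Delta$: its cusps correspond to the cycles of the permutations induced by the $\gamma_i$ on $\Delta/H$; its periods are the integers $n_i/s_{i,j}$ (values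 equal to $1$ being omitted), where $s_{i,j}$ runs over the lengths of the cycles of the permutation induced by $\delta_i$ on $\Delta/H$; its genus is determined by $\chi(H)=[\Delta:H]\chi(\Delta)$, where $\chi=2-2g-r-\sum_i(1-1/n_i)$. When $(g,r)=(0,0)$, $\Delta^{(1)}$ is open in $\Delta$ and carries this induced signature. For a profinite group $G$, $G^{(0)}=G$ and $G^{(m)}$ is the closure of $[G^{(m-1)},G^{(m-1)}]$; the derived length is the minimal $m$ with $G^{(m)}=1$; $G$ is perfect if $G=G^{(1)}$.
   Formalization: The equivalences (i) and (ii) are claimed except when (g,r)=(0,0), k=2 and n_1≠n_2: there Δ is cyclic of order gcd(n_1,n_2) and, whenever it is non-perfect, both equivalences fail, e.g. for signature (0,0;{2,4}). *)

theory Defs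
  imports
    "HOL-Analysis.Product_Topology"
    "HOL-Analysis.T1_Spaces"
    "HOL-Algebra.Generated_Groups"
    "HOL-Algebra.Left_Coset"
    "HOL-Combinatorics.Orbits"
    "HOL-Library.Extended_Nat"
    "HOL-Library.Multiset"
begin

definition topological_group :: "('a, 'm) monoid_scheme \<Rightarrow> 'a topology \<Rightarrow> bool" where
  "topological_group G T \<longleftrightarrow>
     group G \<and> topspace T = carrier G \<and>
     continuous_map (prod_topology T T) T (\<lambda>(x, y). x \<otimes>\<^bsub>G\<^esub> y) \<and>
     continuous_map T T (\<lambda>x. inv\<^bsub>G\<^esub> x)"

definition profinite_group :: "('a, 'm) monoid_scheme \<Rightarrow> 'a topology \<Rightarrow> bool" where
  "profinite_group G T \<longleftrightarrow>
     topological_group G T \<and> compact_space T \<and> Hausdorff_space T \<and>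
     (\<forall>S. connectedin T S \<longrightarrow> (\<exists>a. S \<subseteq> {a}))"

definition quotient_topology ::
  "('a, 'm) monoid_scheme \<Rightarrow> 'a topology \<Rightarrow> 'a set \<Rightarrow> 'a set topology" where
  "quotient_topology G T N =
     topology (\<lambda>U. U \<subseteq> carrier (G Mod N) \<and> openin T {x \<in> topspace T. N #>\<^bsub>G\<^esub> x \<in> U})"

lemma openin_quotient_topology:
  "openin (quotient_topology G T N) U \<longleftrightarrow>
     U \<subseteq> carrier (G Mod N) \<and> openin T {x \<in> topspace T. N #>\<^bsub>G\<^esub> x \<in> U}"
proof -
  have "istopology (\<lambda>U. U \<subseteq> carrier (G Mod N) \<and> openin T {x \<in> topspace T. N #>\<^bsub>G\<^esub> x \<in> U})"
    (is "istopology ?P")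
    unfolding istopology_def
  proof (rule conjI; intro allI impI)
    fix U V assume UV: "?P U" "?P V"
    have eq: "{x \<in> topspace T. N #>\<^bsub>G\<^esub> x \<in> U \<inter> V} =
        {x \<in> topspace T. N #>\<^bsub>G\<^esub> x \<in> U} \<inter> {x \<in> topspace T. N #>\<^bsub>G\<^esub> x \<in> V}"
      by blast
    show "?P (U \<inter> V)"
    proof
      show "U \<inter> V \<subseteq> carrier (G Mod N)" using UV(1) by blast
      show "openin T {x \<in> topspace T. N #>\<^bsub>G\<^esub> x \<in> U \<inter> V}"
        unfolding eq using UV by (intro openin_Int) (rule conjunct2, assumption)+
    qed
  next
    fix \<K> assume *: "\<forall>K\<in>\<K>. ?P K"
    have eq: "{x \<in> topspace T. N #>\<^bsub>G\<^esub> x \<in> \<Union>\<K>} =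
        (\<Union>K\<in>\<K>. {x \<in> topspace T. N #>\<^bsub>G\<^esub> x \<in> K})"
      by blast
    show "?P (\<Union>\<K>)"
    proof
      show "\<Union>\<K> \<subseteq> carrier (G Mod N)" using * by blast
      show "openin T {x \<in> topspace T. N #>\<^bsub>G\<^esub> x \<in> \<Union>\<K>}"
        unfolding eq
      proof (rule openin_Union)
        fix S assume "S \<in> (\<lambda>K. {x \<in> topspace T. N #>\<^bsub>G\<^esub> x \<in> K}) ` \<K>"
        then obtain K where "K \<in> \<K>" and S: "S = {x \<in> topspace T. N #>\<^bsub>G\<^esub> x \<in> K}"
          by (rule imageE)
        then show "openin T S" using * by blast
      qed
    qed
  qed
  then show ?thesis unfolding quotient_topology_def by simp
qed

primrec closed_derived ::
  "('a, 'm) monoid_scheme \<Rightarrow> 'a topology \<Rightarrow> nat \<Rightarrow> 'a set" where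
  "closed_derived G T 0 = carrier G"
| "closed_derived G T (Suc m) = T closure_of (derived G (closed_derived G T m))"

definition perfect_group :: "('a, 'm) monoid_scheme \<Rightarrow> 'a topology \<Rightarrow> bool" where
  "perfect_group G T \<longleftrightarrow> closed_derived G T 1 = carrier G"

text \<open>The value is \<open>\<infinity>\<close> if the closed derived series never reaches the trivial subgroup.\<close>
definition derived_length :: "('a, 'm) monoid_scheme \<Rightarrow> 'a topology \<Rightarrow> enat" where
  "derived_length G T = (INF m \<in> {m. closed_derived G T m = {\<one>\<^bsub>G\<^esub>}}. enat m)"

definition torsion_free_subgroup :: "('a, 'm) monoid_scheme \<Rightarrow> 'a set \<Rightarrow> bool" where
  "torsion_free_subgroup G N \<longleftrightarrow>
     subgroup N G \<and> (\<forall>x\<in>N. \<forall>m::nat. m > 0 \<longrightarrow> x [^]\<^bsub>G\<^esub> m = \<one>\<^bsub>G\<^esub> \<longrightarrow> x = \<one>\<^bsub>G\<^esub>)"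

text \<open>As usual for profinite groups, automorphisms are automorphisms of topological groups.\<close>
definition characteristic_subgroup ::
  "('a, 'm) monoid_scheme \<Rightarrow> 'a topology \<Rightarrow> 'a set \<Rightarrow> bool" where
  "characteristic_subgroup G T N \<longleftrightarrow>
     subgroup N G \<and> (\<forall>\<phi> \<in> iso G G. homeomorphic_map T T \<phi> \<longrightarrow> \<phi> ` N = N)"

definition torsion_free_open_characteristic ::
  "('a, 'm) monoid_scheme \<Rightarrow> 'a topology \<Rightarrow> 'a set \<Rightarrow> bool" where
  "torsion_free_open_characteristic G T N \<longleftrightarrow>
     torsion_free_subgroup G N \<and> openin T N \<and> characteristic_subgroup G T N"

definition torsion_free_open_normal ::
  "('a, 'm) monoid_scheme \<Rightarrow> 'a topology \<Rightarrow> 'a set \<Rightarrow> bool" where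
  "torsion_free_open_normal G T N \<longleftrightarrow>
     torsion_free_subgroup G N \<and> openin T N \<and> N \<lhd> G"

definition ordered_prod :: "('a, 'm) monoid_scheme \<Rightarrow> (nat \<Rightarrow> 'a) \<Rightarrow> nat \<Rightarrow> 'a" where
  "ordered_prod G x n = foldr (\<lambda>i y. x i \<otimes>\<^bsub>G\<^esub> y) [0..<n] \<one>\<^bsub>G\<^esub>"

definition commutator :: "('a, 'm) monoid_scheme \<Rightarrow> 'a \<Rightarrow> 'a \<Rightarrow> 'a" where
  "commutator G x y = x \<otimes>\<^bsub>G\<^esub> y \<otimes>\<^bsub>G\<^esub> inv\<^bsub>G\<^esub> x \<otimes>\<^bsub>G\<^esub> inv\<^bsub>G\<^esub> y"

text \<open>
  Generators are indexed from \<open>0\<close>; only \<open>\<alpha> i\<close>, \<open>\<beta> i\<close> for \<open>i < g\<close>, \<open>\<gamma> j\<close> for \<open>j < r\<close> and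
  \<open>\<delta> l\<close> for \<open>l < k = length ns\<close> are relevant, where \<open>ns\<close> is the list \<open>n\<^sub>1, \<dots>, n\<^sub>k\<close>.
\<close>
definition F_relations ::
  "('a, 'm) monoid_scheme \<Rightarrow> nat \<Rightarrow> nat \<Rightarrow> nat list \<Rightarrow>
   (nat \<Rightarrow> 'a) \<Rightarrow> (nat \<Rightarrow> 'a) \<Rightarrow> (nat \<Rightarrow> 'a) \<Rightarrow> (nat \<Rightarrow> 'a) \<Rightarrow> bool" where
  "F_relations G g r ns \<alpha> \<beta> \<gamma> \<delta> \<longleftrightarrow>
     (\<forall>i<g. \<alpha> i \<in> carrier G \<and> \<beta> i \<in> carrier G) \<and>
     (\<forall>j<r. \<gamma> j \<in> carrier G) \<and>
     (\<forall>l<length ns. \<delta> l \<in> carrier G) \<and>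
     ordered_prod G (\<lambda>i. commutator G (\<alpha> i) (\<beta> i)) g
       \<otimes>\<^bsub>G\<^esub> ordered_prod G \<gamma> r \<otimes>\<^bsub>G\<^esub> ordered_prod G \<delta> (length ns) = \<one>\<^bsub>G\<^esub> \<and>
     (\<forall>l<length ns. \<delta> l [^]\<^bsub>G\<^esub> (ns ! l) = \<one>\<^bsub>G\<^esub>)"

text \<open>
  A topological presentation is expressed by its universal property: \<open>G\<close> is topologically
  generated by elements satisfying the relations, and every family of elements satisfying the
  relations in a profinite group \<open>H\<close> is the image of the given one under a continuous
  homomorphism (unique, by topological generation). Testing on groups \<open>H\<close> with elements of type
  \<open>nat set\<close> loses nothing: the image of \<open>G\<close> lies in a topologically finitely generated closed
  subgroup of \<open>H\<close>, which has at most continuum many elements.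
\<close>
definition F_presentation ::
  "('a, 'm) monoid_scheme \<Rightarrow> 'a topology \<Rightarrow> nat \<Rightarrow> nat \<Rightarrow> nat list \<Rightarrow>
   (nat \<Rightarrow> 'a) \<Rightarrow> (nat \<Rightarrow> 'a) \<Rightarrow> (nat \<Rightarrow> 'a) \<Rightarrow> (nat \<Rightarrow> 'a) \<Rightarrow> bool" where
  "F_presentation G T g r ns \<alpha> \<beta> \<gamma> \<delta> \<longleftrightarrow>
     profinite_group G T \<and> (\<forall>n\<in>set ns. n \<ge> 2) \<and>
     F_relations G g r ns \<alpha> \<beta> \<gamma> \<delta> \<and>
     T closure_of (generate G (\<alpha> ` {..<g} \<union> \<beta> ` {..<g} \<union> \<gamma> ` {..<r} \<union> \<delta> ` {..<length ns}))
       = carrier G \<and>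
     (\<forall>(H :: nat set monoid) S a b c d.
        profinite_group H S \<and> F_relations H g r ns a b c d \<longrightarrow>
        (\<exists>\<phi> \<in> hom G H. continuous_map T S \<phi> \<and>
           (\<forall>i<g. \<phi> (\<alpha> i) = a i \<and> \<phi> (\<beta> i) = b i) \<and>
           (\<forall>j<r. \<phi> (\<gamma> j) = c j) \<and>
           (\<forall>l<length ns. \<phi> (\<delta> l) = d l)))"

datatype signature = Signature (genus: nat) (cusps: nat) (periods: "nat multiset")

definition euler_char :: "signature \<Rightarrow> real" where
  "euler_char \<sigma> = 2 - 2 * real (genus \<sigma>) - real (cusps \<sigma>) -
     (\<Sum>n\<in>#periods \<sigma>. 1 - 1 / real n)"

definition abelian_period_condition :: "signature \<Rightarrow> bool" where
  "abelian_period_condition \<sigma> \<longleftrightarrow>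
     size (periods \<sigma>) \<noteq> 1 \<and>
     (\<forall>n. n \<in># periods \<sigma> \<longrightarrow> n dvd Lcm (set_mset (periods \<sigma> - {#n#})))"

text \<open>Cycles of the permutation of \<open>G/H\<close> (left cosets) induced by left multiplication by \<open>x\<close>.\<close>
definition coset_cycles :: "('a, 'm) monoid_scheme \<Rightarrow> 'a set \<Rightarrow> 'a \<Rightarrow> 'a set set set" where
  "coset_cycles G H x = orbit (\<lambda>C. x <#\<^bsub>G\<^esub> C) ` (lcosets\<^bsub>G\<^esub> H)"

definition induced_cusps ::
  "('a, 'm) monoid_scheme \<Rightarrow> nat \<Rightarrow> (nat \<Rightarrow> 'a) \<Rightarrow> 'a set \<Rightarrow> nat" where
  "induced_cusps G r \<gamma> H = (\<Sum>j<r. card (coset_cycles G H (\<gamma> j)))"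

definition induced_periods ::
  "('a, 'm) monoid_scheme \<Rightarrow> nat list \<Rightarrow> (nat \<Rightarrow> 'a) \<Rightarrow> 'a set \<Rightarrow> nat multiset" where
  "induced_periods G ns \<delta> H =
     filter_mset (\<lambda>n. n \<noteq> 1)
       (\<Sum>l<length ns. image_mset (\<lambda>Z. ns ! l div card Z) (mset_set (coset_cycles G H (\<delta> l))))"

text \<open>The signature of an open subgroup \<open>H\<close>, induced from the given presentation of \<open>G\<close>.\<close>
definition induced_signature ::
  "('a, 'm) monoid_scheme \<Rightarrow> nat \<Rightarrow> nat \<Rightarrow> nat list \<Rightarrow>
   (nat \<Rightarrow> 'a) \<Rightarrow> (nat \<Rightarrow> 'a) \<Rightarrow> 'a set \<Rightarrow> signature" where
  "induced_signature G g r ns \<gamma> \<delta> H =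
     Signature
       (THE h. euler_char (Signature h (induced_cusps G r \<gamma> H) (induced_periods G ns \<delta> H)) =
               real (card (lcosets\<^bsub>G\<^esub> H)) * euler_char (Signature g r (mset ns)))
       (induced_cusps G r \<gamma> H)
       (induced_periods G ns \<delta> H)"

end

theory Submission
  imports
    Defs
    "HOL-Analysis.Abstract_Topological_Spaces"
    "HOL-Number_Theory.Cong"
    "HOL-Algebra.Elementary_Groups"
    "HOL-Algebra.Multiplicative_Group"
    "HOL-Algebra.SndIsomorphismGrp"
begin

text \<open>
  Let \<open>N\<close> be an open normal subgroup modulo which every \<open>\<delta> l\<close> has order exactly \<open>n\<^sub>l\<close>. Then \<open>N\<close> is
  torsion-free: if \<open>x \<in> N\<close> has finite order and nontrivial image in a finite quotient \<open>Q\<close>, the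
  \<open>\<delta> l\<close> act freely on \<open>Q/\<langle>x\<rangle>\<close>, and therefore the monomial representation of \<open>G\<close> induced from a
  faithful character of \<open>\<langle>x\<rangle>\<close> with values in \<open>\<int>/n\<close> lifts to \<open>\<int>/nM\<close> for every \<open>M\<close>, so that \<open>x\<close> has
  infinite order. The obstruction to lifting is the value of the surface relation on lifted
  generators, an element of a permutation module with coordinate sum zero; it can be removed by
  changing the lifts.

  The same lifting argument, applied to wreath products \<open>\<int>/q wr Q\<close>, enlarges the orders of the \<open>\<delta> l\<close>
  in solvable quotients \<open>Q\<close>: prescribed values on the cycles of the \<open>\<delta> l\<close> on \<open>Q\<close> are realised as soon
  as their sum vanishes. This is possible with two cycles of the same \<open>\<delta> l\<close>, or with cycles of
  two different generators whose remaining periods share the factor \<open>q\<close>. Conversely, if \<open>\<delta> l\<close> has a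
  single cycle, the transfer to the kernel bounds its order by the remaining periods.
\<close>

section \<open>Open subgroups of profinite groups\<close>

text \<open>All existence claims reduce to one property of the presentation,
  \<open>separated m\<close>. Passing from a normal to a characteristic subgroup then costs nothing,
  because \<open>G\<close> is topologically finitely generated (\<open>characteristic_core\<close>).
  The converse directions need that \<open>\<delta> l\<close> has order exactly
  \<open>ns ! l\<close> in \<open>G\<close> itself. The presentation only bounds this order from
  above; equality is a consequence of \<open>separated 3\<close>, so the bound 3 has to be
  established before either equivalence. The number 3 comes from one obstacle. Each refinement costs
  one step of the derived series, and it raises the order of \<open>\<delta> l\<close> without any
  condition on the periods only if \<open>\<delta> l\<close> does not generate the finite quotient
  at hand. The quotient by the closed commutator subgroup may be cyclic and generated by
  \<open>\<delta> l\<close>; one extra refinement at another generator then destroys this, so the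
  three steps are the abelian quotient, the detour and the final refinement. For non-perfect groups
  exact orders fail only for \<open>g = r = 0\<close> and two different periods. There the relation
  makes \<open>\<delta> 0\<close> and \<open>\<delta> 1\<close> mutually inverse, so their order
  divides both periods, and this case is settled by hand.\<close>

lemma commutator_in_derived:
  assumes "x \<in> S" "y \<in> S"
  shows "commutator G x y \<in> derived G S"
  unfolding derived_def commutator_def using assms by (blast intro: generate.incl)

lemma (in group) derived_subset_normalI:
  assumes "S \<subseteq> carrier G" "subgroup N G" "\<And>x y. x \<in> S \<Longrightarrow> y \<in> S \<Longrightarrow> commutator G x y \<in> N"
  shows "derived G S \<subseteq> N"
  unfolding derived_def using assms by (intro generate_subgroup_incl) (auto simp: commutator_def)

text \<open>Writes a coset as the preimage of \<open>U\<close> under a translation, so that cosets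
  of open or closed sets inherit these properties from continuity alone.\<close>

lemma (in group) r_coset_preimage:
  assumes "U \<subseteq> carrier G" "a \<in> carrier G"
  shows "U #> a = {x \<in> carrier G. x \<otimes> inv a \<in> U}"
proof
  show "U #> a \<subseteq> {x \<in> carrier G. x \<otimes> inv a \<in> U}"
    using assms by (auto simp: r_coset_def m_assoc subset_iff)
  show "{x \<in> carrier G. x \<otimes> inv a \<in> U} \<subseteq> U #> a"
  proof
    fix x assume x: "x \<in> {x \<in> carrier G. x \<otimes> inv a \<in> U}"
    then have "x = (x \<otimes> inv a) \<otimes> a" using assms(2) by (simp add: m_assoc)
    then show "x \<in> U #> a" using x unfolding r_coset_def by blast
  qed
qed

lemma (in group) r_coset_eq_iff:
  assumes "subgroup N G" "x \<in> carrier G" "y \<in> carrier G"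
  shows "N #> x = N #> y \<longleftrightarrow> x \<otimes> inv y \<in> N"
  using assms rcos_self[OF assms(2,1)] repr_independence[OF _ assms(3,1), of x]
    r_coset_preimage[OF subgroup.subset[OF assms(1)] assms(3)] by auto

locale top_group =
  fixes G :: "('a, 'm) monoid_scheme" (structure) and T :: "'a topology"
  assumes topological_group: "topological_group G T"

sublocale top_group \<subseteq> group G
  using topological_group unfolding topological_group_def by blast

context top_group
begin

lemma topspace_eq [simp]: "topspace T = carrier G"
  using topological_group unfolding topological_group_def by blast

lemma continuous_mult:
  assumes "continuous_map X T f" "continuous_map X T h"
  shows "continuous_map X T (\<lambda>x. f x \<otimes> h x)"
proof -
  have "continuous_map X (prod_topology T T) (\<lambda>x. (f x, h x))"
    using assms by (simp add: continuous_map_pairwise o_def)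
  from continuous_map_compose[OF this, of T "\<lambda>(x, y). x \<otimes> y"] topological_group
  show ?thesis unfolding topological_group_def by (simp add: o_def)
qed

lemma continuous_translation:
  assumes "a \<in> carrier G" "b \<in> carrier G"
  shows "continuous_map T T (\<lambda>x. a \<otimes> x \<otimes> b)"
  using assms by (intro continuous_mult) auto

lemma openin_translation:
  assumes "openin T U" "a \<in> carrier G"
  shows "openin T {x \<in> carrier G. x \<otimes> a \<in> U}"
proof -
  have "openin T {x \<in> topspace T. \<one> \<otimes> x \<otimes> a \<in> U}"
    using openin_continuous_map_preimage[OF continuous_translation assms(1)] assms(2) by blast
  also have "{x \<in> topspace T. \<one> \<otimes> x \<otimes> a \<in> U} = {x \<in> carrier G. x \<otimes> a \<in> U}"
    using assms(2) by auto
  finally show ?thesis .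
qed

lemma openin_r_coset:
  assumes "openin T U" "a \<in> carrier G"
  shows "openin T (U #> a)"
proof -
  have "U #> a = {x \<in> carrier G. x \<otimes> inv a \<in> U}"
    using openin_subset[OF assms(1)] assms(2) by (intro r_coset_preimage) auto
  then show ?thesis using openin_translation[OF assms(1), of "inv a"] assms(2) by simp
qed

text \<open>\<open>S\<close> is a union of right translates of \<open>N\<close>. Subgroups cut out
  by a condition on a finite quotient are shown to be open in this way, since they contain an open
  kernel.\<close>

lemma open_supergroup:
  assumes "openin T N" "subgroup N G" "subgroup S G" "N \<subseteq> S"
  shows "openin T S"
proof -
  have "S = (\<Union>a\<in>S. N #> a)"
  proof
    show "S \<subseteq> (\<Union>a\<in>S. N #> a)"
      using rcos_self[OF _ assms(2)] subgroup.subset[OF assms(3)] by blast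
    show "(\<Union>a\<in>S. N #> a) \<subseteq> S"
      using assms(4) subgroup.m_closed[OF assms(3)] by (auto simp: r_coset_def)
  qed
  moreover have "openin T (\<Union>a\<in>S. N #> a)"
    using openin_r_coset[OF assms(1)] subgroup.subset[OF assms(3)] by blast
  ultimately show ?thesis by simp
qed

lemma open_subgroup_closed:
  assumes "openin T S" "subgroup S G"
  shows "closedin T S"
proof -
  have "carrier G - S = (\<Union>a\<in>carrier G - S. S #> a)"
  proof
    show "carrier G - S \<subseteq> (\<Union>a\<in>carrier G - S. S #> a)"
      using rcos_self[OF _ assms(2)] by blast
    show "(\<Union>a\<in>carrier G - S. S #> a) \<subseteq> carrier G - S"
    proof
      fix x assume "x \<in> (\<Union>a\<in>carrier G - S. S #> a)"
      then obtain a s where a: "a \<in> carrier G" "a \<notin> S" "s \<in> S" "x = s \<otimes> a"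
        by (auto simp: r_coset_def)
      have s: "s \<in> carrier G" using a subgroup.subset[OF assms(2)] by blast
      have "a \<in> S" if "x \<in> S"
      proof -
        have "inv s \<otimes> x \<in> S" using that a assms(2) by (simp add: subgroup.m_closed subgroup.m_inv_closed)
        then show ?thesis using a s by (simp add: m_assoc[symmetric])
      qed
      then show "x \<in> carrier G - S" using a s by auto
    qed
  qed
  moreover have "openin T (\<Union>a\<in>carrier G - S. S #> a)"
    using openin_r_coset[OF assms(1)] by blast
  ultimately have "openin T (topspace T - S)" by simp
  then show ?thesis using subgroup.subset[OF assms(2)] by (simp add: closedin_def)
qed

definition open_normal :: "'a set \<Rightarrow> bool" where
  "open_normal N \<longleftrightarrow> openin T N \<and> N \<lhd> G"

lemma open_normalD:
  assumes "open_normal N"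
  shows "openin T N" "N \<lhd> G" "subgroup N G" "closedin T N"
  using assms normal_imp_subgroup open_subgroup_closed unfolding open_normal_def by blast+

lemma open_normal_carrier: "open_normal (carrier G)"
  unfolding open_normal_def using normal_self openin_topspace[of T] by simp

lemma open_normal_Int:
  assumes "open_normal M" "open_normal N" shows "open_normal (M \<inter> N)"
  using assms normal_subgroup_intersect unfolding open_normal_def by blast

lemma open_normal_INT:
  assumes "finite I" "\<And>i. i \<in> I \<Longrightarrow> open_normal (M i)"
  shows "open_normal (carrier G \<inter> (\<Inter>i\<in>I. M i))"
  using assms
proof (induction I rule: finite_induct)
  case empty then show ?case using open_normal_carrier by simp
next
  case (insert i I)
  have "carrier G \<inter> (\<Inter>i\<in>insert i I. M i) = M i \<inter> (carrier G \<inter> (\<Inter>i\<in>I. M i))" by auto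
  then show ?case using open_normal_Int insert by simp
qed

text \<open>Homomorphisms to discrete groups are treated without a topology on the target: continuity
  is openness of the kernel.\<close>
lemma open_normal_kernel:
  assumes "\<phi> \<in> hom G K" "group K" "openin T (kernel G K \<phi>)"
  shows "open_normal (kernel G K \<phi>)"
proof -
  interpret group_hom G K \<phi>
    using assms by (simp add: group_hom_def group_hom_axioms_def is_group)
  show ?thesis unfolding open_normal_def using assms normal_kernel by simp
qed

end

section \<open>Profinite groups: finite quotients and separation of points by open normal
  subgroups\<close>

locale profinite_grp =
  fixes G :: "('a, 'm) monoid_scheme" (structure) and T :: "'a topology"
  assumes profinite: "profinite_group G T"

sublocale profinite_grp \<subseteq> top_group
  using profinite unfolding profinite_group_def by unfold_locales blast

context profinite_grp
begin

lemma compact: "compact_space T" and hausdorff: "Hausdorff_space T"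
  and totally_disconnected: "\<And>S. connectedin T S \<Longrightarrow> \<exists>a. S \<subseteq> {a}"
  using profinite unfolding profinite_group_def by blast+

lemma finite_quotient:
  assumes "openin T N" "subgroup N G"
  shows "finite (carrier (G Mod N))"
proof -
  have "\<Union> (rcosets N) = carrier G" using rcosets_part_G[OF assms(2)] .
  moreover have "\<forall>U\<in>rcosets N. openin T U"
    using openin_r_coset[OF assms(1)] by (auto simp: RCOSETS_def)
  ultimately obtain F where F: "finite F" "F \<subseteq> rcosets N" "carrier G \<subseteq> \<Union>F"
    using compact unfolding compact_space_alt by (metis equalityD2 topspace_eq)
  have "rcosets N \<subseteq> F"
  proof
    fix C assume C: "C \<in> rcosets N"
    then obtain a where a: "a \<in> carrier G" "C = N #> a" by (auto simp: RCOSETS_def)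
    then have "a \<in> C" using rcos_self[OF _ assms(2)] by blast
    then obtain D where "D \<in> F" "a \<in> D" using F a by blast
    then have "D = C" using rcos_disjoint[OF assms(2)] C F \<open>a \<in> C\<close>
      by (metis disjnt_iff pairwiseD subsetD)
    then show "C \<in> F" using \<open>D \<in> F\<close> by simp
  qed
  then show ?thesis using F finite_subset by (auto simp: FactGroup_def)
qed

text \<open>Total disconnectedness speaks only about connected sets. In a compact Hausdorff space
  components and quasi-components agree, which is the cut-wire-fence theorem, and this turns it into
  clopen separation.\<close>

lemma clopen_separation:
  assumes "x \<in> carrier G" "y \<in> carrier G" "x \<noteq> y"
  obtains U where "openin T U" "closedin T U" "x \<in> U" "y \<notin> U"
proof -
  have sing: "closedin T {z}" if "z \<in> carrier G" for z
    using that hausdorff by (simp add: Hausdorff_imp_t1_space closedin_t1_singleton)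
  have "separated_between T {x} {y}"
  proof (rule cut_wire_fence_theorem[OF compact hausdorff sing[OF assms(1)] sing[OF assms(2)]])
    fix D assume "connectedin T D"
    then obtain a where "D \<subseteq> {a}" using totally_disconnected by blast
    then show "disjnt D {x} \<or> disjnt D {y}" using assms(3) by (auto simp: disjnt_iff)
  qed
  then show ?thesis using that unfolding separated_between by blast
qed

text \<open>The complement of the stabiliser is the projection of a clopen subset of \<open>G \<times> G \<times> G\<close> along
  a compact factor, hence closed.\<close>
lemma clopen_translation_normal:
  assumes "openin T U" "closedin T U"
  defines "N \<equiv> {g \<in> carrier G. \<forall>a\<in>carrier G. \<forall>b\<in>carrier G. a \<otimes> g \<otimes> b \<in> U \<longleftrightarrow> a \<otimes> b \<in> U}"
  shows "open_normal N"
proof -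
  let ?Y = "prod_topology (prod_topology T T) T"
  let ?F = "\<lambda>z. fst (fst z) \<otimes> snd z \<otimes> snd (fst z)"
  let ?H = "\<lambda>z. fst (fst z) \<otimes> snd (fst z)"
  have c1: "continuous_map ?Y T (\<lambda>z. fst (fst z))" and c2: "continuous_map ?Y T (\<lambda>z. snd (fst z))"
    using continuous_map_compose[OF continuous_map_fst continuous_map_fst, of "T" T T]
      continuous_map_compose[OF continuous_map_fst continuous_map_snd, of "T" T T]
    by (simp_all add: o_def)
  have cF: "continuous_map ?Y T ?F" and cH: "continuous_map ?Y T ?H"
    by (intro continuous_mult c1 c2 continuous_map_snd)+
  let ?A = "{z \<in> topspace ?Y. ?F z \<in> U}" and ?B = "{z \<in> topspace ?Y. ?H z \<in> U}"
  have "openin ?Y ?A" "closedin ?Y ?A" "openin ?Y ?B" "closedin ?Y ?B"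
    by (intro openin_continuous_map_preimage[OF cF assms(1)] closedin_continuous_map_preimage[OF cF assms(2)]
        openin_continuous_map_preimage[OF cH assms(1)] closedin_continuous_map_preimage[OF cH assms(2)])+
  then have "closedin ?Y ((?A - ?B) \<union> (?B - ?A))"
    by (intro closedin_Un closedin_diff)
  moreover have "compact_space (prod_topology T T)"
    using compact by (simp add: compact_space_prod_topology)
  ultimately have cl: "closedin T (snd ` ((?A - ?B) \<union> (?B - ?A)))"
    using closed_map_snd unfolding closed_map_def by blast
  define S where "S = snd ` ((?A - ?B) \<union> (?B - ?A))"
  have 1: "a \<otimes> x \<otimes> b \<in> U \<longleftrightarrow> a \<otimes> b \<in> U"
    if "x \<in> carrier G" "x \<notin> S" "a \<in> carrier G" "b \<in> carrier G" for x a b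
  proof -
    have "snd ((a, b), x) \<in> S" if "((a, b), x) \<in> (?A - ?B) \<union> (?B - ?A)"
      unfolding S_def using that by (rule imageI)
    then have "((a, b), x) \<notin> (?A - ?B) \<union> (?B - ?A)" using that(2) by auto
    then show ?thesis using that(1,3,4) by auto
  qed
  have 2: "x \<notin> S" if "x \<in> N" for x
  proof
    assume "x \<in> S"
    then obtain z where "z \<in> (?A - ?B) \<union> (?B - ?A)" "x = snd z" unfolding S_def by (rule imageE)
    then show False using that unfolding N_def by auto
  qed
  have "N \<subseteq> carrier G" unfolding N_def by blast
  then have "N = topspace T - S"
    using 1 2 unfolding topspace_eq by (auto simp only: N_def mem_Collect_eq Diff_iff)
  then have op: "openin T N" using cl unfolding S_def by blast
  have "subgroup N G"
  proof
    show "N \<subseteq> carrier G" "\<one> \<in> N" unfolding N_def by auto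
    show "x \<otimes> y \<in> N" if "x \<in> N" "y \<in> N" for x y
    proof -
      have xy: "x \<in> carrier G" "y \<in> carrier G" using that unfolding N_def by auto
      have "a \<otimes> (x \<otimes> y) \<otimes> b \<in> U \<longleftrightarrow> a \<otimes> b \<in> U" if ab: "a \<in> carrier G" "b \<in> carrier G" for a b
      proof -
        have "a \<otimes> (x \<otimes> y) \<otimes> b = a \<otimes> x \<otimes> (y \<otimes> b)" "a \<otimes> (y \<otimes> b) = a \<otimes> y \<otimes> b"
          using ab xy by (simp_all add: m_assoc)
        then show ?thesis using \<open>x \<in> N\<close> \<open>y \<in> N\<close> ab xy unfolding N_def by auto
      qed
      then show ?thesis using xy unfolding N_def by simp
    qed
    show "inv x \<in> N" if "x \<in> N" for x
    proof -
      have x: "x \<in> carrier G" using that unfolding N_def by auto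
      have "a \<otimes> inv x \<otimes> b \<in> U \<longleftrightarrow> a \<otimes> b \<in> U" if ab: "a \<in> carrier G" "b \<in> carrier G" for a b
      proof -
        have "a \<otimes> inv x \<otimes> x \<otimes> b = a \<otimes> b" using ab x by (simp add: m_assoc)
        moreover have "a \<otimes> inv x \<otimes> x \<otimes> b \<in> U \<longleftrightarrow> a \<otimes> inv x \<otimes> b \<in> U"
          using \<open>x \<in> N\<close> ab x unfolding N_def by auto
        ultimately show ?thesis by simp
      qed
      then show ?thesis using x unfolding N_def by simp
    qed
  qed
  moreover have "h \<otimes> x \<otimes> inv h \<in> N" if "x \<in> N" "h \<in> carrier G" for x h
  proof -
    have x: "x \<in> carrier G" using that unfolding N_def by auto
    have "a \<otimes> (h \<otimes> x \<otimes> inv h) \<otimes> b \<in> U \<longleftrightarrow> a \<otimes> b \<in> U" if ab: "a \<in> carrier G" "b \<in> carrier G" for a b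
    proof -
      have "a \<otimes> (h \<otimes> x \<otimes> inv h) \<otimes> b = (a \<otimes> h) \<otimes> x \<otimes> (inv h \<otimes> b)"
        using ab x \<open>h \<in> carrier G\<close> by (simp add: m_assoc)
      moreover have "a \<otimes> b = (a \<otimes> h) \<otimes> (inv h \<otimes> b)"
        using ab \<open>h \<in> carrier G\<close> by (simp add: m_assoc[symmetric]) (simp add: m_assoc)
      ultimately show ?thesis using \<open>x \<in> N\<close> ab \<open>h \<in> carrier G\<close> unfolding N_def by auto
    qed
    then show ?thesis using x \<open>h \<in> carrier G\<close> unfolding N_def by simp
  qed
  ultimately have "N \<lhd> G" by (auto simp: normal_inv_iff)
  then show ?thesis using op by (simp add: open_normal_def)
qed

text \<open>The two-sided translation stabiliser of a clopen neighbourhood of \<open>\<one>\<close>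
  is contained in that neighbourhood: take both translating elements to be
  \<open>\<one>\<close>.\<close>

lemma open_normal_avoiding:
  assumes "x \<in> carrier G" "x \<noteq> \<one>"
  obtains N where "open_normal N" "x \<notin> N"
proof -
  obtain U where U: "openin T U" "closedin T U" "\<one> \<in> U" "x \<notin> U"
    using clopen_separation[of \<one> x] assms by auto
  let ?N = "{g \<in> carrier G. \<forall>a\<in>carrier G. \<forall>b\<in>carrier G. a \<otimes> g \<otimes> b \<in> U \<longleftrightarrow> a \<otimes> b \<in> U}"
  have "x \<notin> ?N"
  proof
    assume "x \<in> ?N"
    then have "\<one> \<otimes> x \<otimes> \<one> \<in> U \<longleftrightarrow> \<one> \<otimes> \<one> \<in> U" by blast
    then show False using U assms by simp
  qed
  then show thesis using that clopen_translation_normal[OF U(1,2)] by blast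
qed

end

section \<open>Correcting lifts of the surface relation\<close>

context group
begin

lemma inv_mult_cancel:
  assumes "x \<in> carrier G" "y \<in> carrier G"
  shows "inv x \<otimes> (x \<otimes> y) = y" "x \<otimes> (inv x \<otimes> y) = y"
  using assms by (simp_all add: m_assoc[symmetric])

lemmas word_simps = m_assoc inv_mult_group inv_mult_cancel

lemma commutator_closed [simp]:
  assumes "x \<in> carrier G" "y \<in> carrier G"
  shows "commutator G x y \<in> carrier G"
  using assms by (simp add: commutator_def)

lemma foldr_mult_closed:
  assumes "\<And>i. i \<in> set xs \<Longrightarrow> f i \<in> carrier G" "z \<in> carrier G"
  shows "foldr (\<lambda>i y. f i \<otimes> y) xs z \<in> carrier G"
  using assms by (induction xs) auto

lemma foldr_mult_snoc:
  assumes "\<And>i. i \<in> set xs \<Longrightarrow> f i \<in> carrier G" "z \<in> carrier G"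
  shows "foldr (\<lambda>i y. f i \<otimes> y) xs z = foldr (\<lambda>i y. f i \<otimes> y) xs \<one> \<otimes> z"
  using assms by (induction xs) (auto simp: m_assoc foldr_mult_closed)

lemma ordered_prod_closed:
  assumes "\<And>i. i < n \<Longrightarrow> f i \<in> carrier G"
  shows "ordered_prod G f n \<in> carrier G"
  unfolding ordered_prod_def using assms by (intro foldr_mult_closed) auto

lemma ordered_prod_Suc:
  assumes "\<And>i. i \<le> n \<Longrightarrow> f i \<in> carrier G"
  shows "ordered_prod G f (Suc n) = ordered_prod G f n \<otimes> f n"
  using foldr_mult_snoc[of "[0..<n]" f "f n"] assms by (simp add: ordered_prod_def)

end

lemma set_mult_memI: "h \<in> H \<Longrightarrow> k \<in> K \<Longrightarrow> h \<otimes>\<^bsub>G\<^esub> k \<in> H <#>\<^bsub>G\<^esub> K"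
  unfolding set_mult_def by blast

lemma bounded_choice:
  assumes "\<And>i. i < n \<Longrightarrow> \<exists>x. P i x"
  shows "\<exists>f. \<forall>i<n::nat. P i (f i)"
  using assms by metis

lemma ordered_prod_0 [simp]: "ordered_prod G f 0 = \<one>\<^bsub>G\<^esub>"
  by (simp add: ordered_prod_def)

lemma ordered_prod_cong:
  assumes "\<And>i. i < n \<Longrightarrow> f i = h i"
  shows "ordered_prod G f n = ordered_prod G h n"
  unfolding ordered_prod_def using assms by (intro foldr_cong) auto

lemma (in group) ordered_prod_ind:
  assumes "P \<one>" "\<And>x y. P x \<Longrightarrow> P y \<Longrightarrow> P (x \<otimes> y)" "\<And>i. i < n \<Longrightarrow> f i \<in> carrier G"
    "\<And>i. i < n \<Longrightarrow> P (f i)"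
  shows "P (ordered_prod G f n)"
  using assms(3,4) by (induction n) (auto simp: ordered_prod_Suc assms(1,2))

lemma (in group_hom) hom_ordered_prod:
  assumes "\<And>i. i < n \<Longrightarrow> f i \<in> carrier G"
  shows "h (ordered_prod G f n) = ordered_prod H (\<lambda>i. h (f i)) n"
  using assms by (induction n) (auto simp: G.ordered_prod_Suc H.ordered_prod_Suc G.ordered_prod_closed)

lemma (in group_hom) hom_commutator:
  assumes "x \<in> carrier G" "y \<in> carrier G"
  shows "h (commutator G x y) = commutator H (h x) (h y)"
  using assms by (simp add: commutator_def)

locale abelian_normal = normal B L for B and L (structure) +
  assumes B_comm: "x \<in> B \<Longrightarrow> y \<in> B \<Longrightarrow> x \<otimes> y = y \<otimes> x"
begin

definition cj :: "'a \<Rightarrow> 'a \<Rightarrow> 'a" where "cj x b = x \<otimes> b \<otimes> inv x"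

text \<open>These are the elements that act on \<open>B\<close> as the identity modulo
  \<open>I\<close>, phrased so that \<open>I\<close> need not be normal in \<open>L\<close>.\<close>

definition fixmod :: "'a set \<Rightarrow> 'a set" where
  "fixmod I = {h \<in> carrier L. \<forall>b\<in>B. cj h b \<otimes> inv b \<in> I}"

lemma B_carrier [simp]: "b \<in> B \<Longrightarrow> b \<in> carrier L"
  using subset by blast

lemma B_lcomm: "x \<in> B \<Longrightarrow> y \<in> B \<Longrightarrow> z \<in> B \<Longrightarrow> x \<otimes> (y \<otimes> z) = y \<otimes> (x \<otimes> z)"
  by (metis B_comm B_carrier m_assoc)

lemmas B_ac = m_assoc B_comm B_lcomm

lemma cj_B [simp]: "x \<in> carrier L \<Longrightarrow> b \<in> B \<Longrightarrow> cj x b \<in> B"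
  unfolding cj_def by (rule inv_op_closed2)

lemma cj_closed [simp]: "x \<in> carrier L \<Longrightarrow> b \<in> carrier L \<Longrightarrow> cj x b \<in> carrier L"
  unfolding cj_def by simp

lemma cj_mult: "x \<in> carrier L \<Longrightarrow> y \<in> carrier L \<Longrightarrow> b \<in> carrier L \<Longrightarrow> cj (x \<otimes> y) b = cj x (cj y b)"
  unfolding cj_def by (simp add: word_simps)

lemma cj_dist: "x \<in> carrier L \<Longrightarrow> b \<in> carrier L \<Longrightarrow> c \<in> carrier L \<Longrightarrow> cj x (b \<otimes> c) = cj x b \<otimes> cj x c"
  unfolding cj_def by (simp add: word_simps)

lemma cj_inv: "x \<in> carrier L \<Longrightarrow> b \<in> carrier L \<Longrightarrow> cj x (inv b) = inv (cj x b)"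
  unfolding cj_def by (simp add: word_simps)

lemma cj_cancel:
  "x \<in> carrier L \<Longrightarrow> b \<in> carrier L \<Longrightarrow> cj x (cj (inv x) b) = b"
  "x \<in> carrier L \<Longrightarrow> b \<in> carrier L \<Longrightarrow> cj (inv x) (cj x b) = b"
  unfolding cj_def by (simp_all add: word_simps)

lemma fixmod_mono: "I \<subseteq> J \<Longrightarrow> fixmod I \<subseteq> fixmod J"
  unfolding fixmod_def by blast

text \<open>No invariance of \<open>I\<close> under conjugation is required: for a product the
  condition on \<open>x\<close> is applied to \<open>cj y b\<close>, which again lies in
  \<open>B\<close>, and the two defects multiply inside \<open>I\<close>.\<close>

lemma fixmod_subgroup:
  assumes I: "subgroup I L" "I \<subseteq> B"
  shows "subgroup (fixmod I) L"
proof
  show "fixmod I \<subseteq> carrier L" unfolding fixmod_def by blast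
  show "\<one> \<in> fixmod I"
    unfolding fixmod_def cj_def using subgroup.one_closed[OF I(1)] by simp
  show "x \<otimes> y \<in> fixmod I" if "x \<in> fixmod I" "y \<in> fixmod I" for x y
  proof -
    have xy: "x \<in> carrier L" "y \<in> carrier L" using that unfolding fixmod_def by auto
    have "cj (x \<otimes> y) b \<otimes> inv b \<in> I" if "b \<in> B" for b
    proof -
      have "(cj x (cj y b) \<otimes> inv (cj y b)) \<otimes> (cj y b \<otimes> inv b) \<in> I"
        using \<open>x \<in> fixmod I\<close> \<open>y \<in> fixmod I\<close> xy that unfolding fixmod_def
        by (intro subgroup.m_closed[OF I(1), of "_ \<otimes> _" "_ \<otimes> _"]) auto
      also have "(cj x (cj y b) \<otimes> inv (cj y b)) \<otimes> (cj y b \<otimes> inv b) = cj (x \<otimes> y) b \<otimes> inv b"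
        using xy that by (simp add: cj_mult word_simps)
      finally show ?thesis .
    qed
    then show ?thesis using xy unfolding fixmod_def by auto
  qed
  show "inv x \<in> fixmod I" if "x \<in> fixmod I" for x
  proof -
    have x: "x \<in> carrier L" using that unfolding fixmod_def by auto
    have "cj (inv x) b \<otimes> inv b \<in> I" if "b \<in> B" for b
    proof -
      have "inv (cj x (cj (inv x) b) \<otimes> inv (cj (inv x) b)) \<in> I"
        using \<open>x \<in> fixmod I\<close> x that unfolding fixmod_def
        by (intro subgroup.m_inv_closed[OF I(1)]) auto
      also have "inv (cj x (cj (inv x) b) \<otimes> inv (cj (inv x) b)) = cj (inv x) b \<otimes> inv b"
        using x that by (simp add: cj_cancel word_simps)
      finally show ?thesis .
    qed
    then show ?thesis using x unfolding fixmod_def by auto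
  qed
qed

text \<open>Since \<open>P\<close> acts trivially on \<open>B/I\<close>, corrections in \<open>J\<close> can be moved in front of \<open>P\<close> modulo \<open>I\<close>.\<close>
lemma coset_set_mult:
  assumes I: "subgroup I L" "I \<subseteq> B" and J: "subgroup J L" "J \<subseteq> B"
    and P: "P \<in> fixmod I" and x: "x \<in> carrier L"
    and V: "I #> P \<subseteq> V" "J #> x \<subseteq> W"
  shows "subgroup (I <#> J) L" "I <#> J \<subseteq> B" "I \<subseteq> I <#> J" "J \<subseteq> I <#> J"
    "(I <#> J) #> (P \<otimes> x) \<subseteq> V <#> W"
proof -
  have Pc: "P \<in> carrier L" using P unfolding fixmod_def by blast
  show "I <#> J \<subseteq> B" using I(2) J(2) m_closed unfolding set_mult_def by blast
  show "subgroup (I <#> J) L"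
  proof
    show "I <#> J \<subseteq> carrier L" using \<open>I <#> J \<subseteq> B\<close> subset by (rule subset_trans)
    have "\<one> \<otimes> \<one> \<in> I <#> J"
      using subgroup.one_closed[OF I(1)] subgroup.one_closed[OF J(1)] unfolding set_mult_def by blast
    then show "\<one> \<in> I <#> J" by simp
    show "x \<otimes> y \<in> I <#> J" if "x \<in> I <#> J" "y \<in> I <#> J" for x y
    proof -
      from that obtain i j i' j' where ij: "i \<in> I" "j \<in> J" "i' \<in> I" "j' \<in> J" "x = i \<otimes> j" "y = i' \<otimes> j'" unfolding set_mult_def by blast
      then have "i \<in> B" "j \<in> B" "i' \<in> B" "j' \<in> B" using I J by auto
      then have "x \<otimes> y = (i \<otimes> i') \<otimes> (j \<otimes> j')" using ij by (simp add: B_ac)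
      then show ?thesis
        using set_mult_memI subgroup.m_closed[OF I(1) ij(1,3)] subgroup.m_closed[OF J(1) ij(2,4)] by metis
    qed
    show "inv x \<in> I <#> J" if "x \<in> I <#> J" for x
    proof -
      from that obtain i j where ij: "i \<in> I" "j \<in> J" "x = i \<otimes> j" unfolding set_mult_def by blast
      then have "i \<in> B" "j \<in> B" using I J by auto
      then have "inv x = inv i \<otimes> inv j" using ij by (simp add: inv_mult_group B_ac)
      then show ?thesis
        using set_mult_memI subgroup.m_inv_closed[OF I(1) ij(1)] subgroup.m_inv_closed[OF J(1) ij(2)] by metis
    qed
  qed
  show "I \<subseteq> I <#> J"
  proof
    fix i assume "i \<in> I"
    then have "i = i \<otimes> \<one>" using I by auto
    then show "i \<in> I <#> J" using \<open>i \<in> I\<close> subgroup.one_closed[OF J(1)] unfolding set_mult_def by blast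
  qed
  show "J \<subseteq> I <#> J"
  proof
    fix i assume "i \<in> J"
    then have "i = \<one> \<otimes> i" using J by auto
    then show "i \<in> I <#> J" using \<open>i \<in> J\<close> subgroup.one_closed[OF I(1)] unfolding set_mult_def by blast
  qed
  show "(I <#> J) #> (P \<otimes> x) \<subseteq> V <#> W"
  proof
    fix z assume "z \<in> (I <#> J) #> (P \<otimes> x)"
    then obtain i j where ij: "i \<in> I" "j \<in> J" "z = i \<otimes> j \<otimes> (P \<otimes> x)"
      unfolding r_coset_def set_mult_def by blast
    then have B: "i \<in> B" "j \<in> B" using I J by auto
    have "cj P j \<otimes> inv j \<in> I" using P B unfolding fixmod_def by auto
    then have "i \<otimes> inv (cj P j \<otimes> inv j) \<in> I"
      using subgroup.m_closed[OF I(1) ij(1)] subgroup.m_inv_closed[OF I(1)] by metis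
    then have 1: "i \<otimes> inv (cj P j \<otimes> inv j) \<otimes> P \<in> V" using V(1) unfolding r_coset_def by blast
    have 2: "j \<otimes> x \<in> W" using V(2) ij unfolding r_coset_def by blast
    have "z = (i \<otimes> inv (cj P j \<otimes> inv j) \<otimes> P) \<otimes> (j \<otimes> x)"
      using ij(3) B Pc x by (simp add: cj_def word_simps)
    then show "z \<in> V <#> W" using set_mult_memI[OF 1 2] by metis
  qed
qed

text \<open>Since \<open>B\<close> is abelian, sending \<open>b\<close> to
  \<open>b \<otimes> inv (cj d b)\<close> is an endomorphism of \<open>B\<close>; its image
  \<open>J\<close> is \<open>(1 - d) B\<close> in additive notation. The identity \<open>b \<otimes>
  d \<otimes> inv b = b \<otimes> inv (cj d b) \<otimes> d\<close> makes every element of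
  \<open>J #> d\<close> a conjugate of \<open>d\<close>.\<close>

lemma conjugate_factor:
  assumes d: "d \<in> carrier L"
  obtains J where "subgroup J L" "J \<subseteq> B" "d \<in> fixmod J" "J #> d \<subseteq> {b \<otimes> d \<otimes> inv b | b. b \<in> B}"
proof
  let ?J = "{b \<otimes> inv (cj d b) | b. b \<in> B}"
  show "?J \<subseteq> B" using d by auto
  show "subgroup ?J L"
  proof
    show "?J \<subseteq> carrier L" using d by auto
    show "\<one> \<in> ?J" using d by (intro CollectI exI[of _ \<one>]) (auto simp: cj_def)
    show "x \<otimes> y \<in> ?J" if "x \<in> ?J" "y \<in> ?J" for x y
    proof -
      from that(1) obtain b where b: "b \<in> B" "x = b \<otimes> inv (cj d b)" by auto
      from that(2) obtain c where c: "c \<in> B" "y = c \<otimes> inv (cj d c)" by auto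
      have "x \<otimes> y = (b \<otimes> c) \<otimes> inv (cj d (b \<otimes> c))"
        using b c d by (simp add: cj_dist inv_mult_group B_ac)
      then show ?thesis using b c by auto
    qed
    show "inv x \<in> ?J" if "x \<in> ?J" for x
    proof -
      from that obtain b where b: "b \<in> B" "x = b \<otimes> inv (cj d b)" by auto
      then have "inv x = inv b \<otimes> inv (cj d (inv b))"
        using d by (simp add: cj_inv inv_mult_group B_ac)
      then show ?thesis using b by auto
    qed
  qed
  show "d \<in> fixmod ?J"
  proof -
    have "cj d b \<otimes> inv b = inv b \<otimes> inv (cj d (inv b))" if "b \<in> B" for b
      using d that by (simp add: cj_inv B_ac)
    then show ?thesis using d unfolding fixmod_def by auto
  qed
  show "?J #> d \<subseteq> {b \<otimes> d \<otimes> inv b | b. b \<in> B}"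
  proof
    fix z assume "z \<in> ?J #> d"
    then obtain b where b: "b \<in> B" "z = b \<otimes> inv (cj d b) \<otimes> d" unfolding r_coset_def by blast
    then have "z = b \<otimes> d \<otimes> inv b" using d by (simp add: cj_def word_simps)
    then show "z \<in> {b \<otimes> d \<otimes> inv b | b. b \<in> B}" using b by blast
  qed
qed

lemma fixmod_cong:
  assumes I: "subgroup I L" "I \<subseteq> B" and "x \<in> carrier L" "y \<in> carrier L" "x \<in> fixmod I"
    "\<And>b. b \<in> B \<Longrightarrow> cj y b \<otimes> inv (cj x b) \<in> I"
  shows "y \<in> fixmod I"
proof -
  have "cj y b \<otimes> inv b \<in> I" if "b \<in> B" for b
  proof -
    have "(cj y b \<otimes> inv (cj x b)) \<otimes> (cj x b \<otimes> inv b) \<in> I"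
      using assms that unfolding fixmod_def by (intro subgroup.m_closed[OF I(1), of "_ \<otimes> _" "_ \<otimes> _"]) auto
    then show ?thesis using assms that by (simp add: word_simps)
  qed
  then show ?thesis using assms unfolding fixmod_def by auto
qed

text \<open>Multiplying \<open>a\<close> and \<open>b\<close> by elements \<open>u\<close>,
  \<open>v\<close> of the abelian group \<open>B\<close> changes their commutator by a factor that
  is additive in the pair \<open>u\<close>, \<open>v\<close>. All possible factors therefore form a
  subgroup \<open>J\<close>.\<close>

lemma commutator_factor:
  assumes a: "a \<in> carrier L" and b: "b \<in> carrier L"
  obtains J where "subgroup J L" "J \<subseteq> B" "a \<in> fixmod J" "b \<in> fixmod J"
    "J #> commutator L a b \<subseteq> {commutator L (u \<otimes> a) (v \<otimes> b) | u v. u \<in> B \<and> v \<in> B}"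
proof
  define s where "s = a \<otimes> b \<otimes> inv a"
  define k where "k = commutator L a b"
  have s: "s \<in> carrier L" and k: "k \<in> carrier L" and ks: "k = s \<otimes> inv b"
    using a b by (auto simp: s_def k_def commutator_def)
  define \<psi> where "\<psi> u v = (u \<otimes> inv (cj s u)) \<otimes> (cj a v \<otimes> inv (cj k v))" for u v
  let ?J = "{\<psi> u v | u v. u \<in> B \<and> v \<in> B}"
  show JB: "?J \<subseteq> B" using a s k unfolding \<psi>_def by auto
  show J: "subgroup ?J L"
  proof
    show "?J \<subseteq> carrier L" using JB subset by (rule subset_trans)
    show "\<one> \<in> ?J" using a s k by (intro CollectI exI[of _ \<one>]) (auto simp: cj_def \<psi>_def)
    show "x \<otimes> y \<in> ?J" if "x \<in> ?J" "y \<in> ?J" for x y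
    proof -
      from that(1) obtain u v where uv: "u \<in> B" "v \<in> B" "x = \<psi> u v" by auto
      from that(2) obtain u' v' where uv': "u' \<in> B" "v' \<in> B" "y = \<psi> u' v'" by auto
      have "x \<otimes> y = \<psi> (u \<otimes> u') (v \<otimes> v')"
        using uv uv' a s k unfolding \<psi>_def by (simp add: cj_dist inv_mult_group B_ac)
      then show ?thesis using uv uv' by auto
    qed
    show "inv x \<in> ?J" if "x \<in> ?J" for x
    proof -
      from that obtain u v where uv: "u \<in> B" "v \<in> B" "x = \<psi> u v" by auto
      then have "inv x = \<psi> (inv u) (inv v)"
        using a s k unfolding \<psi>_def by (simp add: cj_inv inv_mult_group B_ac)
      then show ?thesis using uv by auto
    qed
  qed
  have 1: "u \<otimes> inv (cj s u) \<in> ?J" if "u \<in> B" for u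
  proof -
    have "u \<otimes> inv (cj s u) = \<psi> u \<one>" using a s k that unfolding \<psi>_def by (simp add: cj_def)
    then show ?thesis using that by (intro CollectI exI[of _ u] exI[of _ \<one>]) simp
  qed
  have 2: "cj a v \<otimes> inv (cj k v) \<in> ?J" if "v \<in> B" for v
  proof -
    have "cj a v \<otimes> inv (cj k v) = \<psi> \<one> v" using a s k that unfolding \<psi>_def by (simp add: cj_def)
    then show ?thesis using that by (intro CollectI exI[of _ v] exI[of _ \<one>]) simp
  qed
  have sfix: "s \<in> fixmod ?J"
  proof -
    have "cj s u \<otimes> inv u \<in> ?J" if "u \<in> B" for u
    proof -
      have "inv u \<otimes> inv (cj s (inv u)) \<in> ?J" using 1[of "inv u"] that by simp
      also have "inv u \<otimes> inv (cj s (inv u)) = cj s u \<otimes> inv u"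
        using s that by (simp add: cj_inv B_ac)
      finally show ?thesis .
    qed
    then show ?thesis using s unfolding fixmod_def by auto
  qed
  text \<open>Modulo \<open>J\<close> conjugation by \<open>a\<close> agrees with conjugation by \<open>k = s b\<inverse>\<close>, hence with
    that by \<open>b\<inverse>\<close>; so \<open>ab\<close> acts trivially, and \<open>s a = a b\<close> then shows that \<open>a\<close> does.\<close>
  have abfix: "a \<otimes> b \<in> fixmod ?J"
  proof (rule fixmod_cong[OF J JB s _ sfix])
    show "a \<otimes> b \<in> carrier L" using a b by simp
    fix v assume v: "v \<in> B"
    have "cj a (cj b v) \<otimes> inv (cj k (cj b v)) \<in> ?J" using 2 v b by simp
    also have "cj k (cj b v) = cj s v" unfolding ks using s b v by (simp add: cj_mult cj_cancel)
    finally show "cj (a \<otimes> b) v \<otimes> inv (cj s v) \<in> ?J" using a b v by (simp add: cj_mult)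
  qed
  note F = fixmod_subgroup[OF J JB]
  have "inv s \<otimes> (a \<otimes> b) = a" unfolding s_def using a b by (simp add: word_simps)
  with subgroup.m_closed[OF F subgroup.m_inv_closed[OF F sfix] abfix]
  show afix: "a \<in> fixmod ?J" by (simp only:)
  have "inv a \<otimes> (a \<otimes> b) = b" using a b by (simp add: word_simps)
  with subgroup.m_closed[OF F subgroup.m_inv_closed[OF F afix] abfix]
  show "b \<in> fixmod ?J" by (simp only:)
  show "?J #> commutator L a b \<subseteq> {commutator L (u \<otimes> a) (v \<otimes> b) | u v. u \<in> B \<and> v \<in> B}"
  proof
    fix z assume "z \<in> ?J #> commutator L a b"
    then obtain u v where uv: "u \<in> B" "v \<in> B" "z = \<psi> u v \<otimes> k" unfolding r_coset_def k_def by auto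
    have "commutator L (u \<otimes> a) (v \<otimes> b) = u \<otimes> cj a v \<otimes> inv (cj s u) \<otimes> inv (cj k v) \<otimes> k"
      using uv a b unfolding s_def k_def commutator_def cj_def by (simp add: word_simps)
    also have "u \<otimes> cj a v \<otimes> inv (cj s u) \<otimes> inv (cj k v) = \<psi> u v"
      using uv a s k unfolding \<psi>_def by (simp add: B_ac)
    finally show "z \<in> {commutator L (u \<otimes> a) (v \<otimes> b) | u v. u \<in> B \<and> v \<in> B}"
      using uv by (intro CollectI exI[of _ u] exI[of _ v]) simp
  qed
qed

text \<open>Induction with \<open>coset_set_mult\<close>: the product of the sets \<open>V i\<close>
  contains a full coset of a subgroup that contains every \<open>J i\<close>. That the partial
  product lies in \<open>fixmod I\<close> is part of the claim because the next step has to move its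
  corrections past this product.\<close>

lemma ordered_prod_factors:
  assumes "\<And>i. i < n \<Longrightarrow> subgroup (J i) L \<and> J i \<subseteq> B \<and> x i \<in> fixmod (J i) \<and> J i #> x i \<subseteq> V i"
    and "\<And>i. i < n \<Longrightarrow> V i \<subseteq> carrier L"
  shows "\<exists>I. subgroup I L \<and> I \<subseteq> B \<and> (\<forall>i<n. J i \<subseteq> I) \<and> ordered_prod L x n \<in> fixmod I
    \<and> I #> ordered_prod L x n \<subseteq> {ordered_prod L y n | y. \<forall>i<n. y i \<in> V i}"
  using assms
proof (induction n)
  case 0
  have "{\<one>} #> \<one> = {\<one>}" by (simp add: r_coset_def)
  then show ?case using subgroup.one_closed[OF fixmod_subgroup[OF triv_subgroup]]
    by (intro exI[of _ "{\<one>}"]) (auto simp: triv_subgroup)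
next
  case (Suc n)
  then obtain I where I: "subgroup I L" "I \<subseteq> B" "\<forall>i<n. J i \<subseteq> I" "ordered_prod L x n \<in> fixmod I"
    "I #> ordered_prod L x n \<subseteq> {ordered_prod L y n | y. \<forall>i<n. y i \<in> V i}" by force
  have J: "subgroup (J n) L" "J n \<subseteq> B" "x n \<in> fixmod (J n)" "J n #> x n \<subseteq> V n" using Suc.prems by auto
  have x: "x i \<in> carrier L" if "i \<le> n" for i
    using Suc.prems(1)[of i] that unfolding fixmod_def by auto
  note c = coset_set_mult[OF I(1,2) J(1,2) I(4) x[of n, simplified] I(5) J(4)]
  have 1: "\<forall>i<Suc n. J i \<subseteq> I <#> J n"
  proof (intro allI impI)
    fix i assume "i < Suc n"
    then consider "i < n" | "i = n" by linarith
    then show "J i \<subseteq> I <#> J n" using c(3,4) I(3) by cases auto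
  qed
  have xSuc: "ordered_prod L x (Suc n) = ordered_prod L x n \<otimes> x n" by (rule ordered_prod_Suc) (rule x)
  have 2: "ordered_prod L x (Suc n) \<in> fixmod (I <#> J n)"
    unfolding xSuc
    using I(4) J(3) fixmod_mono[OF c(3)] fixmod_mono[OF c(4)]
    by (intro subgroup.m_closed[OF fixmod_subgroup[OF c(1,2)]]) auto
  have 3: "{ordered_prod L y n | y. \<forall>i<n. y i \<in> V i} <#> V n \<subseteq> {ordered_prod L y (Suc n) | y. \<forall>i<Suc n. y i \<in> V i}"
  proof
    fix z assume "z \<in> {ordered_prod L y n | y. \<forall>i<n. y i \<in> V i} <#> V n"
    then obtain y w where y: "\<forall>i<n. y i \<in> V i" "w \<in> V n" "z = ordered_prod L y n \<otimes> w"
      unfolding set_mult_def by blast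
    let ?y = "y(n := w)"
    have V: "\<forall>i<Suc n. ?y i \<in> V i" using y by (auto simp: less_Suc_eq)
    have "ordered_prod L ?y (Suc n) = ordered_prod L ?y n \<otimes> ?y n"
      using V Suc.prems(2) by (intro ordered_prod_Suc) (metis in_mono less_Suc_eq_le)
    also have "ordered_prod L ?y n = ordered_prod L y n" by (intro ordered_prod_cong) auto
    finally have "z = ordered_prod L ?y (Suc n)" unfolding y(3) by (simp only: fun_upd_same)
    with V show "z \<in> {ordered_prod L y (Suc n) | y. \<forall>i<Suc n. y i \<in> V i}" by (intro CollectI exI conjI)
  qed
  show ?case
    using c 1 2 3 by (intro exI[of _ "I <#> J n"]) (auto simp: xSuc)
qed

text \<open>Lifts of the generators may be corrected by elements of \<open>B\<close>, the \<open>d j\<close> only up to conjugation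
  so that their orders persist. The corrections change the value of the relation by an arbitrary
  element of \<open>[B, H]\<close>, where \<open>H\<close> is generated by all \<open>a i\<close>, \<open>b i\<close>, \<open>d j\<close>; the hypothesis \<open>W\<close> says that
  the value lies there.\<close>
theorem solve_surface_relation:
  assumes ab: "\<And>i. i < g \<Longrightarrow> a i \<in> carrier L \<and> b i \<in> carrier L" and d: "\<And>j. j < k \<Longrightarrow> d j \<in> carrier L"
    and W: "\<And>I. subgroup I L \<Longrightarrow> I \<subseteq> B \<Longrightarrow> (\<And>i. i < g \<Longrightarrow> a i \<in> fixmod I \<and> b i \<in> fixmod I) \<Longrightarrow>
      (\<And>j. j < k \<Longrightarrow> d j \<in> fixmod I) \<Longrightarrow>
      ordered_prod L (\<lambda>i. commutator L (a i) (b i)) g \<otimes> ordered_prod L d k \<in> I"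
  obtains u v t where "\<And>i. i < g \<Longrightarrow> u i \<in> B \<and> v i \<in> B" "\<And>j. j < k \<Longrightarrow> t j \<in> B"
    "ordered_prod L (\<lambda>i. commutator L (u i \<otimes> a i) (v i \<otimes> b i)) g
      \<otimes> ordered_prod L (\<lambda>j. t j \<otimes> d j \<otimes> inv (t j)) k = \<one>"
proof -
  let ?c = "\<lambda>i. commutator L (a i) (b i)"
  let ?V = "\<lambda>i. {commutator L (u \<otimes> a i) (v \<otimes> b i) | u v. u \<in> B \<and> v \<in> B}"
  let ?W = "\<lambda>j. {b \<otimes> d j \<otimes> inv b | b. b \<in> B}"
  have "\<exists>J. subgroup J L \<and> J \<subseteq> B \<and> a i \<in> fixmod J \<and> b i \<in> fixmod J \<and> J #> ?c i \<subseteq> ?V i" if "i < g" for i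
    by (rule commutator_factor[OF conjunct1[OF ab[OF that]] conjunct2[OF ab[OF that]]]) (intro exI conjI)
  from bounded_choice[OF this] obtain J where J:
    "\<forall>i<g. subgroup (J i) L \<and> J i \<subseteq> B \<and> a i \<in> fixmod (J i) \<and> b i \<in> fixmod (J i) \<and> J i #> ?c i \<subseteq> ?V i" ..
  have "\<exists>J. subgroup J L \<and> J \<subseteq> B \<and> d j \<in> fixmod J \<and> J #> d j \<subseteq> ?W j" if "j < k" for j
    by (rule conjugate_factor[OF d[OF that]]) (intro exI conjI)
  from bounded_choice[OF this] obtain K where K:
    "\<forall>j<k. subgroup (K j) L \<and> K j \<subseteq> B \<and> d j \<in> fixmod (K j) \<and> K j #> d j \<subseteq> ?W j" ..
  have "?c i \<in> fixmod (J i)" if "i < g" for i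
  proof -
    have Ji: "subgroup (J i) L" "J i \<subseteq> B" "a i \<in> fixmod (J i)" "b i \<in> fixmod (J i)" using J that by auto
    note s = fixmod_subgroup[OF Ji(1,2)]
    show ?thesis unfolding commutator_def using Ji
      by (intro subgroup.m_closed[OF s] subgroup.m_inv_closed[OF s]) auto
  qed
  then have "\<exists>I. subgroup I L \<and> I \<subseteq> B \<and> (\<forall>i<g. J i \<subseteq> I) \<and> ordered_prod L ?c g \<in> fixmod I
    \<and> I #> ordered_prod L ?c g \<subseteq> {ordered_prod L y g | y. \<forall>i<g. y i \<in> ?V i}"
    using J ab by (intro ordered_prod_factors) auto
  then obtain I1 where I1: "subgroup I1 L" "I1 \<subseteq> B" "\<forall>i<g. J i \<subseteq> I1" "ordered_prod L ?c g \<in> fixmod I1"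
    "I1 #> ordered_prod L ?c g \<subseteq> {ordered_prod L y g | y. \<forall>i<g. y i \<in> ?V i}" by (elim exE conjE) (rule that)
  have "\<exists>I. subgroup I L \<and> I \<subseteq> B \<and> (\<forall>j<k. K j \<subseteq> I) \<and> ordered_prod L d k \<in> fixmod I
    \<and> I #> ordered_prod L d k \<subseteq> {ordered_prod L y k | y. \<forall>j<k. y j \<in> ?W j}"
    using K d by (intro ordered_prod_factors) auto
  then obtain I2 where I2: "subgroup I2 L" "I2 \<subseteq> B" "\<forall>j<k. K j \<subseteq> I2" "ordered_prod L d k \<in> fixmod I2"
    "I2 #> ordered_prod L d k \<subseteq> {ordered_prod L y k | y. \<forall>j<k. y j \<in> ?W j}" by (elim exE conjE) (rule that)
  note c = coset_set_mult[OF I1(1,2) I2(1,2) I1(4) _ I1(5) I2(5)]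
  let ?I = "I1 <#> I2"
  let ?P = "ordered_prod L ?c g \<otimes> ordered_prod L d k"
  have dk: "ordered_prod L d k \<in> carrier L" and cg: "ordered_prod L ?c g \<in> carrier L"
    using d ab by (auto intro!: ordered_prod_closed)
  have 1: "a i \<in> fixmod ?I \<and> b i \<in> fixmod ?I" if "i < g" for i
  proof -
    have "J i \<subseteq> ?I" using I1(3) that c(3)[OF dk] by blast
    then show ?thesis using J that fixmod_mono[of "J i" ?I] by blast
  qed
  have 2: "d j \<in> fixmod ?I" if "j < k" for j
  proof -
    have "K j \<subseteq> ?I" using I2(3) that c(4)[OF dk] by blast
    then show ?thesis using K that fixmod_mono[of "K j" ?I] by blast
  qed
  have "?P \<in> ?I" by (rule W[OF c(1,2)[OF dk]]) (use 1 2 in auto)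
  then have "inv ?P \<in> ?I" by (rule subgroup.m_inv_closed[OF c(1)[OF dk]])
  \<comment> \<open>Every element of the coset \<open>?I #> ?P\<close> is the value of the relation
    at suitably corrected lifts. As \<open>?P\<close> itself lies in \<open>?I\<close>, the identity
    is such an element.\<close>
  then have "inv ?P \<otimes> ?P \<in> ?I #> ?P" unfolding r_coset_def by (rule UN_I) (rule singletonI)
  then have "\<one> \<in> {ordered_prod L y g | y. \<forall>i<g. y i \<in> ?V i} <#> {ordered_prod L y k | y. \<forall>j<k. y j \<in> ?W j}"
    using c(5)[OF dk] dk cg by auto
  then obtain y z where yz: "\<forall>i<g. y i \<in> ?V i" "\<forall>j<k. z j \<in> ?W j"
    "\<one> = ordered_prod L y g \<otimes> ordered_prod L z k"
    unfolding set_mult_def by (simp only: UN_iff bex_simps mem_Collect_eq singleton_iff) (elim exE conjE, simp)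
  have "\<exists>p. fst p \<in> B \<and> snd p \<in> B \<and> y i = commutator L (fst p \<otimes> a i) (snd p \<otimes> b i)" if "i < g" for i
  proof -
    from yz(1) that obtain u v where "u \<in> B" "v \<in> B" "y i = commutator L (u \<otimes> a i) (v \<otimes> b i)" by auto
    then show ?thesis by (intro exI[of _ "(u, v)"]) simp
  qed
  from bounded_choice[OF this] obtain p where
    p: "\<forall>i<g. fst (p i) \<in> B \<and> snd (p i) \<in> B \<and> y i = commutator L (fst (p i) \<otimes> a i) (snd (p i) \<otimes> b i)" ..
  define u v where "u i = fst (p i)" and "v i = snd (p i)" for i
  have uv: "\<And>i. i < g \<Longrightarrow> u i \<in> B \<and> v i \<in> B \<and> y i = commutator L (u i \<otimes> a i) (v i \<otimes> b i)"
    using p unfolding u_def v_def by blast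
  have "\<exists>t. t \<in> B \<and> z j = t \<otimes> d j \<otimes> inv t" if "j < k" for j
    using yz(2) that by auto
  from bounded_choice[OF this] obtain t where t: "\<forall>j<k. t j \<in> B \<and> z j = t j \<otimes> d j \<otimes> inv (t j)" ..
  show thesis
  proof (rule that)
    show "\<And>i. i < g \<Longrightarrow> u i \<in> B \<and> v i \<in> B" "\<And>j. j < k \<Longrightarrow> t j \<in> B" using uv t by auto
    have "ordered_prod L y g = ordered_prod L (\<lambda>i. commutator L (u i \<otimes> a i) (v i \<otimes> b i)) g"
      "ordered_prod L z k = ordered_prod L (\<lambda>j. t j \<otimes> d j \<otimes> inv (t j)) k"
      using uv t by (auto intro!: ordered_prod_cong)
    then show "ordered_prod L (\<lambda>i. commutator L (u i \<otimes> a i) (v i \<otimes> b i)) g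
      \<otimes> ordered_prod L (\<lambda>j. t j \<otimes> d j \<otimes> inv (t j)) k = \<one>" using yz(3) by simp
  qed
qed

end

section \<open>Permutation modules\<close>

locale perm_module = Q: group Q for Q :: "('q, 'n) monoid_scheme" (structure) +
  fixes X :: "'x set" and act :: "'q \<Rightarrow> 'x \<Rightarrow> 'x" and m :: int
  assumes finite_X [simp]: "finite X"
    and act_closed [simp]: "q \<in> carrier Q \<Longrightarrow> x \<in> X \<Longrightarrow> act q x \<in> X"
    and act_one [simp]: "x \<in> X \<Longrightarrow> act \<one> x = x"
    and act_mult: "q \<in> carrier Q \<Longrightarrow> q' \<in> carrier Q \<Longrightarrow> x \<in> X \<Longrightarrow> act (q \<otimes> q') x = act q (act q' x)"
    and m_pos: "m > 0"
begin

lemma act_inv [simp]: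
  assumes "q \<in> carrier Q" "x \<in> X"
  shows "act (inv q) (act q x) = x" "act q (act (inv q) x) = x"
  using assms by (simp_all flip: act_mult)

lemma act_eq_iff:
  assumes "q \<in> carrier Q" "x \<in> X" "y \<in> X"
  shows "act (inv q) x = y \<longleftrightarrow> x = act q y"
  using assms by auto

lemma sum_act:
  assumes "q \<in> carrier Q"
  shows "(\<Sum>x\<in>X. f (act q x)) = (\<Sum>x\<in>X. f x)"
proof (rule sum.reindex_bij_betw)
  show "bij_betw (act q) X X"
    using assms by (intro bij_betw_byWitness[where f' = "act (inv q)"]) auto
qed

text \<open>Arbitrary integer functions are allowed as coordinates. Reduction modulo
  \<open>m\<close> and restriction to \<open>X\<close> are done here once, so that later
  computations use plain integers.\<close>

definition el :: "('x \<Rightarrow> int) \<Rightarrow> 'q \<Rightarrow> ('x \<Rightarrow> int) \<times> 'q" where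
  "el f q = (\<lambda>y\<in>X. f y mod m, q)"

text \<open>The semidirect product of \<open>(\<int>/m)\<^sup>X\<close> with \<open>Q\<close>.\<close>
definition sdp :: "(('x \<Rightarrow> int) \<times> 'q) monoid" where
  "sdp = \<lparr>carrier = (X \<rightarrow>\<^sub>E {0..<m}) \<times> carrier Q,
     monoid.mult = (\<lambda>x y. el (\<lambda>z. fst x z + fst y (act (inv snd x) z)) (snd x \<otimes> snd y)),
     one = el (\<lambda>_. 0) \<one>\<rparr>"

lemma snd_el [simp]: "snd (el f q) = q" by (simp add: el_def)

lemma fst_el: "y \<in> X \<Longrightarrow> fst (el f q) y = f y mod m" by (simp add: el_def)

lemma el_cong: "(\<And>y. y \<in> X \<Longrightarrow> f y mod m = f' y mod m) \<Longrightarrow> el f q = el f' q"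
  by (auto simp: el_def)

lemma el_eq_iff: "el f q = el f' q' \<longleftrightarrow> q = q' \<and> (\<forall>y\<in>X. f y mod m = f' y mod m)"
  by (auto simp: el_def fun_eq_iff restrict_def)

lemma el_closed [simp]: "q \<in> carrier Q \<Longrightarrow> el f q \<in> carrier sdp"
  using m_pos by (auto simp: el_def sdp_def)

lemma el_collapse:
  assumes "x \<in> carrier sdp" shows "el (fst x) (snd x) = x" "snd x \<in> carrier Q"
proof -
  obtain f q where x: "x = (f, q)" "f \<in> X \<rightarrow>\<^sub>E {0..<m}" "q \<in> carrier Q"
    using assms by (auto simp: sdp_def)
  have "(\<lambda>y\<in>X. f y mod m) = f"
  proof
    fix y show "(\<lambda>y\<in>X. f y mod m) y = f y"
      using x(2) by (cases "y \<in> X") (auto simp: PiE_def Pi_def extensional_def)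
  qed
  then show "el (fst x) (snd x) = x" "snd x \<in> carrier Q" using x by (simp_all add: el_def)
qed

lemma sdpE:
  assumes "x \<in> carrier sdp"
  obtains f q where "x = el f q" "q \<in> carrier Q"
  using el_collapse[OF assms] that by metis

lemma finite_sdp: "finite (carrier Q) \<Longrightarrow> finite (carrier sdp)"
  by (simp add: sdp_def finite_PiE)

lemma el_mult [simp]:
  assumes "q \<in> carrier Q" "q' \<in> carrier Q"
  shows "el f q \<otimes>\<^bsub>sdp\<^esub> el f' q' = el (\<lambda>y. f y + f' (act (inv q) y)) (q \<otimes> q')"
proof -
  have "el (\<lambda>z. fst (el f q) z + fst (el f' q') (act (inv q) z)) (q \<otimes> q')
     = el (\<lambda>y. f y + f' (act (inv q) y)) (q \<otimes> q')"
    using assms by (intro el_cong) (simp add: fst_el mod_simps)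
  then show ?thesis by (simp add: sdp_def)
qed

lemma one_sdp: "\<one>\<^bsub>sdp\<^esub> = el (\<lambda>_. 0) \<one>"
  by (simp add: sdp_def)

lemma group_sdp: "group sdp"
proof (rule groupI)
  show "\<one>\<^bsub>sdp\<^esub> \<in> carrier sdp" by (simp add: one_sdp)
  fix x assume x: "x \<in> carrier sdp"
  then obtain f q where 1: "x = el f q" "q \<in> carrier Q" by (rule sdpE)
  show "\<one>\<^bsub>sdp\<^esub> \<otimes>\<^bsub>sdp\<^esub> x = x" using 1 by (simp add: one_sdp el_eq_iff)
  show "\<exists>y\<in>carrier sdp. y \<otimes>\<^bsub>sdp\<^esub> x = \<one>\<^bsub>sdp\<^esub>"
    using 1 by (intro bexI[of _ "el (\<lambda>y. - f (act q y)) (inv q)"]) (simp_all add: one_sdp el_eq_iff)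
  fix y assume "y \<in> carrier sdp"
  then obtain f' q' where 2: "y = el f' q'" "q' \<in> carrier Q" by (rule sdpE)
  show "x \<otimes>\<^bsub>sdp\<^esub> y \<in> carrier sdp" using 1 2 by simp
  fix z assume "z \<in> carrier sdp"
  then obtain f'' q'' where 3: "z = el f'' q''" "q'' \<in> carrier Q" by (rule sdpE)
  show "x \<otimes>\<^bsub>sdp\<^esub> y \<otimes>\<^bsub>sdp\<^esub> z = x \<otimes>\<^bsub>sdp\<^esub> (y \<otimes>\<^bsub>sdp\<^esub> z)"
    using 1 2 3 by (simp add: el_eq_iff Q.m_assoc Q.inv_mult_group act_mult add.assoc)
qed

sublocale sdp: group sdp by (rule group_sdp)

lemma inv_el [simp]:
  assumes "q \<in> carrier Q"
  shows "inv\<^bsub>sdp\<^esub> (el f q) = el (\<lambda>y. - f (act q y)) (inv q)"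
  using assms by (intro sdp.inv_equality) (simp_all add: one_sdp el_eq_iff)

lemma snd_hom: "snd \<in> hom sdp Q"
  by (auto simp: hom_def sdp_def el_def)

lemma el_pow:
  assumes "q \<in> carrier Q"
  shows "el f q [^]\<^bsub>sdp\<^esub> n = el (\<lambda>y. \<Sum>i<n. f (act (inv (q [^] i)) y)) (q [^] (n::nat))"
proof (induction n)
  case 0 show ?case by (simp add: one_sdp)
next
  case (Suc n)
  then show ?case using assms by (simp add: el_eq_iff)
qed

text \<open>The augmentation of the permutation module. As \<open>Q\<close> only permutes
  coordinates, it is a homomorphism to the integers modulo \<open>m\<close>, and it vanishes on
  commutators.\<close>

definition tot :: "('x \<Rightarrow> int) \<times> 'q \<Rightarrow> int" where "tot x = (\<Sum>y\<in>X. fst x y) mod m"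

lemma tot_el: "tot (el f q) = (\<Sum>y\<in>X. f y) mod m"
proof -
  have "(\<Sum>y\<in>X. fst (el f q) y) = (\<Sum>y\<in>X. f y mod m)" by (intro sum.cong) (simp_all add: fst_el)
  then show ?thesis by (simp add: tot_def mod_sum_eq)
qed

lemma tot_mult:
  assumes "x \<in> carrier sdp" "y \<in> carrier sdp"
  shows "tot (x \<otimes>\<^bsub>sdp\<^esub> y) = (tot x + tot y) mod m"
proof -
  obtain f q where 1: "x = el f q" "q \<in> carrier Q" using assms(1) by (rule sdpE)
  obtain f' q' where 2: "y = el f' q'" "q' \<in> carrier Q" using assms(2) by (rule sdpE)
  show ?thesis using 1 2 sum_act[of "inv q" f'] by (simp add: tot_el sum.distrib mod_simps)
qed

lemma tot_one [simp]: "tot \<one>\<^bsub>sdp\<^esub> = 0"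
  by (simp add: one_sdp tot_el)

lemma tot_inv:
  assumes "x \<in> carrier sdp"
  shows "tot (inv\<^bsub>sdp\<^esub> x) = (- tot x) mod m"
proof -
  obtain f q where 1: "x = el f q" "q \<in> carrier Q" using assms(1) by (rule sdpE)
  then show ?thesis using sum_act[of q f] by (simp add: tot_el sum_negf mod_simps)
qed

lemma tot_commutator:
  assumes "x \<in> carrier sdp" "y \<in> carrier sdp"
  shows "tot (commutator sdp x y) = 0"
  using assms by (simp add: commutator_def tot_mult tot_inv mod_simps)

lemma tot_ordered_prod:
  assumes "\<And>i. i < n \<Longrightarrow> f i \<in> carrier sdp"
  shows "tot (ordered_prod sdp f n) = (\<Sum>i<n. tot (f i)) mod m"
  using assms
proof (induction n)
  case (Suc n)
  then have "ordered_prod sdp f (Suc n) = ordered_prod sdp f n \<otimes>\<^bsub>sdp\<^esub> f n"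
    by (intro sdp.ordered_prod_Suc) auto
  then show ?case using Suc by (simp add: tot_mult sdp.ordered_prod_closed mod_simps)
qed simp

text \<open>For \<open>d\<close> dividing \<open>m\<close> this is the kernel of the reduction of
  coefficients modulo \<open>d\<close>. The value \<open>d = 1\<close> gives the whole module and
  serves to refine quotients; \<open>d = n\<close> confines corrections to what is invisible modulo
  \<open>n\<close> in the torsion argument.\<close>

definition base :: "int \<Rightarrow> (('x \<Rightarrow> int) \<times> 'q) set" where
  "base d = {el f \<one> | f. \<forall>y\<in>X. d dvd f y}"

lemma base_abelian_normal: "abelian_normal (base d) sdp"
proof -
  have "subgroup (base d) sdp"
  proof
    show "base d \<subseteq> carrier sdp" by (auto simp: base_def)
    show "\<one>\<^bsub>sdp\<^esub> \<in> base d" by (auto simp: base_def one_sdp)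
    show "x \<otimes>\<^bsub>sdp\<^esub> y \<in> base d" if "x \<in> base d" "y \<in> base d" for x y
    proof -
      from that obtain f f' where f: "x = el f \<one>" "y = el f' \<one>" "\<forall>y\<in>X. d dvd f y" "\<forall>y\<in>X. d dvd f' y"
        unfolding base_def by auto
      then have "x \<otimes>\<^bsub>sdp\<^esub> y = el (\<lambda>y. f y + f' y) \<one>" by (simp add: el_eq_iff)
      then show ?thesis using f unfolding base_def by auto
    qed
    show "inv\<^bsub>sdp\<^esub> x \<in> base d" if "x \<in> base d" for x
    proof -
      from that obtain f where f: "x = el f \<one>" "\<forall>y\<in>X. d dvd f y" unfolding base_def by auto
      then have "inv\<^bsub>sdp\<^esub> x = el (\<lambda>y. - f y) \<one>" by (simp add: el_eq_iff)
      then show ?thesis using f unfolding base_def by auto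
    qed
  qed
  moreover have "h \<otimes>\<^bsub>sdp\<^esub> x \<otimes>\<^bsub>sdp\<^esub> inv\<^bsub>sdp\<^esub> h \<in> base d" if "h \<in> carrier sdp" "x \<in> base d" for h x
  proof -
    from that obtain f where f: "x = el f \<one>" "\<forall>y\<in>X. d dvd f y" unfolding base_def by auto
    obtain e q where h: "h = el e q" "q \<in> carrier Q" using \<open>h \<in> carrier sdp\<close> by (rule sdpE)
    have "h \<otimes>\<^bsub>sdp\<^esub> x \<otimes>\<^bsub>sdp\<^esub> inv\<^bsub>sdp\<^esub> h = el (\<lambda>y. f (act (inv q) y)) \<one>"
      using f h by (simp add: el_eq_iff)
    then show ?thesis using f h unfolding base_def by auto
  qed
  ultimately have "base d \<lhd> sdp" using sdp.normal_inv_iff by auto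
  moreover have "x \<otimes>\<^bsub>sdp\<^esub> y = y \<otimes>\<^bsub>sdp\<^esub> x" if "x \<in> base d" "y \<in> base d" for x y
    using that unfolding base_def by (auto simp: el_eq_iff add.commute)
  ultimately show ?thesis by (simp add: abelian_normal_def abelian_normal_axioms_def)
qed

text \<open>Modulo \<open>I\<close> all of \<open>Q\<close> acts trivially, yet it moves every point
  to every other. Hence a multiple of \<open>d\<close> placed at \<open>y\<close> equals, modulo
  \<open>I\<close>, the same multiple placed at a base point \<open>x\<close>, and a function with
  sum zero is a sum of such differences.\<close>

lemma sum_zero_in_submodule:
  assumes I: "subgroup I sdp" "I \<subseteq> base d"
    and triv: "\<And>q. q \<in> carrier Q \<Longrightarrow> \<exists>h\<in>abelian_normal.fixmod (base d) sdp I. snd h = q"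
    and trans: "\<And>x y. x \<in> X \<Longrightarrow> y \<in> X \<Longrightarrow> \<exists>q\<in>carrier Q. act q x = y"
    and w: "\<And>y. y \<in> X \<Longrightarrow> d dvd w y" "m dvd (\<Sum>y\<in>X. w y)"
  shows "el w \<one> \<in> I"
proof (cases "X = {}")
  case True
  then have "el w \<one> = \<one>\<^bsub>sdp\<^esub>" unfolding one_sdp by (intro el_cong) blast
  then show ?thesis using subgroup.one_closed[OF I(1)] by simp
next
  case False
  then obtain x where x: "x \<in> X" by blast
  interpret B: abelian_normal "base d" sdp by (rule base_abelian_normal)
  have move: "el (\<lambda>z. (if z = y then c else 0) - (if z = x then c else 0)) \<one> \<in> I"
    if y: "y \<in> X" and c: "d dvd c" for y c
  proof -
    obtain q where q: "q \<in> carrier Q" "act q y = x" using trans[OF y x] by blast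
    obtain h where h: "h \<in> B.fixmod I" "snd h = q" using triv[OF q(1)] by blast
    then have "h \<in> carrier sdp" unfolding B.fixmod_def by blast
    then obtain e where h': "h = el e q" using h(2) by (metis sdpE snd_el)
    \<comment> \<open>An element moving \<open>y\<close> to \<open>x\<close> shifts this function
      from \<open>y\<close> to \<open>x\<close>. With the minus sign, the difference of the shifted
      and the original function is \<open>c\<close> at \<open>y\<close> and \<open>- c\<close> at
      \<open>x\<close>.\<close>
    let ?f = "\<lambda>z. if z = y then - c else 0"
    have "el ?f \<one> \<in> base d" using c unfolding base_def by auto
    then have "B.cj h (el ?f \<one>) \<otimes>\<^bsub>sdp\<^esub> inv\<^bsub>sdp\<^esub> (el ?f \<one>) \<in> I"
      using h(1) unfolding B.fixmod_def by blast
    also have "B.cj h (el ?f \<one>) \<otimes>\<^bsub>sdp\<^esub> inv\<^bsub>sdp\<^esub> (el ?f \<one>)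
      = el (\<lambda>z. (if z = y then c else 0) - (if z = x then c else 0)) \<one>"
      unfolding B.cj_def h' using q y act_eq_iff[OF q(1) _ y] by (auto simp: el_eq_iff)
    finally show ?thesis .
  qed
  \<comment> \<open>The values on \<open>Y\<close> are collected one at a time and their sum is
    subtracted at the base point \<open>x\<close>. For \<open>Y = X - {x}\<close> the coefficient at
    \<open>x\<close> is then \<open>w x\<close> modulo \<open>m\<close>, because the total sum
    vanishes.\<close>
  have "el (\<lambda>z. (if z \<in> Y then w z else 0) - (if z = x then \<Sum>y\<in>Y. w y else 0)) \<one> \<in> I"
    if "Y \<subseteq> X - {x}" for Y
    using finite_subset[OF that finite_Diff[OF finite_X]] that
  proof (induction Y rule: finite_induct)
    case empty
    then show ?case using subgroup.one_closed[OF I(1)] by (simp add: one_sdp cong: if_cong)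
  next
    case (insert y Y)
    let ?F = "\<lambda>Y z. (if z \<in> Y then w z else 0) - (if z = x then \<Sum>y\<in>Y. w y else 0)"
    let ?G = "\<lambda>z. (if z = y then w y else 0) - (if z = x then w y else 0)"
    have "el (?F Y) \<one> \<otimes>\<^bsub>sdp\<^esub> el ?G \<one> \<in> I"
      using insert w by (intro subgroup.m_closed[OF I(1)] move) auto
    also have "el (?F Y) \<one> \<otimes>\<^bsub>sdp\<^esub> el ?G \<one> = el (\<lambda>z. ?F Y z + ?G z) \<one>"
      by (simp add: el_eq_iff)
    also have "\<dots> = el (?F (insert y Y)) \<one>"
      using insert by (intro el_cong arg_cong[where f = "\<lambda>i. i mod m"]) auto
    finally show ?case .
  qed
  from this[of "X - {x}"]
  have "el (\<lambda>z. (if z \<in> X - {x} then w z else 0) - (if z = x then \<Sum>y\<in>X - {x}. w y else 0)) \<one> \<in> I" by simp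
  moreover have "el (\<lambda>z. (if z \<in> X - {x} then w z else 0) - (if z = x then \<Sum>y\<in>X - {x}. w y else 0)) \<one>
     = el w \<one>"
  proof (rule el_cong)
    fix z assume z: "z \<in> X"
    have "(\<Sum>y\<in>X. w y) = w x + (\<Sum>y\<in>X - {x}. w y)" using x by (simp add: sum.remove)
    then have "- (\<Sum>y\<in>X - {x}. w y) = w x - (\<Sum>y\<in>X. w y)" by simp
    moreover have "(w x - (\<Sum>y\<in>X. w y)) mod m = w x mod m"
      using w(2) by (metis diff_zero dvd_imp_mod_0 mod_diff_right_eq)
    ultimately show "((if z \<in> X - {x} then w z else 0) - (if z = x then \<Sum>y\<in>X - {x}. w y else 0)) mod m = w z mod m"
      using z by auto
  qed
  ultimately show ?thesis by simp
qed

text \<open>The elements acting trivially on \<open>base d\<close> modulo \<open>I\<close> form a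
  subgroup. If it contains the lifts, it maps onto \<open>Q\<close>, because they project to
  generators. The value of the relation has augmentation zero, by \<open>tot0\<close> and because
  commutators contribute nothing, so \<open>sum_zero_in_submodule\<close> puts it in
  \<open>I\<close>.\<close>

theorem solve_lifted_relation:
  assumes trans: "\<And>x y. x \<in> X \<Longrightarrow> y \<in> X \<Longrightarrow> \<exists>q\<in>carrier Q. act q x = y"
    and ab: "\<And>i. i < g \<Longrightarrow> a i \<in> carrier sdp \<and> b i \<in> carrier sdp"
    and c: "\<And>j. j < k \<Longrightarrow> c j \<in> carrier sdp"
    and gen: "generate Q ((snd \<circ> a) ` {..<g} \<union> (snd \<circ> b) ` {..<g} \<union> (snd \<circ> c) ` {..<k}) = carrier Q"
    and W: "ordered_prod sdp (\<lambda>i. commutator sdp (a i) (b i)) g \<otimes>\<^bsub>sdp\<^esub> ordered_prod sdp c k \<in> base d"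
    and tot0: "(\<Sum>j<k. tot (c j)) mod m = 0" and dm: "d dvd m"
  obtains u v t where "\<And>i. i < g \<Longrightarrow> u i \<in> base d \<and> v i \<in> base d" "\<And>j. j < k \<Longrightarrow> t j \<in> base d"
    "ordered_prod sdp (\<lambda>i. commutator sdp (u i \<otimes>\<^bsub>sdp\<^esub> a i) (v i \<otimes>\<^bsub>sdp\<^esub> b i)) g
      \<otimes>\<^bsub>sdp\<^esub> ordered_prod sdp (\<lambda>j. t j \<otimes>\<^bsub>sdp\<^esub> c j \<otimes>\<^bsub>sdp\<^esub> inv\<^bsub>sdp\<^esub> (t j)) k = \<one>\<^bsub>sdp\<^esub>"
proof -
  interpret B: abelian_normal "base d" sdp by (rule base_abelian_normal)
  let ?C = "ordered_prod sdp (\<lambda>i. commutator sdp (a i) (b i)) g" and ?D = "ordered_prod sdp c k"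
  have CD: "?C \<in> carrier sdp" "?D \<in> carrier sdp"
    using ab c by (auto intro!: sdp.ordered_prod_closed)
  have "tot ?C = 0" using ab by (subst tot_ordered_prod) (auto simp: tot_commutator)
  moreover have "tot ?D = 0" using c tot0 by (subst tot_ordered_prod) auto
  ultimately have tot: "tot (?C \<otimes>\<^bsub>sdp\<^esub> ?D) = 0" using CD by (simp add: tot_mult)
  obtain w where w: "?C \<otimes>\<^bsub>sdp\<^esub> ?D = el w \<one>" "\<forall>y\<in>X. d dvd w y" using W unfolding base_def by blast
  have "m dvd (\<Sum>y\<in>X. w y)" using tot unfolding w(1) tot_el by (simp add: dvd_eq_mod_eq_0)
  show thesis
  proof (rule B.solve_surface_relation[of g a b k c])
    show "\<And>i. i < g \<Longrightarrow> a i \<in> carrier sdp \<and> b i \<in> carrier sdp" "\<And>j. j < k \<Longrightarrow> c j \<in> carrier sdp"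
      by (fact ab, fact c)
    fix I assume I: "subgroup I sdp" "I \<subseteq> base d" "\<And>i. i < g \<Longrightarrow> a i \<in> B.fixmod I \<and> b i \<in> B.fixmod I"
      "\<And>j. j < k \<Longrightarrow> c j \<in> B.fixmod I"
    interpret snd: group_hom sdp Q snd
      using snd_hom by (simp add: group_hom_def group_hom_axioms_def Q.is_group group_sdp)
    have "subgroup (snd ` B.fixmod I) Q"
      by (rule snd.subgroup_img_is_subgroup[OF B.fixmod_subgroup[OF I(1,2)]])
    then have "generate Q ((snd \<circ> a) ` {..<g} \<union> (snd \<circ> b) ` {..<g} \<union> (snd \<circ> c) ` {..<k}) \<subseteq> snd ` B.fixmod I"
      using I(3,4) by (intro Q.generate_subgroup_incl) auto
    then have "\<exists>h\<in>B.fixmod I. snd h = q" if "q \<in> carrier Q" for q using gen that by auto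
    then show "?C \<otimes>\<^bsub>sdp\<^esub> ?D \<in> I"
      unfolding w(1) using sum_zero_in_submodule[OF I(1,2) _ trans _ \<open>m dvd _\<close>] w(2) by blast
  next
    fix u v t assume "\<And>i. i < g \<Longrightarrow> u i \<in> base d \<and> v i \<in> base d" "\<And>j. j < k \<Longrightarrow> t j \<in> base d"
      "ordered_prod sdp (\<lambda>i. commutator sdp (u i \<otimes>\<^bsub>sdp\<^esub> a i) (v i \<otimes>\<^bsub>sdp\<^esub> b i)) g
      \<otimes>\<^bsub>sdp\<^esub> ordered_prod sdp (\<lambda>j. t j \<otimes>\<^bsub>sdp\<^esub> c j \<otimes>\<^bsub>sdp\<^esub> inv\<^bsub>sdp\<^esub> (t j)) k = \<one>\<^bsub>sdp\<^esub>"
    then show thesis by (rule that)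
  qed
qed

end

section \<open>Profinite F-groups and their finite quotients\<close>

definition der :: "('a, 'm) monoid_scheme \<Rightarrow> nat \<Rightarrow> 'a set" where
  "der G n = (derived G ^^ n) (carrier G)"

lemma der_0 [simp]: "der G 0 = carrier G" and der_Suc: "der G (Suc n) = derived G (der G n)"
  by (simp_all add: der_def)

context group
begin

lemma der_carrier: "der G n \<subseteq> carrier G"
  unfolding der_def by (rule exp_of_derived_in_carrier) simp

lemma der_subgroup: "subgroup (der G n) G"
  unfolding der_def by (rule exp_of_derived_is_subgroup) (rule subgroup_self)

lemma der_decreasing:
  assumes "i \<le> n" shows "der G n \<subseteq> der G i"
  using assms
proof (induction rule: dec_induct)
  case (step n)
  have "der G (Suc n) \<subseteq> der G n" unfolding der_Suc by (rule derived_incl[OF order_refl der_subgroup])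
  then show ?case using step by blast
qed simp

lemma der_normal: "der G n \<lhd> G"
  by (induction n) (simp_all add: normal_self der_Suc derived_is_normal)

lemma der_trivial_mono:
  assumes "der G i = {\<one>}" "i \<le> n" shows "der G n = {\<one>}"
  using der_decreasing[OF assms(2)] subgroup.one_closed[OF der_subgroup] assms(1) by blast

lemma quotient_one_iff:
  assumes "subgroup N G" "x \<in> carrier G"
  shows "N #> x = N \<longleftrightarrow> x \<in> N"
  using assms coset_join1[OF _ assms(2,1)] coset_join2[OF assms(2,1)] subgroup.subset[OF assms(1)] by blast

end

lemma (in normal) quotient_hom: "group_hom G (G Mod H) (\<lambda>x. H #> x)"
  using r_coset_hom_Mod factorgroup_is_group is_group by (simp add: group_hom_def group_hom_axioms_def)

lemma (in group_hom) der_image: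
  assumes "h ` carrier G = carrier H" shows "der H n = h ` der G n"
  unfolding der_def using exp_of_derived_img[of "carrier G" n] assms by simp

lemma (in group_hom) der_image_subset: "h ` der G n \<subseteq> der H n"
proof -
  have "h ` carrier G \<subseteq> carrier H" by auto
  then show ?thesis
    unfolding der_def using exp_of_derived_img[of "carrier G" n] H.mono_exp_of_derived by (metis order_refl)
qed

context normal
begin

lemma der_quotient: "der (G Mod H) n = (\<lambda>x. H #> x) ` der G n"
  by (intro group_hom.der_image quotient_hom) (simp add: carrier_FactGroup)

lemma der_quotient_trivial_iff: "der (G Mod H) n = {\<one>\<^bsub>G Mod H\<^esub>} \<longleftrightarrow> der G n \<subseteq> H"
proof
  assume "der (G Mod H) n = {\<one>\<^bsub>G Mod H\<^esub>}"
  then have "H #> x = H" if "x \<in> der G n" for x using that unfolding der_quotient by auto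
  then show "der G n \<subseteq> H" using quotient_one_iff[OF subgroup_axioms] der_carrier by blast
next
  assume "der G n \<subseteq> H"
  then have "H #> x = H" if "x \<in> der G n" for x
    using quotient_one_iff[OF subgroup_axioms] der_carrier that by blast
  moreover have "\<one> \<in> der G n" using subgroup.one_closed[OF der_subgroup] .
  ultimately show "der (G Mod H) n = {\<one>\<^bsub>G Mod H\<^esub>}" unfolding der_quotient by (auto simp: image_iff)
qed

lemma comm_quotient_iff: "comm_group (G Mod H) \<longleftrightarrow> der G 1 \<subseteq> H"
proof
  assume "comm_group (G Mod H)"
  then have "derived (G Mod H) (carrier (G Mod H)) = {\<one>\<^bsub>G Mod H\<^esub>}"
    by (intro comm_group.derived_eq_singleton) auto
  then have "der (G Mod H) 1 = {\<one>\<^bsub>G Mod H\<^esub>}" by (simp add: der_def)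
  then show "der G 1 \<subseteq> H" by (simp only: der_quotient_trivial_iff)
next
  assume D: "der G 1 \<subseteq> H"
  interpret Q: group "G Mod H" by (rule factorgroup_is_group)
  show "comm_group (G Mod H)"
  proof (rule Q.group_comm_groupI)
    fix X Y assume XY: "X \<in> carrier (G Mod H)" "Y \<in> carrier (G Mod H)"
    then have "commutator (G Mod H) X Y \<in> der (G Mod H) 1"
      by (simp add: der_def commutator_in_derived)
    moreover have "der (G Mod H) 1 = {\<one>\<^bsub>G Mod H\<^esub>}" using D by (simp only: der_quotient_trivial_iff)
    ultimately have "commutator (G Mod H) X Y = \<one>\<^bsub>G Mod H\<^esub>" by blast
    then have "X \<otimes>\<^bsub>G Mod H\<^esub> Y \<otimes>\<^bsub>G Mod H\<^esub> inv\<^bsub>G Mod H\<^esub> (Y \<otimes>\<^bsub>G Mod H\<^esub> X) = \<one>\<^bsub>G Mod H\<^esub>"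
      using XY by (simp add: commutator_def Q.inv_mult_group Q.m_assoc del: mult_FactGroup one_FactGroup)
    then show "X \<otimes>\<^bsub>G Mod H\<^esub> Y = Y \<otimes>\<^bsub>G Mod H\<^esub> X"
      using XY by (metis Q.inv_closed Q.inv_equality Q.inv_inv Q.m_closed)
  qed
qed

end

lemma (in group_hom) der_subset_kernel:
  assumes "der H n = {\<one>\<^bsub>H\<^esub>}" shows "der G n \<subseteq> kernel G H h"
  using der_image_subset[of n] assms G.der_carrier[of n] by (auto simp: kernel_def)

lemma INF_enat_le_iff: "(INF k\<in>A. enat k) \<le> enat n \<longleftrightarrow> (\<exists>k\<in>A. k \<le> n)"
proof
  show "\<exists>k\<in>A. k \<le> n" if "(INF k\<in>A. enat k) \<le> enat n"
  proof (rule ccontr)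
    assume "\<not> (\<exists>k\<in>A. k \<le> n)"
    then have "enat (Suc n) \<le> enat k" if "k \<in> A" for k using that by (auto simp: not_le Suc_le_eq)
    then have "enat (Suc n) \<le> (INF k\<in>A. enat k)" by (intro INF_greatest)
    then show False using that by (metis Suc_n_not_le_n enat_ord_simps(1) order_trans)
  qed
  show "(INF k\<in>A. enat k) \<le> enat n" if "\<exists>k\<in>A. k \<le> n"
    using that by (metis INF_lower2 enat_ord_simps(1))
qed

context top_group
begin

lemma quotient_topology_discrete:
  assumes "open_normal N"
  shows "quotient_topology G T N = discrete_topology (carrier (G Mod N))"
proof -
  note N = open_normalD[OF assms]
  have "openin (quotient_topology G T N) {C}" if "C \<in> carrier (G Mod N)" for C
  proof -
    from that obtain a where a: "a \<in> carrier G" "C = N #> a" by (auto simp: carrier_FactGroup)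
    have "{x \<in> topspace T. N #> x \<in> {C}} = N #> a"
    proof
      show "{x \<in> topspace T. N #> x \<in> {C}} \<subseteq> N #> a" using a rcos_self[OF _ N(3)] by auto
      show "N #> a \<subseteq> {x \<in> topspace T. N #> x \<in> {C}}"
        using a repr_independence[OF _ _ N(3)] r_coset_subset_G[OF subgroup.subset[OF N(3)] a(1)] by auto
    qed
    then show ?thesis using openin_r_coset[OF N(1) a(1)] that by (simp add: openin_quotient_topology)
  qed
  moreover have "topspace (quotient_topology G T N) = carrier (G Mod N)"
  proof
    show "topspace (quotient_topology G T N) \<subseteq> carrier (G Mod N)"
      using openin_topspace[of "quotient_topology G T N"] unfolding openin_quotient_topology by blast
    show "carrier (G Mod N) \<subseteq> topspace (quotient_topology G T N)"
      using calculation openin_subset by blast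
  qed
  ultimately show ?thesis by (metis discrete_topology_unique)
qed

text \<open>The quotient by an open normal subgroup is discrete, so closures change nothing and its
  closed derived series is the abstract one. From here on derived lengths are handled through
  \<open>der G n \<subseteq> N\<close>.\<close>

lemma derived_length_quotient:
  assumes "open_normal N"
  shows "derived_length (G Mod N) (quotient_topology G T N) \<le> enat n \<longleftrightarrow> der G n \<subseteq> N"
proof -
  interpret normal N G using open_normalD(2)[OF assms] .
  interpret Q: group "G Mod N" by (rule factorgroup_is_group)
  have "closed_derived (G Mod N) (quotient_topology G T N) k = der (G Mod N) k" for k
  proof (induction k)
    case (Suc k)
    have "derived (G Mod N) (der (G Mod N) k) \<subseteq> carrier (G Mod N)"
      using Q.der_carrier[of "Suc k"] by (simp add: der_Suc)
    then show ?case using Suc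
      by (simp add: quotient_topology_discrete[OF assms] discrete_topology_closure_of der_Suc inf_absorb2)
  qed simp
  then have "derived_length (G Mod N) (quotient_topology G T N) \<le> enat n
    \<longleftrightarrow> (\<exists>k\<le>n. der (G Mod N) k = {\<one>\<^bsub>G Mod N\<^esub>})"
    unfolding derived_length_def INF_enat_le_iff by auto
  also have "\<dots> \<longleftrightarrow> der (G Mod N) n = {\<one>\<^bsub>G Mod N\<^esub>}"
    by (rule iffI, elim exE conjE, erule Q.der_trivial_mono, assumption, intro exI[of _ n] conjI order_refl)
  finally show ?thesis by (simp only: der_quotient_trivial_iff)
qed

end

section \<open>The universal property for finite groups\<close>

lemma F_relations_hom:
  assumes "group_hom K L h" "F_relations K g r ns a b c d"
  shows "F_relations L g r ns (\<lambda>i. h (a i)) (\<lambda>i. h (b i)) (\<lambda>i. h (c i)) (\<lambda>i. h (d i))"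
proof -
  interpret group_hom K L h by fact
  have cl: "\<And>i. i < g \<Longrightarrow> a i \<in> carrier K \<and> b i \<in> carrier K" "\<And>j. j < r \<Longrightarrow> c j \<in> carrier K"
    "\<And>l. l < length ns \<Longrightarrow> d l \<in> carrier K"
    and rel: "ordered_prod K (\<lambda>i. commutator K (a i) (b i)) g
       \<otimes>\<^bsub>K\<^esub> ordered_prod K c r \<otimes>\<^bsub>K\<^esub> ordered_prod K d (length ns) = \<one>\<^bsub>K\<^esub>"
    and pow: "\<And>l. l < length ns \<Longrightarrow> d l [^]\<^bsub>K\<^esub> (ns ! l) = \<one>\<^bsub>K\<^esub>"
    using assms(2) unfolding F_relations_def by blast+
  have "ordered_prod L (\<lambda>i. commutator L (h (a i)) (h (b i))) g = h (ordered_prod K (\<lambda>i. commutator K (a i) (b i)) g)"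
    using cl by (subst hom_ordered_prod) (auto simp: hom_commutator intro!: ordered_prod_cong)
  moreover have "ordered_prod L (\<lambda>i. h (c i)) r = h (ordered_prod K c r)"
    "ordered_prod L (\<lambda>i. h (d i)) (length ns) = h (ordered_prod K d (length ns))"
    using cl by (auto simp: hom_ordered_prod)
  ultimately have "ordered_prod L (\<lambda>i. commutator L (h (a i)) (h (b i))) g \<otimes>\<^bsub>L\<^esub> ordered_prod L (\<lambda>i. h (c i)) r
    \<otimes>\<^bsub>L\<^esub> ordered_prod L (\<lambda>i. h (d i)) (length ns)
    = h (ordered_prod K (\<lambda>i. commutator K (a i) (b i)) g \<otimes>\<^bsub>K\<^esub> ordered_prod K c r \<otimes>\<^bsub>K\<^esub> ordered_prod K d (length ns))"
    using cl by (simp add: G.ordered_prod_closed)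
  then show ?thesis
    unfolding F_relations_def using cl rel pow by (simp flip: hom_nat_pow)
qed

lemma discrete_profinite_group:
  assumes "group H" "finite (carrier H)"
  shows "profinite_group H (discrete_topology (carrier H))"
proof -
  interpret group H by fact
  have "topological_group H (discrete_topology (carrier H))"
    unfolding topological_group_def
    by (auto simp flip: prod_topology_discrete_topology simp: is_group)
  then show ?thesis
    unfolding profinite_group_def using assms(2)
    by (auto simp: compact_space_discrete_topology connectedin_discrete_topology)
qed

text \<open>The universal property in \<open>F_presentation\<close> tests only groups of type
  \<open>nat set monoid\<close>. A finite group of any other type is copied there, with singletons
  as elements.\<close>

lemma transport_to_nat_set:
  assumes "group K" "finite (carrier K)"
  obtains H :: "nat set monoid" and e e' where "group H" "finite (carrier H)" "e \<in> hom K H" "e' \<in> hom H K"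
    "\<And>x. x \<in> carrier K \<Longrightarrow> e' (e x) = x" "\<And>x. x \<in> carrier H \<Longrightarrow> e (e' x) = x"
proof -
  interpret K: group K by fact
  obtain f :: "'a \<Rightarrow> nat" where f: "inj_on f (carrier K)"
    using finite_imp_inj_to_nat_seg[OF assms(2)] by blast
  define e where "e x = {f x}" for x
  define e' where "e' = inv_into (carrier K) e"
  define H :: "nat set monoid" where
    "H = \<lparr>carrier = e ` carrier K, monoid.mult = (\<lambda>A B. e (e' A \<otimes>\<^bsub>K\<^esub> e' B)), one = e \<one>\<^bsub>K\<^esub>\<rparr>"
  have "inj_on e (carrier K)" using f by (auto simp: inj_on_def e_def)
  then have e'e: "e' (e x) = x" if "x \<in> carrier K" for x
    using that by (simp add: e'_def inv_into_f_f)
  have "group H"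
  proof (rule groupI)
    fix x assume "x \<in> carrier H"
    then obtain a where a: "x = e a" "a \<in> carrier K" by (auto simp: H_def)
    show "\<one>\<^bsub>H\<^esub> \<otimes>\<^bsub>H\<^esub> x = x" using a by (simp add: H_def e'e)
    show "\<exists>y\<in>carrier H. y \<otimes>\<^bsub>H\<^esub> x = \<one>\<^bsub>H\<^esub>"
      using a by (intro bexI[of _ "e (inv\<^bsub>K\<^esub> a)"]) (auto simp: H_def e'e)
  qed (auto simp: H_def e'e K.m_assoc)
  then show thesis
    by (rule that[of H e e']) (auto simp: H_def e'e hom_def assms(2))
qed

locale F_group =
  fixes G :: "('a, 'm) monoid_scheme" (structure) and T :: "'a topology"
    and g r :: nat and ns :: "nat list" and \<alpha> \<beta> \<gamma> \<delta> :: "nat \<Rightarrow> 'a"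
  assumes presentation: "F_presentation G T g r ns \<alpha> \<beta> \<gamma> \<delta>"

sublocale F_group \<subseteq> profinite_grp
  using presentation unfolding F_presentation_def by unfold_locales blast

context F_group
begin

definition gens :: "'a set" where
  "gens = \<alpha> ` {..<g} \<union> \<beta> ` {..<g} \<union> \<gamma> ` {..<r} \<union> \<delta> ` {..<length ns}"

lemma relations: "F_relations G g r ns \<alpha> \<beta> \<gamma> \<delta>"
  and period_ge_2: "l < length ns \<Longrightarrow> ns ! l \<ge> 2"
  and dense: "T closure_of (generate G gens) = carrier G"
  using presentation unfolding F_presentation_def gens_def by auto

lemma universal:
  fixes H :: "nat set monoid"
  assumes "profinite_group H S" "F_relations H g r ns a b c d"
  shows "\<exists>\<phi>\<in>hom G H. continuous_map T S \<phi> \<and> (\<forall>i<g. \<phi> (\<alpha> i) = a i \<and> \<phi> (\<beta> i) = b i) \<and>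
    (\<forall>j<r. \<phi> (\<gamma> j) = c j) \<and> (\<forall>l<length ns. \<phi> (\<delta> l) = d l)"
  using presentation assms unfolding F_presentation_def by (elim conjE allE impE) auto

lemma gen_closed [simp]:
  "i < g \<Longrightarrow> \<alpha> i \<in> carrier G" "i < g \<Longrightarrow> \<beta> i \<in> carrier G"
  "j < r \<Longrightarrow> \<gamma> j \<in> carrier G" "l < length ns \<Longrightarrow> \<delta> l \<in> carrier G"
  and relation: "ordered_prod G (\<lambda>i. commutator G (\<alpha> i) (\<beta> i)) g
       \<otimes> ordered_prod G \<gamma> r \<otimes> ordered_prod G \<delta> (length ns) = \<one>"
  and \<delta>_pow: "l < length ns \<Longrightarrow> \<delta> l [^] (ns ! l) = \<one>"
  using relations unfolding F_relations_def by blast+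

lemma gens_carrier: "gens \<subseteq> carrier G"
  unfolding gens_def by auto

lemma finite_gens: "finite gens"
  unfolding gens_def by simp

text \<open>Open subgroups are closed, so one that contains the generators contains the closure of
  what they generate.\<close>

lemma open_subgroup_eq_carrier:
  assumes "openin T S" "subgroup S G" "gens \<subseteq> S"
  shows "S = carrier G"
proof -
  have "generate G gens \<subseteq> S" by (rule generate_subgroup_incl[OF assms(3,2)])
  then have "carrier G \<subseteq> S"
    using closure_of_minimal[OF _ open_subgroup_closed[OF assms(1,2)]] dense by auto
  then show ?thesis using subgroup.subset[OF assms(2)] by blast
qed

text \<open>The set where both maps agree is a subgroup containing the intersection of the two open
  kernels. Hence it is open, and it contains the generators.\<close>

lemma hom_unique:
  assumes "group K" and \<phi>: "\<phi> \<in> hom G K" "openin T (kernel G K \<phi>)"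
    and \<psi>: "\<psi> \<in> hom G K" "openin T (kernel G K \<psi>)" and eq: "\<And>x. x \<in> gens \<Longrightarrow> \<phi> x = \<psi> x"
    and x: "x \<in> carrier G"
  shows "\<phi> x = \<psi> x"
proof -
  interpret f: group_hom G K \<phi> using assms by (simp add: group_hom_def group_hom_axioms_def is_group)
  interpret h: group_hom G K \<psi> using assms by (simp add: group_hom_def group_hom_axioms_def is_group)
  let ?S = "{x \<in> carrier G. \<phi> x = \<psi> x}"
  have S: "subgroup ?S G" by standard auto
  have "open_normal (kernel G K \<phi> \<inter> kernel G K \<psi>)"
    using assms by (intro open_normal_Int open_normal_kernel)
  note N = open_normalD[OF this]
  have "?S = carrier G"
    using eq gens_carrier by (intro open_subgroup_eq_carrier open_supergroup[OF N(1,3) S] S) (auto simp: kernel_def)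
  then show ?thesis using x by auto
qed

lemma hom_exists:
  assumes "group K" "finite (carrier K)" "F_relations K g r ns a b c d"
  obtains \<phi> where "\<phi> \<in> hom G K" "open_normal (kernel G K \<phi>)"
    "\<And>i. i < g \<Longrightarrow> \<phi> (\<alpha> i) = a i \<and> \<phi> (\<beta> i) = b i" "\<And>j. j < r \<Longrightarrow> \<phi> (\<gamma> j) = c j"
    "\<And>l. l < length ns \<Longrightarrow> \<phi> (\<delta> l) = d l"
proof -
  obtain H :: "nat set monoid" and e e' where H: "group H" "finite (carrier H)" "e \<in> hom K H" "e' \<in> hom H K"
    "\<And>x. x \<in> carrier K \<Longrightarrow> e' (e x) = x" "\<And>x. x \<in> carrier H \<Longrightarrow> e (e' x) = x"
    using transport_to_nat_set[OF assms(1,2)] by blast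
  interpret e: group_hom K H e using assms(1) H by (simp add: group_hom_def group_hom_axioms_def)
  interpret e': group_hom H K e' using assms(1) H by (simp add: group_hom_def group_hom_axioms_def)
  have "F_relations H g r ns (\<lambda>i. e (a i)) (\<lambda>i. e (b i)) (\<lambda>i. e (c i)) (\<lambda>i. e (d i))"
    by (rule F_relations_hom[OF e.group_hom_axioms assms(3)])
  from universal[OF discrete_profinite_group[OF H(1,2)] this] obtain \<phi> where \<phi>: "\<phi> \<in> hom G H"
    "continuous_map T (discrete_topology (carrier H)) \<phi>"
    "\<forall>i<g. \<phi> (\<alpha> i) = e (a i) \<and> \<phi> (\<beta> i) = e (b i)" "\<forall>j<r. \<phi> (\<gamma> j) = e (c j)"
    "\<forall>l<length ns. \<phi> (\<delta> l) = e (d l)"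
    by (elim bexE conjE) (rule that)
  have e'\<phi>: "e' \<circ> \<phi> \<in> hom G K" using \<phi>(1) H(4) by (rule Group.hom_compose)
  have "kernel G K (e' \<circ> \<phi>) = {x \<in> topspace T. \<phi> x \<in> {\<one>\<^bsub>H\<^esub>}}"
  proof -
    have "e' (\<phi> x) = \<one>\<^bsub>K\<^esub> \<longleftrightarrow> \<phi> x = \<one>\<^bsub>H\<^esub>" if "x \<in> carrier G" for x
      using H(6)[of "\<phi> x"] that \<phi>(1) by (metis e'.hom_one e.hom_one hom_in_carrier)
    then show ?thesis by (auto simp: kernel_def)
  qed
  moreover have "openin T {x \<in> topspace T. \<phi> x \<in> {\<one>\<^bsub>H\<^esub>}}"
    by (rule openin_continuous_map_preimage[OF \<phi>(2)]) simp
  ultimately have "open_normal (kernel G K (e' \<circ> \<phi>))"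
    using open_normal_kernel[OF e'\<phi> assms(1)] by simp
  moreover have "\<And>i. i < g \<Longrightarrow> a i \<in> carrier K \<and> b i \<in> carrier K" "\<And>j. j < r \<Longrightarrow> c j \<in> carrier K"
    "\<And>l. l < length ns \<Longrightarrow> d l \<in> carrier K"
    using assms(3) unfolding F_relations_def by blast+
  ultimately show thesis using that[OF e'\<phi>] \<phi>(3-5) H(5) by simp
qed

text \<open>\<open>M\<close> is the intersection of the kernels of all homomorphisms with open
  kernel from \<open>G\<close> to the finite group \<open>G Mod N\<close>. They are determined by
  their values on \<open>gens\<close>, so there are finitely many kernels and \<open>M\<close> is
  open. Automorphisms permute these homomorphisms by precomposition, so \<open>M\<close> is
  characteristic. Each quotient by such a kernel embeds into \<open>G Mod N\<close>, which preserves
  the bound on the derived length, and \<open>M \<subseteq> N\<close> because the projection is one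
  of the maps.\<close>

lemma characteristic_core:
  assumes N: "open_normal N"
  obtains M where "open_normal M" "characteristic_subgroup G T M" "M \<subseteq> N"
    "\<And>n. der G n \<subseteq> N \<Longrightarrow> der G n \<subseteq> M"
proof -
  note No = open_normalD[OF N]
  interpret normal N G by (rule No(2))
  let ?A = "G Mod N"
  interpret A: group ?A by (rule factorgroup_is_group)
  let ?H = "{\<phi> \<in> hom G ?A. openin T (kernel G ?A \<phi>)}"
  let ?K = "(\<lambda>\<phi>. kernel G ?A \<phi>) ` ?H"
  have "finite ?K"
  proof -
    define res where "res \<phi> = restrict \<phi> gens" for \<phi> :: "'a \<Rightarrow> 'a set"
    define H where "H = ?H"
    have "res ` H \<subseteq> gens \<rightarrow>\<^sub>E carrier ?A"
      using gens_carrier by (auto simp: hom_def H_def res_def)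
    moreover have "finite (gens \<rightarrow>\<^sub>E carrier ?A)"
      using finite_gens finite_quotient[OF No(1,3)] by (intro finite_PiE) auto
    ultimately have fin: "finite (res ` H)" by (rule finite_subset)
    have "kernel G ?A \<phi> = kernel G ?A (inv_into H res (res \<phi>))" if "\<phi> \<in> H" for \<phi>
    proof -
      define \<psi> where "\<psi> = inv_into H res (res \<phi>)"
      have \<psi>: "\<psi> \<in> H" "res \<psi> = res \<phi>"
        unfolding \<psi>_def using that by (auto intro!: inv_into_into f_inv_into_f[of "res \<phi>" res H])
      then have eq: "\<phi> x = \<psi> x" if "x \<in> gens" for x using that unfolding res_def by (metis restrict_apply')
      have "\<phi> \<in> hom G ?A" "openin T (kernel G ?A \<phi>)" "\<psi> \<in> hom G ?A" "openin T (kernel G ?A \<psi>)"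
        using \<psi>(1) that unfolding H_def by auto
      then have "\<phi> x = \<psi> x" if "x \<in> carrier G" for x
        using hom_unique[OF A.is_group] eq that by blast
      then show ?thesis unfolding \<psi>_def[symmetric] by (auto simp: kernel_def)
    qed
    then have "kernel G ?A ` H \<subseteq> (\<lambda>f. kernel G ?A (inv_into H res f)) ` res ` H"
      by (intro image_subsetI) (simp add: image_image)
    then show ?thesis using fin finite_surj unfolding H_def by blast
  qed
  define M where "M = carrier G \<inter> (\<Inter>K\<in>?K. K)"
  have Mo: "open_normal M"
    unfolding M_def using A.is_group by (intro open_normal_INT[OF \<open>finite ?K\<close>]) (auto intro: open_normal_kernel)
  interpret q: group_hom G ?A "\<lambda>x. N #> x" by (rule quotient_hom)
  have kq: "kernel G ?A (\<lambda>x. N #> x) = N"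
    using quotient_one_iff[OF No(3)] subset by (auto simp: kernel_def)
  have MN: "M \<subseteq> N"
    unfolding M_def using q.homh kq No(1) by (auto simp: image_iff)
  have inv1: "\<psi> ` M \<subseteq> M" if \<psi>: "\<psi> \<in> iso G G" "homeomorphic_map T T \<psi>" for \<psi>
  proof -
    interpret \<psi>: group_hom G G \<psi> using \<psi>(1) by (simp add: group_hom_def group_hom_axioms_def is_group iso_def)
    have "\<phi> \<circ> \<psi> \<in> ?H" if "\<phi> \<in> ?H" for \<phi>
    proof -
      have "kernel G ?A (\<phi> \<circ> \<psi>) = {x \<in> topspace T. \<psi> x \<in> kernel G ?A \<phi>}"
        by (auto simp: kernel_def)
      moreover have "openin T {x \<in> topspace T. \<psi> x \<in> kernel G ?A \<phi>}"
        using that by (intro openin_continuous_map_preimage[OF homeomorphic_imp_continuous_map[OF \<psi>(2)]]) blast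
      ultimately show ?thesis using that Group.hom_compose[OF \<psi>.homh] by auto
    qed
    then have 1: "\<psi> x \<in> kernel G ?A \<phi>" if "x \<in> M" "\<phi> \<in> ?H" for x \<phi>
    proof -
      have "x \<in> kernel G ?A (\<phi> \<circ> \<psi>)" using that \<open>\<phi> \<in> ?H \<Longrightarrow> \<phi> \<circ> \<psi> \<in> ?H\<close> unfolding M_def by blast
      then show ?thesis by (simp add: kernel_def)
    qed
    show ?thesis
    proof
      fix y assume "y \<in> \<psi> ` M"
      then obtain x where x: "x \<in> M" "y = \<psi> x" by blast
      then have "y \<in> carrier G" using \<psi>.hom_closed unfolding M_def by simp
      then show "y \<in> M" using 1[OF x(1)] unfolding M_def x(2) by simp
    qed
  qed
  have "characteristic_subgroup G T M"
    unfolding characteristic_subgroup_def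
  proof (intro conjI ballI impI)
    show "subgroup M G" using open_normalD[OF Mo] by blast
    fix \<psi> assume \<psi>: "\<psi> \<in> iso G G" "homeomorphic_map T T \<psi>"
    have bij: "bij_betw \<psi> (carrier G) (carrier G)" using \<psi>(1) by (simp add: iso_def)
    obtain \<psi>' where hm: "homeomorphic_maps T T \<psi> \<psi>'" using \<psi>(2) by (auto simp: homeomorphic_map_maps)
    have inv: "inv_into (carrier G) \<psi> x = \<psi>' x" if "x \<in> carrier G" for x
      using hm that bij unfolding homeomorphic_maps_def
      by (metis bij_betw_imp_surj_on bij_betw_inv_into_left continuous_map_image_subset_topspace image_subset_iff topspace_eq)
    have "inv_into (carrier G) \<psi> \<in> iso G G" using \<psi>(1) by (rule iso_set_sym)
    moreover have "homeomorphic_map T T \<psi>'"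
      using hm homeomorphic_maps_map homeomorphic_maps_sym by blast
    then have "homeomorphic_map T T (inv_into (carrier G) \<psi>)"
      using homeomorphic_map_eq inv by (metis topspace_eq)
    ultimately have sub: "inv_into (carrier G) \<psi> ` M \<subseteq> M" by (rule inv1)
    have "M \<subseteq> \<psi> ` M"
    proof
      fix x assume x: "x \<in> M"
      then have "x \<in> carrier G" unfolding M_def by blast
      then have "x = \<psi> (inv_into (carrier G) \<psi> x)" using bij by (simp add: bij_betw_inv_into_right)
      then show "x \<in> \<psi> ` M" using sub x by blast
    qed
    then show "\<psi> ` M = M" using inv1[OF \<psi>] by blast
  qed
  moreover have "der G n \<subseteq> M" if "der G n \<subseteq> N" for n
  proof -
    have "der ?A n = {\<one>\<^bsub>?A\<^esub>}" using that by (simp only: der_quotient_trivial_iff)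
    then have "der G n \<subseteq> kernel G ?A \<phi>" if "\<phi> \<in> ?H" for \<phi>
      using that A.is_group by (intro group_hom.der_subset_kernel) (auto simp: group_hom_def group_hom_axioms_def is_group)
    then show ?thesis unfolding M_def using der_carrier by blast
  qed
  ultimately show thesis using that[of M] MN Mo by blast
qed

end

section \<open>Lifting homomorphisms to semidirect products\<close>

lemma (in group) ordered_prod_Suc_left:
  "ordered_prod G f (Suc n) = f 0 \<otimes> ordered_prod G (\<lambda>i. f (Suc i)) n"
  by (simp add: ordered_prod_def upt_conv_Cons foldr_map o_def del: upt_Suc flip: map_Suc_upt)

locale F_quotient = F_group +
  fixes Q :: "('q, 'n) monoid_scheme" and \<pi> :: "'a \<Rightarrow> 'q"
  assumes hom_\<pi>: "group_hom G Q \<pi>" and \<pi>_onto: "\<pi> ` carrier G = carrier Q"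
    and \<pi>_kernel: "open_normal (kernel G Q \<pi>)" and finite_Q: "finite (carrier Q)"

sublocale F_quotient \<subseteq> \<pi>: group_hom G Q \<pi>
  by (rule hom_\<pi>)

lemma (in F_group) F_quotient_Mod:
  assumes "open_normal N"
  shows "F_quotient G T g r ns \<alpha> \<beta> \<gamma> \<delta> (G Mod N) (\<lambda>x. N #> x)" "kernel G (G Mod N) (\<lambda>x. N #> x) = N"
proof -
  note N = open_normalD[OF assms]
  interpret normal N G by (rule N(2))
  show ker: "kernel G (G Mod N) (\<lambda>x. N #> x) = N"
    using quotient_one_iff[OF N(3)] subset by (auto simp: kernel_def)
  show "F_quotient G T g r ns \<alpha> \<beta> \<gamma> \<delta> (G Mod N) (\<lambda>x. N #> x)"
    using finite_quotient[OF N(1,3)] assms ker quotient_hom F_group_axioms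
    by (simp add: F_quotient_def F_quotient_axioms_def carrier_FactGroup)
qed

context F_quotient
begin

lemma Q_generated: "generate Q (\<pi> ` gens) = carrier Q"
proof -
  note N = open_normalD[OF \<pi>_kernel]
  let ?H = "generate Q (\<pi> ` gens)"
  have H: "subgroup ?H Q"
    using gens_carrier by (intro \<pi>.H.generate_is_subgroup) auto
  let ?S = "{x \<in> carrier G. \<pi> x \<in> ?H}"
  have S: "subgroup ?S G"
    using subgroup.m_closed[OF H] subgroup.m_inv_closed[OF H] subgroup.one_closed[OF H]
    by unfold_locales auto
  have "kernel G Q \<pi> \<subseteq> ?S"
    using subgroup.one_closed[OF H] by (auto simp: kernel_def)
  then have "?S = carrier G"
    using generate.incl[of _ "\<pi> ` gens" Q] gens_carrier
    by (intro open_subgroup_eq_carrier open_supergroup[OF N(1,3) S] S) auto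
  then have "carrier Q \<subseteq> ?H" unfolding \<pi>_onto[symmetric] by auto
  then show ?thesis using subgroup.subset[OF H] by blast
qed

lemma Q_relations: "F_relations Q g r ns (\<lambda>i. \<pi> (\<alpha> i)) (\<lambda>i. \<pi> (\<beta> i)) (\<lambda>i. \<pi> (\<gamma> i)) (\<lambda>i. \<pi> (\<delta> i))"
  by (rule F_relations_hom[OF hom_\<pi> relations])

text \<open>With a cusp the relation can be solved for the lift of \<open>\<gamma> 0\<close>, so the
  augmentation has to vanish only for \<open>r = 0\<close>. The lifts of the
  \<open>\<delta> l\<close> are changed by conjugation alone, which keeps their power
  relations.\<close>

theorem lift_hom:
  fixes X :: "'x set" and act :: "'q \<Rightarrow> 'x \<Rightarrow> 'x" and m e :: int
  assumes PM: "perm_module Q X act m"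
    and trans: "\<And>x y. x \<in> X \<Longrightarrow> y \<in> X \<Longrightarrow> \<exists>q\<in>carrier Q. act q x = y"
  defines "L \<equiv> perm_module.sdp Q X act m" and "B \<equiv> perm_module.base Q X m e"
  assumes em: "e dvd m"
    and a: "\<And>i. i < g \<Longrightarrow> a i \<in> carrier L \<and> snd (a i) = \<pi> (\<alpha> i)"
    and b: "\<And>i. i < g \<Longrightarrow> b i \<in> carrier L \<and> snd (b i) = \<pi> (\<beta> i)"
    and c: "\<And>j. j < r \<Longrightarrow> c j \<in> carrier L \<and> snd (c j) = \<pi> (\<gamma> j)"
    and d: "\<And>l. l < length ns \<Longrightarrow> d l \<in> carrier L \<and> snd (d l) = \<pi> (\<delta> l) \<and> d l [^]\<^bsub>L\<^esub> (ns ! l) = \<one>\<^bsub>L\<^esub>"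
    and W: "ordered_prod L (\<lambda>i. commutator L (a i) (b i)) g \<otimes>\<^bsub>L\<^esub> ordered_prod L c r
      \<otimes>\<^bsub>L\<^esub> ordered_prod L d (length ns) \<in> B"
    and tot0: "r = 0 \<Longrightarrow> (\<Sum>l<length ns. perm_module.tot X m (d l)) mod m = 0"
  obtains \<phi> where "\<phi> \<in> hom G L" "open_normal (kernel G L \<phi>)"
    "\<And>x. x \<in> carrier G \<Longrightarrow> snd (\<phi> x) = \<pi> x"
    "\<And>i. i < g \<Longrightarrow> \<exists>u\<in>B. \<exists>v\<in>B. \<phi> (\<alpha> i) = u \<otimes>\<^bsub>L\<^esub> a i \<and> \<phi> (\<beta> i) = v \<otimes>\<^bsub>L\<^esub> b i"
    "\<And>j. j < r \<Longrightarrow> \<exists>u\<in>B. \<phi> (\<gamma> j) = u \<otimes>\<^bsub>L\<^esub> c j"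
    "\<And>l. l < length ns \<Longrightarrow> \<exists>t\<in>B. \<phi> (\<delta> l) = t \<otimes>\<^bsub>L\<^esub> d l \<otimes>\<^bsub>L\<^esub> inv\<^bsub>L\<^esub> t"
proof -
  interpret PM: perm_module Q X act m by (rule PM)
  interpret B: abelian_normal B L unfolding B_def L_def by (rule PM.base_abelian_normal)
  interpret s: group_hom L Q snd
    using PM.snd_hom by unfold_locales (simp add: L_def)
  have sB: "snd u = \<one>\<^bsub>Q\<^esub>" if "u \<in> B" for u using that unfolding B_def PM.base_def by auto
  define A where "A = ordered_prod L (\<lambda>i. commutator L (a i) (b i)) g"
  define D where "D = ordered_prod L d (length ns)"
  have AD: "A \<in> carrier L" "D \<in> carrier L"
    unfolding A_def D_def using a b d by (auto intro!: B.ordered_prod_closed)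
  have "\<exists>u v w t. (\<forall>i<g. u i \<in> B \<and> v i \<in> B) \<and> (\<forall>j<r. w j \<in> B) \<and> (\<forall>l<length ns. t l \<in> B) \<and>
    ordered_prod L (\<lambda>i. commutator L (u i \<otimes>\<^bsub>L\<^esub> a i) (v i \<otimes>\<^bsub>L\<^esub> b i)) g \<otimes>\<^bsub>L\<^esub>
    ordered_prod L (\<lambda>j. w j \<otimes>\<^bsub>L\<^esub> c j) r \<otimes>\<^bsub>L\<^esub>
    ordered_prod L (\<lambda>l. t l \<otimes>\<^bsub>L\<^esub> d l \<otimes>\<^bsub>L\<^esub> inv\<^bsub>L\<^esub> (t l)) (length ns) = \<one>\<^bsub>L\<^esub>"
  proof (cases r)
    case 0
    have "\<pi> ` gens = (snd \<circ> a) ` {..<g} \<union> (snd \<circ> b) ` {..<g} \<union> (snd \<circ> d) ` {..<length ns}"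
      unfolding gens_def image_Un image_image using a b d 0 by (auto simp: image_iff)
    then have gen: "generate Q ((snd \<circ> a) ` {..<g} \<union> (snd \<circ> b) ` {..<g} \<union> (snd \<circ> d) ` {..<length ns}) = carrier Q"
      using Q_generated by simp
    have W0: "ordered_prod L (\<lambda>i. commutator L (a i) (b i)) g \<otimes>\<^bsub>L\<^esub> ordered_prod L d (length ns) \<in> B"
      using W AD 0 unfolding A_def D_def by simp
    obtain u v t where uvt: "\<And>i. i < g \<Longrightarrow> u i \<in> B \<and> v i \<in> B" "\<And>j. j < length ns \<Longrightarrow> t j \<in> B"
    "ordered_prod L (\<lambda>i. commutator L (u i \<otimes>\<^bsub>L\<^esub> a i) (v i \<otimes>\<^bsub>L\<^esub> b i)) g
      \<otimes>\<^bsub>L\<^esub> ordered_prod L (\<lambda>j. t j \<otimes>\<^bsub>L\<^esub> d j \<otimes>\<^bsub>L\<^esub> inv\<^bsub>L\<^esub> (t j)) (length ns) = \<one>\<^bsub>L\<^esub>"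
      using PM.solve_lifted_relation[OF trans _ _ gen W0[unfolded B_def L_def] tot0[OF 0] em, folded B_def L_def]
        a b d by blast
    have "ordered_prod L (\<lambda>i. commutator L (u i \<otimes>\<^bsub>L\<^esub> a i) (v i \<otimes>\<^bsub>L\<^esub> b i)) g \<in> carrier L"
      using a b uvt(1) by (intro B.ordered_prod_closed) auto
    then show ?thesis using uvt 0
      by (intro exI[of _ u] exI[of _ v] exI[of _ "\<lambda>_. \<one>\<^bsub>L\<^esub>"] exI[of _ t]) simp
  next
    case (Suc r')
    define C where "C = ordered_prod L (\<lambda>i. c (Suc i)) r'"
    have C: "C \<in> carrier L" unfolding C_def using c Suc by (intro B.ordered_prod_closed) auto
    have c0: "c 0 \<in> carrier L" using c Suc by auto
    let ?W = "A \<otimes>\<^bsub>L\<^esub> (c 0 \<otimes>\<^bsub>L\<^esub> C) \<otimes>\<^bsub>L\<^esub> D"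
    have WB: "?W \<in> B"
      using W unfolding A_def[symmetric] D_def[symmetric] Suc B.ordered_prod_Suc_left C_def by simp
    \<comment> \<open>Chosen so that \<open>A\<close> followed by \<open>w0\<close> equals the
      inverse of \<open>?W\<close> followed by \<open>A\<close>: inserting \<open>w0\<close> before
      \<open>c 0\<close> multiplies the whole word by the inverse of its value.\<close>
    define w0 where "w0 = inv\<^bsub>L\<^esub> A \<otimes>\<^bsub>L\<^esub> inv\<^bsub>L\<^esub> ?W \<otimes>\<^bsub>L\<^esub> A"
    have w0: "w0 \<in> B" unfolding w0_def using WB AD by (intro B.inv_op_closed1) auto
    let ?w = "\<lambda>j. if j = 0 then w0 else \<one>\<^bsub>L\<^esub>"
    have "ordered_prod L (\<lambda>j. ?w j \<otimes>\<^bsub>L\<^esub> c j) r = w0 \<otimes>\<^bsub>L\<^esub> c 0 \<otimes>\<^bsub>L\<^esub> ordered_prod L (\<lambda>i. \<one>\<^bsub>L\<^esub> \<otimes>\<^bsub>L\<^esub> c (Suc i)) r'"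
      unfolding Suc B.ordered_prod_Suc_left by simp
    also have "ordered_prod L (\<lambda>i. \<one>\<^bsub>L\<^esub> \<otimes>\<^bsub>L\<^esub> c (Suc i)) r' = C"
      unfolding C_def using c Suc by (intro ordered_prod_cong) auto
    finally have "ordered_prod L (\<lambda>j. ?w j \<otimes>\<^bsub>L\<^esub> c j) r = w0 \<otimes>\<^bsub>L\<^esub> c 0 \<otimes>\<^bsub>L\<^esub> C" .
    moreover have "A \<otimes>\<^bsub>L\<^esub> (w0 \<otimes>\<^bsub>L\<^esub> c 0 \<otimes>\<^bsub>L\<^esub> C) \<otimes>\<^bsub>L\<^esub> D = \<one>\<^bsub>L\<^esub>"
      unfolding w0_def using AD C c0 by (simp add: B.word_simps)
    moreover have "ordered_prod L (\<lambda>i. commutator L (\<one>\<^bsub>L\<^esub> \<otimes>\<^bsub>L\<^esub> a i) (\<one>\<^bsub>L\<^esub> \<otimes>\<^bsub>L\<^esub> b i)) g = A"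
      unfolding A_def using a b by (intro ordered_prod_cong) auto
    moreover have "ordered_prod L (\<lambda>l. \<one>\<^bsub>L\<^esub> \<otimes>\<^bsub>L\<^esub> d l \<otimes>\<^bsub>L\<^esub> inv\<^bsub>L\<^esub> \<one>\<^bsub>L\<^esub>) (length ns) = D"
      unfolding D_def using d by (intro ordered_prod_cong) auto
    ultimately show ?thesis using w0
      by (intro exI[of _ "\<lambda>_. \<one>\<^bsub>L\<^esub>"] exI[of _ ?w]) simp
  qed
  then obtain u v w t where uv: "\<forall>i<g. u i \<in> B \<and> v i \<in> B" and w: "\<forall>j<r. w j \<in> B" and t: "\<forall>l<length ns. t l \<in> B"
    and rel: "ordered_prod L (\<lambda>i. commutator L (u i \<otimes>\<^bsub>L\<^esub> a i) (v i \<otimes>\<^bsub>L\<^esub> b i)) g \<otimes>\<^bsub>L\<^esub>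
    ordered_prod L (\<lambda>j. w j \<otimes>\<^bsub>L\<^esub> c j) r \<otimes>\<^bsub>L\<^esub>
    ordered_prod L (\<lambda>l. t l \<otimes>\<^bsub>L\<^esub> d l \<otimes>\<^bsub>L\<^esub> inv\<^bsub>L\<^esub> (t l)) (length ns) = \<one>\<^bsub>L\<^esub>"
    by (elim exE conjE) (rule that)
  have conj_pow: "(x \<otimes>\<^bsub>L\<^esub> y \<otimes>\<^bsub>L\<^esub> inv\<^bsub>L\<^esub> x) [^]\<^bsub>L\<^esub> (n::nat) = x \<otimes>\<^bsub>L\<^esub> y [^]\<^bsub>L\<^esub> n \<otimes>\<^bsub>L\<^esub> inv\<^bsub>L\<^esub> x"
    if "x \<in> carrier L" "y \<in> carrier L" for x y n
    using that by (induction n) (simp_all add: B.word_simps)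
  have F: "F_relations L g r ns (\<lambda>i. u i \<otimes>\<^bsub>L\<^esub> a i) (\<lambda>i. v i \<otimes>\<^bsub>L\<^esub> b i) (\<lambda>j. w j \<otimes>\<^bsub>L\<^esub> c j)
    (\<lambda>l. t l \<otimes>\<^bsub>L\<^esub> d l \<otimes>\<^bsub>L\<^esub> inv\<^bsub>L\<^esub> (t l))"
    unfolding F_relations_def using uv w t rel a b c d by (auto simp: conj_pow)
  have "finite (carrier L)" unfolding L_def using finite_Q by (rule PM.finite_sdp)
  from hom_exists[OF B.is_group this F] obtain \<phi> where \<phi>: "\<phi> \<in> hom G L" "open_normal (kernel G L \<phi>)"
    "\<And>i. i < g \<Longrightarrow> \<phi> (\<alpha> i) = u i \<otimes>\<^bsub>L\<^esub> a i \<and> \<phi> (\<beta> i) = v i \<otimes>\<^bsub>L\<^esub> b i"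
    "\<And>j. j < r \<Longrightarrow> \<phi> (\<gamma> j) = w j \<otimes>\<^bsub>L\<^esub> c j"
    "\<And>l. l < length ns \<Longrightarrow> \<phi> (\<delta> l) = t l \<otimes>\<^bsub>L\<^esub> d l \<otimes>\<^bsub>L\<^esub> inv\<^bsub>L\<^esub> (t l)" by blast
  interpret \<phi>: group_hom G L \<phi> using \<phi>(1) by unfold_locales
  have "snd (\<phi> x) = \<pi> x" if x: "x \<in> carrier G" for x
  proof -
    have "snd \<circ> \<phi> \<in> hom G Q" using \<phi>(1) s.homh by (rule Group.hom_compose)
    moreover have "openin T (kernel G Q (snd \<circ> \<phi>))"
    proof -
      interpret sp: group_hom G Q "snd \<circ> \<phi>" using \<open>snd \<circ> \<phi> \<in> hom G Q\<close> by unfold_locales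
      have "kernel G L \<phi> \<subseteq> kernel G Q (snd \<circ> \<phi>)" by (auto simp: kernel_def)
      then show ?thesis
        using open_supergroup open_normalD[OF \<phi>(2)] sp.subgroup_kernel by blast
    qed
    moreover have "(snd \<circ> \<phi>) y = \<pi> y" if "y \<in> gens" for y
    proof -
      have 1: "snd (\<phi> (\<alpha> i)) = \<pi> (\<alpha> i)" "snd (\<phi> (\<beta> i)) = \<pi> (\<beta> i)" if "i < g" for i
        using \<phi>(3)[OF that] a[OF that] b[OF that] uv that sB by auto
      have 2: "snd (\<phi> (\<gamma> j)) = \<pi> (\<gamma> j)" if "j < r" for j
        using \<phi>(4)[OF that] c[OF that] w that sB by auto
      have 3: "snd (\<phi> (\<delta> l)) = \<pi> (\<delta> l)" if "l < length ns" for l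
        using \<phi>(5)[OF that] d[OF that] t that sB by auto
      show ?thesis using that 1 2 3 unfolding gens_def by auto
    qed
    ultimately show ?thesis
      using hom_unique[OF \<pi>.H.is_group _ _ \<pi>.homh open_normalD(1)[OF \<pi>_kernel] _ x] by fastforce
  qed
  then show thesis using that[OF \<phi>(1,2)] \<phi>(3-5) uv w t by blast
qed

end

section \<open>Torsion\<close>

context group
begin

lemma subgroup_nat_pow:
  assumes "subgroup N G" "x \<in> N" shows "x [^] (n::nat) \<in> N"
  using assms by (induction n) (auto intro: subgroup.one_closed subgroup.m_closed)

text \<open>The left coset of the cyclic group generated by \<open>x\<close>. Natural exponents
  suffice because inverses are positive powers in the finite groups where this is used.\<close>

definition cyc_coset :: "'a \<Rightarrow> 'a \<Rightarrow> 'a set" where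
  "cyc_coset x q = {q \<otimes> x [^] (j::nat) | j. True}"

lemma cyc_coset_self: "q \<in> carrier G \<Longrightarrow> x \<in> carrier G \<Longrightarrow> q \<in> cyc_coset x q"
  unfolding cyc_coset_def by (intro CollectI exI[of _ 0]) simp

lemma cyc_coset_carrier: "q \<in> carrier G \<Longrightarrow> x \<in> carrier G \<Longrightarrow> cyc_coset x q \<subseteq> carrier G"
  unfolding cyc_coset_def by auto

lemma cyc_coset_shift:
  assumes fin: "finite (carrier G)" and q: "q \<in> carrier G" and x: "x \<in> carrier G" and s: "s \<in> cyc_coset x q"
  shows "cyc_coset x s = cyc_coset x q"
proof -
  obtain j :: nat where j: "s = q \<otimes> x [^] j" using s unfolding cyc_coset_def by blast
  have pos: "ord x > 0" using ord_ge_1[OF fin x] by simp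
  \<comment> \<open>The exponent of a natural power of \<open>x\<close> that inverts
    \<open>x [^] j\<close>.\<close>
  define i where "i = ord x * j - j"
  have "j \<le> ord x * j" using pos by simp
  then have "j + i = ord x * j" unfolding i_def by simp
  then have "x [^] j \<otimes> x [^] i = \<one>" using x by (simp add: nat_pow_mult pow_eq_id)
  then have "q = s \<otimes> x [^] i" unfolding j using q x by (simp add: m_assoc)
  then have 1: "q \<otimes> x [^] n = s \<otimes> x [^] (i + n)" for n :: nat
    using x q j by (metis m_assoc nat_pow_closed nat_pow_mult m_closed)
  have 2: "s \<otimes> x [^] n = q \<otimes> x [^] (j + n)" for n :: nat
    unfolding j using x q by (simp add: m_assoc nat_pow_mult)
  show ?thesis unfolding cyc_coset_def using 1 2 by auto
qed

end

context perm_module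
begin

text \<open>The function \<open>h\<close> integrates \<open>c\<close> along the orbits of \<open>s\<close>; freeness makes this consistent.\<close>
lemma cocycle_coboundary:
  fixes c :: "'q \<Rightarrow> 'x \<Rightarrow> int" and n :: int
  assumes s: "s \<in> carrier Q" and free: "\<And>i A. A \<in> X \<Longrightarrow> act (s [^] (i::nat)) A = A \<Longrightarrow> N dvd i"
    and sN: "s [^] (N::nat) = \<one>" and N: "N > 0"
    and coc: "\<And>p q A. p \<in> carrier Q \<Longrightarrow> q \<in> carrier Q \<Longrightarrow> A \<in> X \<Longrightarrow>
      [c (p \<otimes> q) A = c p A + c q (act (inv p) A)] (mod n)"
  obtains h where "\<And>A. A \<in> X \<Longrightarrow> [c s A = h A - h (act (inv s) A)] (mod n)"
proof -
  define orb where "orb A = {act (s [^] (i::nat)) A | i. True}" for A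
  define rep where "rep A = (SOME R. R \<in> orb A)" for A
  define idx where "idx A = (SOME i. A = act (s [^] (i::nat)) (rep A))" for A
  define h where "h A = c (s [^] idx A) A" for A
  have pw: "act (s [^] (i + j)) A = act (s [^] i) (act (s [^] j) A)" if "A \<in> X" for i j :: nat and A
    using s that by (simp flip: act_mult Q.nat_pow_mult)
  have period: "s [^] (N * i) = \<one>" for i :: nat
    using s sN by (metis Q.nat_pow_pow Q.nat_pow_one)
  have inO: "rep A \<in> orb A" for A
    unfolding rep_def by (rule someI_ex) (auto simp: orb_def)
  have OX: "orb A \<subseteq> X" if "A \<in> X" for A using that s by (auto simp: orb_def)
  have O_eq: "orb (act (s [^] j) A) = orb A" if A: "A \<in> X" for A and j :: nat
  proof
    show "orb (act (s [^] j) A) \<subseteq> orb A"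
    proof
      fix z assume "z \<in> orb (act (s [^] j) A)"
      then obtain i :: nat where "z = act (s [^] i) (act (s [^] j) A)" unfolding orb_def by blast
      then have "z = act (s [^] (i + j)) A" by (simp only: pw[OF A])
      then show "z \<in> orb A" unfolding orb_def by blast
    qed
    show "orb A \<subseteq> orb (act (s [^] j) A)"
    proof
      fix z assume "z \<in> orb A"
      then obtain i :: nat where i: "z = act (s [^] i) A" unfolding orb_def by blast
      have "j \<le> N * j" using N by simp
      then have "N * j - j + j = N * j" by (rule le_add_diff_inverse2)
      then have "i + (N * j - j) + j = i + N * j" by (simp only: add.assoc)
      then have "act (s [^] (i + (N * j - j))) (act (s [^] j) A) = act (s [^] (i + N * j)) A"
        by (simp only: pw[OF A, symmetric])
      also have "\<dots> = z" unfolding i using A s by (simp add: pw period)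
      finally show "z \<in> orb (act (s [^] j) A)" unfolding orb_def by blast
    qed
  qed
  have idx: "A = act (s [^] idx A) (rep A)" if A: "A \<in> X" for A
  proof -
    obtain j :: nat where j: "rep A = act (s [^] j) A" using inO[of A] unfolding orb_def by blast
    have "A \<in> orb (rep A)" unfolding j O_eq[OF A] unfolding orb_def using A by (intro CollectI exI[of _ 0]) simp
    then have "\<exists>i. A = act (s [^] (i::nat)) (rep A)" unfolding orb_def by blast
    then show ?thesis unfolding idx_def by (rule someI_ex)
  qed
  have "[c s A = h A - h (act (inv s) A)] (mod n)" if A: "A \<in> X" for A
  proof -
    define B where "B = act (inv s) A"
    have B: "B \<in> X" "A = act s B" unfolding B_def using A s by auto
    have "orb A = orb B" using O_eq[OF B(1), of 1] B(2) s by simp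
    then have rep: "rep A = rep B" unfolding rep_def by simp
    have R: "rep B \<in> X" using inO[of B] OX[OF B(1)] by blast
    have 1: "A = act (s [^] Suc (idx B)) (rep B)"
      using B(2) idx[OF B(1)] pw[OF R, of 1 "idx B"] s by simp
    have 2: "A = act (s [^] idx A) (rep B)" using idx[OF A] rep by simp
    have "s [^] i = s [^] j" if ij: "i \<le> j" "act (s [^] i) (rep B) = act (s [^] j) (rep B)" for i j :: nat
    proof -
      have "act (s [^] j) (rep B) = act (s [^] (j - i)) (act (s [^] i) (rep B))"
        using ij(1) R by (simp flip: pw)
      then have "act (s [^] (j - i)) (act (s [^] i) (rep B)) = act (s [^] i) (rep B)"
        using ij(2) by simp
      then have "N dvd j - i" using free[of "act (s [^] i) (rep B)" "j - i"] R s by simp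
      then have "s [^] (j - i) = \<one>" using period by (auto elim!: dvdE)
      then have "s [^] (i + (j - i)) = s [^] i" using s by (simp flip: Q.nat_pow_mult)
      then show ?thesis using ij(1) by simp
    qed
    then have "s [^] idx A = s [^] Suc (idx B)"
      using 1 2 by (metis nat_le_linear)
    also have "\<dots> = s \<otimes> s [^] idx B" using s by (rule Q.nat_pow_Suc2)
    finally have "h A = c (s \<otimes> s [^] idx B) A" unfolding h_def by simp
    then have "[h A = c s A + h B] (mod n)"
      using coc[of s "s [^] idx B" A] s A unfolding h_def B_def by simp
    then have "n dvd - (h A - (c s A + h B))" unfolding cong_iff_dvd_diff dvd_minus_iff .
    also have "- (h A - (c s A + h B)) = c s A - (h A - h B)" by simp
    finally show ?thesis unfolding B_def[symmetric] cong_iff_dvd_diff .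
  qed
  then show thesis by (rule that)
qed

text \<open>A coboundary sums to zero over a full period of \<open>s\<close>. Thus a lift of
  \<open>s\<close> with coboundary coordinates still satisfies the relation of exponent
  \<open>N\<close>, with coefficients modulo \<open>m\<close>.\<close>

lemma telescoping_pow:
  assumes s: "s \<in> carrier Q" and sN: "s [^] (N::nat) = \<one>"
  shows "el (\<lambda>A. h A - h (act (inv s) A)) s [^]\<^bsub>sdp\<^esub> N = \<one>\<^bsub>sdp\<^esub>"
proof -
  have "(\<Sum>i<N. h (act (inv (s [^] i)) A) - h (act (inv s) (act (inv (s [^] i)) A))) = 0"
    if A: "A \<in> X" for A
  proof -
    have "act (inv s) (act (inv (s [^] i)) A) = act (inv (s [^] Suc i)) A" for i
      using s A by (simp add: Q.inv_mult_group flip: act_mult)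
    then have "(\<Sum>i<N. h (act (inv (s [^] i)) A) - h (act (inv s) (act (inv (s [^] i)) A)))
      = (\<Sum>i<N. h (act (inv (s [^] i)) A) - h (act (inv (s [^] Suc i)) A))" by simp
    also have "\<dots> = h (act (inv (s [^] (0::nat))) A) - h (act (inv (s [^] N)) A)"
      by (rule sum_lessThan_telescope')
    finally show ?thesis using sN by simp
  qed
  then show ?thesis using s sN by (simp add: el_pow one_sdp el_eq_iff)
qed

text \<open>Modulo \<open>n\<close> the graph of the cocycle \<open>c\<close> is a complement of the
  permutation module. \<open>S\<close> is its preimage under reduction of coefficients from
  \<open>m\<close> to \<open>n\<close>, and over the identity of \<open>Q\<close> only
  \<open>base n\<close> remains.\<close>

lemma cocycle_subgroup:
  assumes nm: "n dvd m"
    and coc: "\<And>p q A. p \<in> carrier Q \<Longrightarrow> q \<in> carrier Q \<Longrightarrow> A \<in> X \<Longrightarrow>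
      [c (p \<otimes> q) A = c p A + c q (act (inv p) A)] (mod n)"
  defines "S \<equiv> {x \<in> carrier sdp. \<forall>A\<in>X. [fst x A = c (snd x) A] (mod n)}"
  shows "subgroup S sdp" "\<And>f q. el f q \<in> S \<longleftrightarrow> q \<in> carrier Q \<and> (\<forall>A\<in>X. [f A = c q A] (mod n))"
    "base n \<subseteq> S" "\<And>x. x \<in> S \<Longrightarrow> snd x = \<one> \<Longrightarrow> x \<in> base n"
proof -
  have modm: "[a mod m = b] (mod n) \<longleftrightarrow> [a = b] (mod n)" for a b
    using nm by (simp add: cong_def mod_mod_cancel)
  show el_iff: "el f q \<in> S \<longleftrightarrow> q \<in> carrier Q \<and> (\<forall>A\<in>X. [f A = c q A] (mod n))" for f q
  proof -
    have "el f q \<in> carrier sdp \<longleftrightarrow> q \<in> carrier Q" using el_collapse(2)[of "el f q"] by auto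
    then show ?thesis unfolding S_def by (auto simp: fst_el modm)
  qed
  have one: "[c \<one> A = 0] (mod n)" if "A \<in> X" for A
    using coc[of "\<one>" "\<one>" A] that by (simp add: cong_iff_dvd_diff)
  show "subgroup S sdp"
  proof
    show "S \<subseteq> carrier sdp" unfolding S_def by blast
    show "\<one>\<^bsub>sdp\<^esub> \<in> S" unfolding one_sdp el_iff using one by (simp add: cong_sym_eq)
    show "x \<otimes>\<^bsub>sdp\<^esub> y \<in> S" if xy: "x \<in> S" "y \<in> S" for x y
    proof -
      have "x \<in> carrier sdp" "y \<in> carrier sdp" using xy unfolding S_def by auto
      then obtain f q f' q' where e: "x = el f q" "q \<in> carrier Q" "y = el f' q'" "q' \<in> carrier Q"
        by (metis sdpE)
      have "[f A + f' (act (inv q) A) = c (q \<otimes> q') A] (mod n)" if A: "A \<in> X" for A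
      proof -
        have "[f A + f' (act (inv q) A) = c q A + c q' (act (inv q) A)] (mod n)"
          using xy A e unfolding e(1,3) el_iff by (intro cong_add) auto
        also have "[c q A + c q' (act (inv q) A) = c (q \<otimes> q') A] (mod n)"
          using coc[OF e(2,4) A] by (rule cong_sym)
        finally show ?thesis .
      qed
      then show ?thesis using e by (simp add: el_iff)
    qed
    show "inv\<^bsub>sdp\<^esub> x \<in> S" if x: "x \<in> S" for x
    proof -
      have "x \<in> carrier sdp" using x unfolding S_def by auto
      then obtain f q where e: "x = el f q" "q \<in> carrier Q" by (metis sdpE)
      have "[- f (act q A) = c (inv q) A] (mod n)" if A: "A \<in> X" for A
      proof -
        have 1: "[f (act q A) = c q (act q A)] (mod n)" using x A e unfolding e(1) el_iff by auto
        have "[c q (act q A) + c (inv q) A = 0] (mod n)"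
          using coc[OF e(2) Q.inv_closed[OF e(2)], of "act q A"] one[of "act q A"] A e(2)
          by simp (metis cong_sym cong_trans)
        then have "n dvd (c q (act q A) + c (inv q) A) + (f (act q A) - c q (act q A))"
          using dvd_add[of n "c q (act q A) + c (inv q) A" "f (act q A) - c q (act q A)"] 1
          by (simp add: cong_iff_dvd_diff)
        then have "n dvd - (- f (act q A) - c (inv q) A)" by (simp add: algebra_simps)
        then show ?thesis unfolding cong_iff_dvd_diff by (subst (asm) dvd_minus_iff)
      qed
      then show ?thesis using e by (simp add: el_iff)
    qed
  qed
  show "base n \<subseteq> S"
  proof
    fix x assume "x \<in> base n"
    then obtain f where f: "x = el f \<one>" "\<forall>A\<in>X. n dvd f A" unfolding base_def by blast
    then show "x \<in> S" using one by (auto simp: el_iff cong_iff_dvd_diff intro: dvd_diff)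
  qed
  show "x \<in> base n" if "x \<in> S" "snd x = \<one>" for x
  proof -
    have "x \<in> carrier sdp" using that unfolding S_def by auto
    then obtain f q where e: "x = el f q" "q \<in> carrier Q" by (rule sdpE)
    then have q: "q = \<one>" using that by simp
    have "n dvd f A" if A: "A \<in> X" for A
    proof -
      have "[f A = c \<one> A] (mod n)" using \<open>x \<in> S\<close> A unfolding e(1) q el_iff by blast
      then have "[f A = 0] (mod n)" using one[OF A] cong_trans by blast
      then show ?thesis by (simp add: cong_iff_dvd_diff)
    qed
    then show ?thesis unfolding e(1) q base_def by blast
  qed
qed

end

context F_quotient
begin

lemma pow_conj_kernel:
  assumes "d \<in> carrier G" "y \<in> carrier G" "x \<in> carrier G"
    and "\<pi> d [^]\<^bsub>Q\<^esub> i \<otimes>\<^bsub>Q\<^esub> \<pi> y = \<pi> y \<otimes>\<^bsub>Q\<^esub> \<pi> x [^]\<^bsub>Q\<^esub> j"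
  shows "d [^] (i::nat) \<otimes> y \<otimes> inv (y \<otimes> x [^] (j::nat)) \<in> kernel G Q \<pi>"
  using assms by (simp add: kernel_def \<pi>.hom_nat_pow del: \<pi>.H.inv_mult_group)

text \<open>The character of the stabiliser of a coset of \<open>\<langle>\<pi> x\<rangle>\<close> that sends \<open>x\<close> to a generator of
  \<open>\<int>/n\<close> lifts to \<open>\<int>/nM\<close>, so \<open>x\<close> cannot have order dividing \<open>M\<close> unless \<open>n = 1\<close>.\<close>
lemma torsion_in_kernel:
  assumes x: "x \<in> carrier G" "x [^] (M::nat) = \<one>" "M > 0"
    and free: "\<And>l q (i::nat) (j::nat). l < length ns \<Longrightarrow> q \<in> carrier Q \<Longrightarrow>
      \<pi> (\<delta> l) [^]\<^bsub>Q\<^esub> i \<otimes>\<^bsub>Q\<^esub> q = q \<otimes>\<^bsub>Q\<^esub> \<pi> x [^]\<^bsub>Q\<^esub> j \<Longrightarrow> ns ! l dvd i"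
  shows "\<pi> x = \<one>\<^bsub>Q\<^esub>"
proof -
  define xb where "xb = \<pi> x"
  have xb: "xb \<in> carrier Q" unfolding xb_def using x by simp
  define n where "n = int (\<pi>.H.ord xb)"
  have n: "n > 0" unfolding n_def using \<pi>.H.ord_ge_1[OF finite_Q xb] by simp
  define m where "m = n * int M"
  \<comment> \<open>The coset space of the cyclic group generated by \<open>xb\<close>. The
    hypothesis \<open>free\<close> says that a power of \<open>\<pi> (\<delta> l)\<close> fixes a
    point of \<open>X\<close> only if \<open>ns ! l\<close> divides the exponent.\<close>
  define X where "X = \<pi>.H.cyc_coset xb ` carrier Q"
  define act where "act q A = (\<lambda>z. q \<otimes>\<^bsub>Q\<^esub> z) ` A" for q A
  have act_coset: "act q (\<pi>.H.cyc_coset xb p) = \<pi>.H.cyc_coset xb (q \<otimes>\<^bsub>Q\<^esub> p)"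
    if "q \<in> carrier Q" "p \<in> carrier Q" for p q
    unfolding act_def \<pi>.H.cyc_coset_def using that xb by (auto simp: \<pi>.H.m_assoc image_iff)
  have XE: "\<exists>p\<in>carrier Q. A = \<pi>.H.cyc_coset xb p" if "A \<in> X" for A
    using that unfolding X_def by blast
  interpret PM: perm_module Q X act m
  proof
    show "finite X" unfolding X_def using finite_Q by simp
    show "m > 0" unfolding m_def using n x(3) by simp
    show "act q A \<in> X" if q: "q \<in> carrier Q" "A \<in> X" for q A
    proof -
      from XE[OF q(2)] obtain p where "p \<in> carrier Q" "A = \<pi>.H.cyc_coset xb p" by blast
      then show ?thesis using act_coset q unfolding X_def by auto
    qed
    show "act \<one>\<^bsub>Q\<^esub> A = A" if A: "A \<in> X" for A
    proof -
      from XE[OF A] obtain p where "p \<in> carrier Q" "A = \<pi>.H.cyc_coset xb p" by blast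
      then show ?thesis using act_coset by simp
    qed
    show "act (q \<otimes>\<^bsub>Q\<^esub> q') A = act q (act q' A)" if q: "q \<in> carrier Q" "q' \<in> carrier Q" "A \<in> X" for q q' A
    proof -
      from XE[OF q(3)] obtain p where "p \<in> carrier Q" "A = \<pi>.H.cyc_coset xb p" by blast
      then show ?thesis using act_coset q by (simp add: \<pi>.H.m_assoc)
    qed
  qed
  have trans: "\<exists>q\<in>carrier Q. act q A = B" if AB: "A \<in> X" "B \<in> X" for A B
  proof -
    from XE[OF AB(1)] obtain p where p: "p \<in> carrier Q" "A = \<pi>.H.cyc_coset xb p" by blast
    from XE[OF AB(2)] obtain p' where p': "p' \<in> carrier Q" "B = \<pi>.H.cyc_coset xb p'" by blast
    have "act (p' \<otimes>\<^bsub>Q\<^esub> inv\<^bsub>Q\<^esub> p) A = B" using p p' act_coset by (simp add: \<pi>.H.m_assoc)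
    then show ?thesis using p(1) p'(1) by (metis \<pi>.H.inv_closed \<pi>.H.m_closed)
  qed
  define rep where "rep A = (SOME s. s \<in> A)" for A :: "'q set"
  have rep: "rep (\<pi>.H.cyc_coset xb q) \<in> \<pi>.H.cyc_coset xb q" if "q \<in> carrier Q" for q
    unfolding rep_def using \<pi>.H.cyc_coset_self[OF that xb] by (rule someI)
  \<comment> \<open>\<open>k q\<close> is the exponent of \<open>q\<close> relative to the chosen
    representative of its coset. It is well defined modulo \<open>n\<close>, the order of
    \<open>xb\<close>.\<close>
  define k where "k q = (SOME j::nat. q = rep (\<pi>.H.cyc_coset xb q) \<otimes>\<^bsub>Q\<^esub> xb [^]\<^bsub>Q\<^esub> j)" for q
  have k: "q = rep (\<pi>.H.cyc_coset xb q) \<otimes>\<^bsub>Q\<^esub> xb [^]\<^bsub>Q\<^esub> k q" if q: "q \<in> carrier Q" for q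
  proof -
    have "q \<in> \<pi>.H.cyc_coset xb (rep (\<pi>.H.cyc_coset xb q))"
      using \<pi>.H.cyc_coset_shift[OF finite_Q q xb rep[OF q]] \<pi>.H.cyc_coset_self[OF q xb] by simp
    then have "\<exists>j::nat. q = rep (\<pi>.H.cyc_coset xb q) \<otimes>\<^bsub>Q\<^esub> xb [^]\<^bsub>Q\<^esub> j"
      unfolding \<pi>.H.cyc_coset_def[of xb "rep _"] by blast
    then show ?thesis unfolding k_def by (rule someI_ex)
  qed
  have k_shift: "[int (k (q \<otimes>\<^bsub>Q\<^esub> xb [^]\<^bsub>Q\<^esub> j)) = int (k q) + int j] (mod n)" if q: "q \<in> carrier Q" for q and j :: nat
  proof -
    let ?s = "q \<otimes>\<^bsub>Q\<^esub> xb [^]\<^bsub>Q\<^esub> j" and ?R = "rep (\<pi>.H.cyc_coset xb q)"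
    have s: "?s \<in> carrier Q" using q xb by simp
    have R: "?R \<in> carrier Q" using rep[OF q] \<pi>.H.cyc_coset_carrier[OF q xb] by blast
    have "?s \<in> \<pi>.H.cyc_coset xb q" unfolding \<pi>.H.cyc_coset_def by blast
    then have "?s = ?R \<otimes>\<^bsub>Q\<^esub> xb [^]\<^bsub>Q\<^esub> k ?s" using k[OF s] \<pi>.H.cyc_coset_shift[OF finite_Q q xb] by simp
    moreover have "?s = ?R \<otimes>\<^bsub>Q\<^esub> xb [^]\<^bsub>Q\<^esub> (k q + j)"
      using k[OF q] xb R by (metis \<pi>.H.m_assoc \<pi>.H.nat_pow_closed \<pi>.H.nat_pow_mult)
    ultimately have "xb [^]\<^bsub>Q\<^esub> k ?s = xb [^]\<^bsub>Q\<^esub> (k q + j)"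
      using R xb by (metis \<pi>.H.inv_mult_cancel(1) \<pi>.H.nat_pow_closed)
    then have "xb [^]\<^bsub>Q\<^esub> int (k ?s) = xb [^]\<^bsub>Q\<^esub> int (k q + j)" by (simp only: int_pow_int)
    then have "n dvd int (k ?s) - int (k q + j)"
      using \<pi>.H.int_pow_eq[OF xb, of "int (k ?s)" "int (k q + j)"] unfolding n_def by (metis cong_iff_dvd_diff cong_sym)
    then show ?thesis by (simp add: cong_iff_dvd_diff)
  qed
  \<comment> \<open>This is the cocycle of the monomial representation: it compares the exponent of
    a point of \<open>A\<close> with that of its translate. By \<open>k_shift\<close> any other
    point of \<open>A\<close> gives the same value modulo \<open>n\<close>, which is what makes the
    cocycle identity work.\<close>
  define c where "c q A = int (k (rep A)) - int (k (inv\<^bsub>Q\<^esub> q \<otimes>\<^bsub>Q\<^esub> rep A))" for q A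
  have c_any: "[c q A = int (k s) - int (k (inv\<^bsub>Q\<^esub> q \<otimes>\<^bsub>Q\<^esub> s))] (mod n)" and s_carrier: "s \<in> carrier Q"
    if q: "q \<in> carrier Q" "A \<in> X" "s \<in> A" for q A s
  proof -
    from XE[OF q(2)] obtain p where p: "p \<in> carrier Q" "A = \<pi>.H.cyc_coset xb p" by blast
    show s: "s \<in> carrier Q" using p q(3) \<pi>.H.cyc_coset_carrier[OF p(1) xb] by blast
    have A: "A = \<pi>.H.cyc_coset xb s" using \<pi>.H.cyc_coset_shift[OF finite_Q p(1) xb] q(3) p(2) by simp
    then have "rep A \<in> \<pi>.H.cyc_coset xb s" using rep[OF s] by simp
    then obtain j :: nat where j: "rep A = s \<otimes>\<^bsub>Q\<^esub> xb [^]\<^bsub>Q\<^esub> j" unfolding \<pi>.H.cyc_coset_def by blast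
    have "inv\<^bsub>Q\<^esub> q \<otimes>\<^bsub>Q\<^esub> rep A = (inv\<^bsub>Q\<^esub> q \<otimes>\<^bsub>Q\<^esub> s) \<otimes>\<^bsub>Q\<^esub> xb [^]\<^bsub>Q\<^esub> j"
      unfolding j using q s xb by (simp add: \<pi>.H.m_assoc)
    then have "[c q A = (int (k s) + int j) - (int (k (inv\<^bsub>Q\<^esub> q \<otimes>\<^bsub>Q\<^esub> s)) + int j)] (mod n)"
      unfolding c_def using k_shift[OF s, of j] k_shift[of "inv\<^bsub>Q\<^esub> q \<otimes>\<^bsub>Q\<^esub> s" j] q s j
      by (intro cong_diff) auto
    then show "[c q A = int (k s) - int (k (inv\<^bsub>Q\<^esub> q \<otimes>\<^bsub>Q\<^esub> s))] (mod n)" by simp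
  qed
  have rep_in: "rep A \<in> A" if "A \<in> X" for A using XE[OF that] rep by blast
  have coc: "[c (p \<otimes>\<^bsub>Q\<^esub> q) A = c p A + c q (act (inv\<^bsub>Q\<^esub> p) A)] (mod n)"
    if p: "p \<in> carrier Q" "q \<in> carrier Q" "A \<in> X" for p q A
  proof -
    let ?t = "rep A" and ?s = "inv\<^bsub>Q\<^esub> p \<otimes>\<^bsub>Q\<^esub> rep A"
    have t: "?t \<in> carrier Q" using s_carrier[OF p(1,3) rep_in[OF p(3)]] .
    have "?s \<in> act (inv\<^bsub>Q\<^esub> p) A" unfolding act_def using rep_in[OF p(3)] by blast
    then have "[c q (act (inv\<^bsub>Q\<^esub> p) A) = int (k ?s) - int (k (inv\<^bsub>Q\<^esub> q \<otimes>\<^bsub>Q\<^esub> ?s))] (mod n)"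
      using c_any[OF p(2), of "act (inv\<^bsub>Q\<^esub> p) A"] p by simp
    then have "[c p A + c q (act (inv\<^bsub>Q\<^esub> p) A) = (int (k ?t) - int (k ?s)) + (int (k ?s) - int (k (inv\<^bsub>Q\<^esub> q \<otimes>\<^bsub>Q\<^esub> ?s)))] (mod n)"
      unfolding c_def[of p] by (intro cong_add cong_refl)
    moreover have "c (p \<otimes>\<^bsub>Q\<^esub> q) A = (int (k ?t) - int (k ?s)) + (int (k ?s) - int (k (inv\<^bsub>Q\<^esub> q \<otimes>\<^bsub>Q\<^esub> ?s)))"
      unfolding c_def using p t by (simp add: \<pi>.H.inv_mult_group \<pi>.H.m_assoc)
    ultimately show ?thesis by (simp add: cong_sym_eq)
  qed
  have nm: "n dvd m" unfolding m_def by simp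
  define S where "S = {x \<in> carrier PM.sdp. \<forall>A\<in>X. [fst x A = c (snd x) A] (mod n)}"
  note S0 = PM.cocycle_subgroup[OF nm, of c, folded S_def]
  have S: "subgroup S PM.sdp"
    "\<And>f q. PM.el f q \<in> S \<longleftrightarrow> q \<in> carrier Q \<and> (\<forall>A\<in>X. [f A = c q A] (mod n))"
    "PM.base n \<subseteq> S" "\<And>x. x \<in> S \<Longrightarrow> snd x = \<one>\<^bsub>Q\<^esub> \<Longrightarrow> x \<in> PM.base n"
    by (rule S0(1), rule coc, assumption+) (rule S0(2), rule coc, assumption+, rule S0(3), rule coc, assumption+, rule S0(4), rule coc, assumption+)
  have "\<exists>h. \<forall>A\<in>X. [c (\<pi> (\<delta> l)) A = h A - h (act (inv\<^bsub>Q\<^esub> \<pi> (\<delta> l)) A)] (mod n)" if l: "l < length ns" for l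
  proof -
    have 1: "ns ! l dvd i" if A: "A \<in> X" "act (\<pi> (\<delta> l) [^]\<^bsub>Q\<^esub> (i::nat)) A = A" for i A
    proof -
      from XE[OF A(1)] obtain p where p: "p \<in> carrier Q" "A = \<pi>.H.cyc_coset xb p" by blast
      have "\<pi> (\<delta> l) [^]\<^bsub>Q\<^esub> i \<otimes>\<^bsub>Q\<^esub> p \<in> act (\<pi> (\<delta> l) [^]\<^bsub>Q\<^esub> i) A"
        unfolding act_def p(2) using \<pi>.H.cyc_coset_self[OF p(1) xb] by (rule imageI)
      then have "\<pi> (\<delta> l) [^]\<^bsub>Q\<^esub> i \<otimes>\<^bsub>Q\<^esub> p \<in> \<pi>.H.cyc_coset xb p" using A(2) p(2) by simp
      then obtain j :: nat where "\<pi> (\<delta> l) [^]\<^bsub>Q\<^esub> i \<otimes>\<^bsub>Q\<^esub> p = p \<otimes>\<^bsub>Q\<^esub> xb [^]\<^bsub>Q\<^esub> j"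
        unfolding \<pi>.H.cyc_coset_def by blast
      then show ?thesis using free[OF l p(1)] unfolding xb_def by blast
    qed
    have 2: "\<pi> (\<delta> l) [^]\<^bsub>Q\<^esub> (ns ! l) = \<one>\<^bsub>Q\<^esub>"
      using Q_relations l unfolding F_relations_def by blast
    have "\<pi> (\<delta> l) \<in> carrier Q" "ns ! l > 0" using l period_ge_2[OF l] by auto
    then obtain h where "\<And>A. A \<in> X \<Longrightarrow> [c (\<pi> (\<delta> l)) A = h A - h (act (inv\<^bsub>Q\<^esub> \<pi> (\<delta> l)) A)] (mod n)"
      using PM.cocycle_coboundary[of "\<pi> (\<delta> l)" "ns ! l" c n] 1 2 coc by blast
    then show ?thesis by blast
  qed
  from bounded_choice[OF this] obtain h where
    h: "\<forall>l<length ns. \<forall>A\<in>X. [c (\<pi> (\<delta> l)) A = h l A - h l (act (inv\<^bsub>Q\<^esub> \<pi> (\<delta> l)) A)] (mod n)" ..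
  define a where "a i = PM.el (c (\<pi> (\<alpha> i))) (\<pi> (\<alpha> i))" for i
  define b where "b i = PM.el (c (\<pi> (\<beta> i))) (\<pi> (\<beta> i))" for i
  define cc where "cc i = PM.el (c (\<pi> (\<gamma> i))) (\<pi> (\<gamma> i))" for i
  \<comment> \<open>A lift of \<open>\<delta> l\<close> must satisfy its power relation modulo
    \<open>m\<close>, whereas \<open>c\<close> is controlled only modulo \<open>n\<close>. Hence the
    integer coboundary of \<open>h l\<close> replaces \<open>c\<close>, to which it is congruent
    modulo \<open>n\<close>; its augmentation also vanishes.\<close>
  define d where "d l = PM.el (\<lambda>A. h l A - h l (act (inv\<^bsub>Q\<^esub> \<pi> (\<delta> l)) A)) (\<pi> (\<delta> l))" for l
  have aS: "a i \<in> S" "b i \<in> S" if "i < g" for i using that by (simp_all add: a_def b_def S(2))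
  have cS: "cc j \<in> S" if "j < r" for j using that by (simp add: cc_def S(2))
  have dS: "d l \<in> S" if "l < length ns" for l using that h by (simp add: d_def S(2) cong_sym_eq)
  have d_pow: "d l [^]\<^bsub>PM.sdp\<^esub> (ns ! l) = \<one>\<^bsub>PM.sdp\<^esub>" if "l < length ns" for l
    unfolding d_def using that Q_relations by (intro PM.telescoping_pow) (simp_all add: F_relations_def)
  have d_tot: "PM.tot (d l) = 0" if "l < length ns" for l
    unfolding d_def PM.tot_el using that PM.sum_act[of "inv\<^bsub>Q\<^esub> \<pi> (\<delta> l)" "h l"] by (simp add: sum_subtractf)
  let ?L = "PM.sdp"
  interpret s: group_hom ?L Q snd
    using PM.snd_hom by unfold_locales
  let ?W = "ordered_prod ?L (\<lambda>i. commutator ?L (a i) (b i)) g \<otimes>\<^bsub>?L\<^esub> ordered_prod ?L cc r \<otimes>\<^bsub>?L\<^esub> ordered_prod ?L d (length ns)"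
  have SL: "S \<subseteq> carrier ?L" by (rule subgroup.subset[OF S(1)])
  have SC: "commutator ?L p q \<in> S" if "p \<in> S" "q \<in> S" for p q
    unfolding commutator_def using that by (intro subgroup.m_closed[OF S(1)] subgroup.m_inv_closed[OF S(1)])
  have SP: "ordered_prod ?L f i \<in> S" if "\<And>j. j < i \<Longrightarrow> f j \<in> S" for f i
    using that SL by (intro PM.sdp.ordered_prod_ind[where P = "\<lambda>x. x \<in> S"])
      (auto intro: subgroup.m_closed[OF S(1)] subgroup.one_closed[OF S(1)])
  have WS: "?W \<in> S" using aS cS dS SC by (intro subgroup.m_closed[OF S(1)] SP) auto
  have "snd ?W = \<one>\<^bsub>Q\<^esub>"
  proof -
    have "snd (ordered_prod ?L (\<lambda>i. commutator ?L (a i) (b i)) g) = ordered_prod Q (\<lambda>i. commutator Q (\<pi> (\<alpha> i)) (\<pi> (\<beta> i))) g"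
    proof (subst s.hom_ordered_prod)
      show "commutator ?L (a i) (b i) \<in> carrier ?L" if "i < g" for i using SC aS that SL by blast
      show "ordered_prod Q (\<lambda>i. snd (commutator ?L (a i) (b i))) g = ordered_prod Q (\<lambda>i. commutator Q (\<pi> (\<alpha> i)) (\<pi> (\<beta> i))) g"
        using s.hom_commutator[of "a _" "b _"] by (intro ordered_prod_cong) (simp add: a_def b_def)
    qed
    moreover have "snd (ordered_prod ?L cc r) = ordered_prod Q (\<lambda>j. \<pi> (\<gamma> j)) r"
      using cS SL by (subst s.hom_ordered_prod) (auto intro!: ordered_prod_cong, simp_all add: cc_def)
    moreover have "snd (ordered_prod ?L d (length ns)) = ordered_prod Q (\<lambda>j. \<pi> (\<delta> j)) (length ns)"
      using dS SL by (subst s.hom_ordered_prod) (auto intro!: ordered_prod_cong, simp_all add: d_def)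
    moreover have "ordered_prod ?L (\<lambda>i. commutator ?L (a i) (b i)) g \<in> carrier ?L"
      "ordered_prod ?L cc r \<in> carrier ?L" "ordered_prod ?L d (length ns) \<in> carrier ?L"
      using SP SL aS cS dS SC by (meson subsetD)+
    ultimately show ?thesis using Q_relations unfolding F_relations_def by simp
  qed
  then have WB: "?W \<in> PM.base n" using S(4)[OF WS] by simp
  have tot0: "(\<Sum>l<length ns. PM.tot (d l)) mod m = 0" using d_tot by simp
  obtain \<phi> where \<phi>: "\<phi> \<in> hom G ?L" "open_normal (kernel G ?L \<phi>)" "\<And>x. x \<in> carrier G \<Longrightarrow> snd (\<phi> x) = \<pi> x"
    "\<And>i. i < g \<Longrightarrow> \<exists>u\<in>PM.base n. \<exists>v\<in>PM.base n. \<phi> (\<alpha> i) = u \<otimes>\<^bsub>?L\<^esub> a i \<and> \<phi> (\<beta> i) = v \<otimes>\<^bsub>?L\<^esub> b i"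
    "\<And>j. j < r \<Longrightarrow> \<exists>u\<in>PM.base n. \<phi> (\<gamma> j) = u \<otimes>\<^bsub>?L\<^esub> cc j"
    "\<And>l. l < length ns \<Longrightarrow> \<exists>t\<in>PM.base n. \<phi> (\<delta> l) = t \<otimes>\<^bsub>?L\<^esub> d l \<otimes>\<^bsub>?L\<^esub> inv\<^bsub>?L\<^esub> t"
  proof (rule lift_hom[OF PM.perm_module_axioms _ nm _ _ _ _ WB tot0])
    show "\<exists>q\<in>carrier Q. act q A = B" if "A \<in> X" "B \<in> X" for A B using that by (rule trans)
    show "a i \<in> carrier ?L \<and> snd (a i) = \<pi> (\<alpha> i)" "b i \<in> carrier ?L \<and> snd (b i) = \<pi> (\<beta> i)" if "i < g" for i
      using that by (simp_all add: a_def b_def)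
    show "cc i \<in> carrier ?L \<and> snd (cc i) = \<pi> (\<gamma> i)" if "i < r" for i
      using that by (simp add: cc_def)
    show "d l \<in> carrier ?L \<and> snd (d l) = \<pi> (\<delta> l) \<and> d l [^]\<^bsub>?L\<^esub> (ns ! l) = \<one>\<^bsub>?L\<^esub>" if "l < length ns" for l
      using that d_pow by (simp add: d_def)
  qed (rule that, assumption+)
  interpret \<phi>: group_hom G ?L \<phi> using \<phi>(1) by unfold_locales
  \<comment> \<open>The uncorrected lifts lie in \<open>S\<close> and the corrections in
    \<open>base n\<close>, which is contained in \<open>S\<close>. So the coordinates of every value
    of \<open>\<phi>\<close> agree with \<open>c\<close> modulo \<open>n\<close>.\<close>
  have \<phi>S: "\<phi> y \<in> S" if y: "y \<in> carrier G" for y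
  proof -
    let ?S = "{y \<in> carrier G. \<phi> y \<in> S}"
    have sub: "subgroup ?S G"
      using subgroup.m_closed[OF S(1)] subgroup.m_inv_closed[OF S(1)] subgroup.one_closed[OF S(1)]
      by unfold_locales auto
    have ker: "kernel G ?L \<phi> \<subseteq> ?S" using subgroup.one_closed[OF S(1)] by (auto simp: kernel_def)
    have BS: "u \<in> S" if "u \<in> PM.base n" for u using S(3) that by blast
    have g1: "\<phi> (\<alpha> i) \<in> S" "\<phi> (\<beta> i) \<in> S" if i: "i < g" for i
    proof -
      from \<phi>(4)[OF i] obtain u v where "u \<in> PM.base n" "v \<in> PM.base n"
        "\<phi> (\<alpha> i) = u \<otimes>\<^bsub>?L\<^esub> a i" "\<phi> (\<beta> i) = v \<otimes>\<^bsub>?L\<^esub> b i" by blast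
      then show "\<phi> (\<alpha> i) \<in> S" "\<phi> (\<beta> i) \<in> S" using aS[OF i] BS subgroup.m_closed[OF S(1)] by auto
    qed
    have g2: "\<phi> (\<gamma> j) \<in> S" if j: "j < r" for j
    proof -
      from \<phi>(5)[OF j] obtain u where "u \<in> PM.base n" "\<phi> (\<gamma> j) = u \<otimes>\<^bsub>?L\<^esub> cc j" by blast
      then show ?thesis using subgroup.m_closed[OF S(1) BS cS[OF j]] by simp
    qed
    have g3: "\<phi> (\<delta> l) \<in> S" if l: "l < length ns" for l
    proof -
      from \<phi>(6)[OF l] obtain t where "t \<in> PM.base n" "\<phi> (\<delta> l) = t \<otimes>\<^bsub>?L\<^esub> d l \<otimes>\<^bsub>?L\<^esub> inv\<^bsub>?L\<^esub> t" by blast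
      then show ?thesis
        using subgroup.m_closed[OF S(1) subgroup.m_closed[OF S(1) BS dS[OF l]] subgroup.m_inv_closed[OF S(1) BS]] by simp
    qed
    have "gens \<subseteq> ?S" unfolding gens_def using g1 g2 g3 by auto
    then have "?S = carrier G"
      using open_supergroup[OF _ _ sub ker] open_normalD[OF \<phi>(2)] sub by (intro open_subgroup_eq_carrier) auto
    then show ?thesis using y by blast
  qed
  obtain f q where fq: "\<phi> x = PM.el f q" "q \<in> carrier Q" using \<phi>.hom_closed[OF x(1)] by (rule PM.sdpE)
  have q: "q = xb" using \<phi>(3)[OF x(1)] fq(1) unfolding xb_def by simp
  \<comment> \<open>The point \<open>?A\<close> is fixed by \<open>xb\<close>, so the coordinate at
    \<open>?A\<close> of the power with exponent \<open>M\<close> is \<open>M\<close> times that of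
    \<open>\<phi> x\<close>. Its vanishing modulo \<open>m = n * M\<close> forces \<open>n\<close>
    to divide the latter, which however is congruent to \<open>c xb ?A\<close>, that is to
    1.\<close>
  let ?A = "\<pi>.H.cyc_coset xb \<one>\<^bsub>Q\<^esub>"
  have A: "?A \<in> X" unfolding X_def by blast
  have act_pow: "act (inv\<^bsub>Q\<^esub> (xb [^]\<^bsub>Q\<^esub> (i::nat))) ?A = ?A" for i
  proof -
    have "xb [^]\<^bsub>Q\<^esub> i \<in> ?A" unfolding \<pi>.H.cyc_coset_def using xb by auto
    then have "act (xb [^]\<^bsub>Q\<^esub> i) ?A = ?A"
      using act_coset[of "xb [^]\<^bsub>Q\<^esub> i" "\<one>\<^bsub>Q\<^esub>"] \<pi>.H.cyc_coset_shift[OF finite_Q \<pi>.H.one_closed xb] xb by simp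
    then show ?thesis using PM.act_inv(1)[of "xb [^]\<^bsub>Q\<^esub> i" ?A] A xb by simp
  qed
  have "PM.el f xb [^]\<^bsub>?L\<^esub> M = \<one>\<^bsub>?L\<^esub>"
    using \<phi>.hom_nat_pow[OF x(1), of M] x(2) fq(1) q by simp
  then have "(\<Sum>i<M. f (act (inv\<^bsub>Q\<^esub> (xb [^]\<^bsub>Q\<^esub> i)) ?A)) mod m = 0"
    using A xb by (simp add: PM.el_pow PM.one_sdp PM.el_eq_iff)
  then have "m dvd int M * f ?A" by (simp add: act_pow dvd_eq_mod_eq_0)
  then have "n dvd f ?A" unfolding m_def using x(3) by (simp add: mult.commute)
  moreover have "[f ?A = c xb ?A] (mod n)" using \<phi>S[OF x(1)] A unfolding fq(1) q S(2) by blast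
  moreover have "[c xb ?A = 1] (mod n)"
  proof -
    have "xb [^]\<^bsub>Q\<^esub> (1::nat) \<in> ?A" unfolding \<pi>.H.cyc_coset_def using xb
      by (intro CollectI exI[of _ 1]) simp
    then have "[c xb ?A = int (k xb) - int (k \<one>\<^bsub>Q\<^esub>)] (mod n)"
      using c_any[OF xb A, of xb] xb by simp
    moreover have "[int (k xb) = int (k \<one>\<^bsub>Q\<^esub>) + 1] (mod n)"
      using k_shift[OF \<pi>.H.one_closed, of 1] xb by simp
    then have "[int (k xb) - int (k \<one>\<^bsub>Q\<^esub>) = 1] (mod n)" by (simp add: cong_iff_dvd_diff algebra_simps)
    ultimately show ?thesis by (rule cong_trans)
  qed
  ultimately have "n dvd 1"
    by (metis cong_dvd_iff cong_trans)
  then have "\<pi>.H.ord xb = 1" using n unfolding n_def by simp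
  then show ?thesis using \<pi>.H.pow_ord_eq_1[OF xb] xb unfolding xb_def by simp
qed

end

context F_group
begin

text \<open>For a torsion element \<open>x \<noteq> \<one>\<close> of \<open>N\<close>, choose an
  open normal \<open>C \<subseteq> N\<close> with \<open>x \<notin> C\<close>. If a power of
  \<open>\<delta> l\<close> fixes a coset of the group generated by \<open>x\<close> modulo
  \<open>C\<close>, it is modulo \<open>C\<close> a conjugate of a power of \<open>x\<close>, hence
  lies in \<open>N\<close>. The hypothesis \<open>order\<close> is therefore exactly the freeness
  that \<open>torsion_in_kernel\<close> needs.\<close>

theorem torsion_free_criterion:
  assumes N: "open_normal N" and order: "\<And>l i. l < length ns \<Longrightarrow> \<delta> l [^] (i::nat) \<in> N \<Longrightarrow> ns ! l dvd i"
  shows "torsion_free_subgroup G N"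
  unfolding torsion_free_subgroup_def
proof (intro conjI ballI allI impI)
  note No = open_normalD[OF N]
  show "subgroup N G" by (rule No(3))
  fix x and M :: nat assume x: "x \<in> N" "0 < M" "x [^] M = \<one>"
  have xc: "x \<in> carrier G" using subgroup.subset[OF No(3)] x by blast
  show "x = \<one>"
  proof (rule ccontr)
    assume "x \<noteq> \<one>"
    then obtain C0 where C0: "open_normal C0" "x \<notin> C0" using open_normal_avoiding xc by blast
    define C where "C = C0 \<inter> N"
    have C: "open_normal C" unfolding C_def by (rule open_normal_Int[OF C0(1) N])
    interpret Q: F_quotient G T g r ns \<alpha> \<beta> \<gamma> \<delta> "G Mod C" "\<lambda>x. C #> x" by (rule F_quotient_Mod[OF C])
    note ker = F_quotient_Mod(2)[OF C]
    have "C #> x = \<one>\<^bsub>G Mod C\<^esub>"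
    proof (rule Q.torsion_in_kernel[OF xc x(3,2)])
      fix l q and i j :: nat
      assume l: "l < length ns" and q: "q \<in> carrier (G Mod C)"
        and eq: "(C #> \<delta> l) [^]\<^bsub>G Mod C\<^esub> i \<otimes>\<^bsub>G Mod C\<^esub> q = q \<otimes>\<^bsub>G Mod C\<^esub> (C #> x) [^]\<^bsub>G Mod C\<^esub> j"
      from q obtain y where y: "y \<in> carrier G" "q = C #> y" by (auto simp: carrier_FactGroup)
      let ?z = "\<delta> l [^] i \<otimes> y \<otimes> inv (y \<otimes> x [^] j)"
      have "?z \<in> C" using Q.pow_conj_kernel[OF _ y(1) xc eq[unfolded y(2)]] l ker by simp
      then have "?z \<in> N" unfolding C_def by blast
      moreover have "y \<otimes> x [^] j \<otimes> inv y \<in> N"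
        using normal.inv_op_closed2[OF No(2) y(1)] subgroup_nat_pow[OF No(3) x(1)] by blast
      ultimately have "?z \<otimes> (y \<otimes> x [^] j \<otimes> inv y) \<in> N" using subgroup.m_closed[OF No(3)] by blast
      also have "?z \<otimes> (y \<otimes> x [^] j \<otimes> inv y) = \<delta> l [^] i" using l y xc by (simp add: word_simps)
      finally show "ns ! l dvd i" using order[OF l] by blast
    qed
    then have "x \<in> C" using ker xc unfolding kernel_def by blast
    then show False using C0 unfolding C_def by blast
  qed
qed

end

section \<open>Refining finite quotients\<close>

lemma sum_periodic:
  fixes F :: "nat \<Rightarrow> int"
  assumes "\<And>t. F (t + p) = F t"
  shows "(\<Sum>t<s * p. F t) = int s * (\<Sum>t<p. F t)"
proof -
  have "F (t + i * p) = F t" for t i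
  proof (induction i)
    case (Suc i)
    have "t + Suc i * p = (t + i * p) + p" by simp
    then show ?case using Suc by (simp only: assms)
  qed simp
  then have "sum F {i * p..<i * p + p} = (\<Sum>t<p. F t)" for i
    using sum.shift_bounds_nat_ivl[of F 0 "i * p" p] by (simp add: lessThan_atLeast0 add.commute)
  then show ?thesis using sum.nat_group[of F p s] by simp
qed

lemma (in group) conj_nat_pow:
  assumes "x \<in> carrier G" "y \<in> carrier G"
  shows "(x \<otimes> y \<otimes> inv x) [^] (n::nat) = x \<otimes> y [^] n \<otimes> inv x"
  using assms by (induction n) (simp_all add: word_simps)

lemma (in group) inv_nat_pow_finite:
  assumes "finite (carrier G)" "x \<in> carrier G"
  shows "\<exists>i::nat. inv (x [^] (t::nat)) = x [^] i"
proof -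
  have "t \<le> ord x * t" using ord_ge_1[OF assms] by simp
  then have "ord x * t - t + t = ord x * t" by (rule le_add_diff_inverse2)
  then have "x [^] (ord x * t - t) \<otimes> x [^] t = \<one>"
    using assms(2) by (simp add: nat_pow_mult pow_eq_id)
  then show ?thesis using assms(2) by (metis inv_equality nat_pow_closed)
qed

context F_quotient
begin

text \<open>With \<open>X\<close> equal to \<open>Q\<close> the semidirect product is a wreath
  product, and \<open>f i\<close> is the module part of the lift of \<open>\<delta> i\<close>. A
  nonzero \<open>f i\<close> needs room in the period: if \<open>q\<close> times the order of
  \<open>\<delta> i\<close> in \<open>Q\<close> divides \<open>ns ! i\<close>, then each cycle sum
  enters the power of exponent \<open>ns ! i\<close> with a multiple of \<open>q\<close>, so the
  power relation survives. Generators with \<open>f i\<close> zero keep their old order.\<close>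

theorem refine_core:
  fixes f :: "nat \<Rightarrow> 'q \<Rightarrow> int" and q :: nat
  assumes q: "q > 0"
    and ord: "\<And>i. i < length ns \<Longrightarrow> f i \<noteq> (\<lambda>_. 0) \<Longrightarrow> q * \<pi>.H.ord (\<pi> (\<delta> i)) dvd ns ! i"
    and sum0: "r = 0 \<Longrightarrow> (\<Sum>i<length ns. \<Sum>z\<in>carrier Q. f i z) = 0"
  obtains M where "open_normal M" "M \<subseteq> kernel G Q \<pi>" "derived G (kernel G Q \<pi>) \<subseteq> M"
    "\<And>i s. i < length ns \<Longrightarrow> \<delta> i [^] (\<pi>.H.ord (\<pi> (\<delta> i)) * s) \<in> M \<Longrightarrow>
      int q dvd int s * (\<Sum>t<\<pi>.H.ord (\<pi> (\<delta> i)). f i (inv\<^bsub>Q\<^esub> (\<pi> (\<delta> i) [^]\<^bsub>Q\<^esub> t)))"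
    "\<And>i s. i < length ns \<Longrightarrow> f i = (\<lambda>_. 0) \<Longrightarrow> \<delta> i [^] s \<in> kernel G Q \<pi> \<Longrightarrow> \<delta> i [^] (s::nat) \<in> M"
proof -
  interpret PM: perm_module Q "carrier Q" "\<lambda>q z. q \<otimes>\<^bsub>Q\<^esub> z" "int q"
    using finite_Q q by unfold_locales (auto simp: \<pi>.H.m_assoc)
  let ?L = PM.sdp
  define d where "d i = PM.el (f i) (\<pi> (\<delta> i))" for i
  let ?F = "\<lambda>i z (t::nat). f i (inv\<^bsub>Q\<^esub> (\<pi> (\<delta> i) [^]\<^bsub>Q\<^esub> t) \<otimes>\<^bsub>Q\<^esub> z)"
  have per: "?F i z (t + \<pi>.H.ord (\<pi> (\<delta> i))) = ?F i z t" if "i < length ns" for i z t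
    using that by (simp flip: \<pi>.H.nat_pow_mult)
  have persum: "(\<Sum>t<s * \<pi>.H.ord (\<pi> (\<delta> i)). ?F i z t) = int s * (\<Sum>t<\<pi>.H.ord (\<pi> (\<delta> i)). ?F i z t)"
    if "i < length ns" for i z s
    by (rule sum_periodic[of "?F i z" "\<pi>.H.ord (\<pi> (\<delta> i))"]) (rule per[OF that])
  have d_pow: "d i [^]\<^bsub>?L\<^esub> (ns ! i) = \<one>\<^bsub>?L\<^esub>" if i: "i < length ns" for i
  proof -
    have "(\<Sum>t<ns ! i. ?F i z t) mod int q = 0" for z
    proof (cases "f i = (\<lambda>_. 0)")
      case False
      then obtain s where s: "ns ! i = s * q * \<pi>.H.ord (\<pi> (\<delta> i))" using ord[OF i] by (metis dvdE mult.assoc mult.commute)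
      show ?thesis unfolding s persum[OF i] by simp
    qed simp
    moreover have "\<pi> (\<delta> i) [^]\<^bsub>Q\<^esub> (ns ! i) = \<one>\<^bsub>Q\<^esub>" using Q_relations i unfolding F_relations_def by blast
    ultimately show ?thesis using i by (simp add: d_def PM.el_pow PM.one_sdp PM.el_eq_iff)
  qed
  have el_base: "x \<in> PM.base 1" if "x \<in> carrier ?L" "snd x = \<one>\<^bsub>Q\<^esub>" for x
    using that PM.el_collapse[of x] unfolding PM.base_def by (intro CollectI exI[of _ "fst x"]) auto
  define a where "a i = PM.el (\<lambda>_. 0) (\<pi> (\<alpha> i))" for i
  define b where "b i = PM.el (\<lambda>_. 0) (\<pi> (\<beta> i))" for i
  define c where "c i = PM.el (\<lambda>_. 0) (\<pi> (\<gamma> i))" for i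
  interpret s: group_hom ?L Q snd
    using PM.snd_hom by unfold_locales
  let ?W = "ordered_prod ?L (\<lambda>i. commutator ?L (a i) (b i)) g \<otimes>\<^bsub>?L\<^esub> ordered_prod ?L c r \<otimes>\<^bsub>?L\<^esub> ordered_prod ?L d (length ns)"
  have W: "?W \<in> PM.base 1"
  proof (rule el_base)
    have C: "ordered_prod ?L (\<lambda>i. commutator ?L (a i) (b i)) g \<in> carrier ?L"
      "ordered_prod ?L c r \<in> carrier ?L" "ordered_prod ?L d (length ns) \<in> carrier ?L"
      by (auto intro!: PM.sdp.ordered_prod_closed simp: a_def b_def c_def d_def)
    then show "?W \<in> carrier ?L" by simp
    have "snd (ordered_prod ?L (\<lambda>i. commutator ?L (a i) (b i)) g) = ordered_prod Q (\<lambda>i. commutator Q (\<pi> (\<alpha> i)) (\<pi> (\<beta> i))) g"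
      by (subst s.hom_ordered_prod) (simp_all add: a_def b_def s.hom_commutator cong: ordered_prod_cong)
    moreover have "snd (ordered_prod ?L c r) = ordered_prod Q (\<lambda>j. \<pi> (\<gamma> j)) r"
      by (subst s.hom_ordered_prod) (simp_all add: c_def)
    moreover have "snd (ordered_prod ?L d (length ns)) = ordered_prod Q (\<lambda>j. \<pi> (\<delta> j)) (length ns)"
      by (subst s.hom_ordered_prod) (simp_all add: d_def)
    ultimately show "snd ?W = \<one>\<^bsub>Q\<^esub>" using C Q_relations unfolding F_relations_def by simp
  qed
  have tot0: "(\<Sum>i<length ns. PM.tot (d i)) mod int q = 0" if "r = 0"
    using sum0[OF that] by (simp add: d_def PM.tot_el mod_sum_eq)
  obtain \<phi> where \<phi>: "\<phi> \<in> hom G ?L" "open_normal (kernel G ?L \<phi>)" "\<And>x. x \<in> carrier G \<Longrightarrow> snd (\<phi> x) = \<pi> x"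
    "\<And>l. l < length ns \<Longrightarrow> \<exists>t\<in>PM.base 1. \<phi> (\<delta> l) = t \<otimes>\<^bsub>?L\<^esub> d l \<otimes>\<^bsub>?L\<^esub> inv\<^bsub>?L\<^esub> t"
  proof (rule lift_hom[OF PM.perm_module_axioms _ one_dvd _ _ _ _ W tot0])
    show "\<exists>q\<in>carrier Q. q \<otimes>\<^bsub>Q\<^esub> x = y" if "x \<in> carrier Q" "y \<in> carrier Q" for x y
      using that by (intro bexI[of _ "y \<otimes>\<^bsub>Q\<^esub> inv\<^bsub>Q\<^esub> x"]) (simp_all add: \<pi>.H.m_assoc)
    show "a i \<in> carrier ?L \<and> snd (a i) = \<pi> (\<alpha> i)" "b i \<in> carrier ?L \<and> snd (b i) = \<pi> (\<beta> i)" if "i < g" for i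
      using that by (simp_all add: a_def b_def)
    show "c i \<in> carrier ?L \<and> snd (c i) = \<pi> (\<gamma> i)" if "i < r" for i
      using that by (simp add: c_def)
    show "d l \<in> carrier ?L \<and> snd (d l) = \<pi> (\<delta> l) \<and> d l [^]\<^bsub>?L\<^esub> (ns ! l) = \<one>\<^bsub>?L\<^esub>" if "l < length ns" for l
      using that d_pow by (simp add: d_def)
  qed (assumption, rule that, assumption+)
  interpret \<phi>: group_hom G ?L \<phi> using \<phi>(1) by unfold_locales
  let ?M = "kernel G ?L \<phi>"
  interpret B: abelian_normal "PM.base 1" ?L by (rule PM.base_abelian_normal)
  have MK: "?M \<subseteq> kernel G Q \<pi>"
    using \<phi>(3) by (auto simp: kernel_def) (metis s.hom_one)
  have "derived G (kernel G Q \<pi>) \<subseteq> ?M"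
  proof (rule derived_subset_normalI)
    show "kernel G Q \<pi> \<subseteq> carrier G" by (auto simp: kernel_def)
    show "subgroup ?M G" by (rule \<phi>.subgroup_kernel)
    fix x y assume xy: "x \<in> kernel G Q \<pi>" "y \<in> kernel G Q \<pi>"
    then have c: "x \<in> carrier G" "y \<in> carrier G" by (auto simp: kernel_def)
    have "\<phi> x \<in> PM.base 1" "\<phi> y \<in> PM.base 1"
      using xy \<phi>(3) c by (auto simp: kernel_def intro!: el_base)
    then have "\<phi> x \<otimes>\<^bsub>?L\<^esub> \<phi> y = \<phi> y \<otimes>\<^bsub>?L\<^esub> \<phi> x" by (rule B.B_comm)
    then have "\<phi> (commutator G x y) = \<one>\<^bsub>?L\<^esub>"
      unfolding commutator_def using c by (simp add: PM.sdp.word_simps)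
    then show "commutator G x y \<in> ?M" using c by (simp add: kernel_def)
  qed
  moreover have pow_iff: "\<delta> i [^] n \<in> ?M \<longleftrightarrow> d i [^]\<^bsub>?L\<^esub> n = \<one>\<^bsub>?L\<^esub>" if i: "i < length ns" for i and n :: nat
  proof -
    from \<phi>(4)[OF i] obtain t where t: "t \<in> PM.base 1" "\<phi> (\<delta> i) = t \<otimes>\<^bsub>?L\<^esub> d i \<otimes>\<^bsub>?L\<^esub> inv\<^bsub>?L\<^esub> t" by blast
    have c: "t \<in> carrier ?L" "d i \<in> carrier ?L" using t(1) B.B_carrier i by (simp_all add: d_def)
    have "\<phi> (\<delta> i [^] n) = t \<otimes>\<^bsub>?L\<^esub> d i [^]\<^bsub>?L\<^esub> n \<otimes>\<^bsub>?L\<^esub> inv\<^bsub>?L\<^esub> t"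
      using i t(2) c by (simp add: \<phi>.hom_nat_pow PM.sdp.conj_nat_pow)
    moreover have "t \<otimes>\<^bsub>?L\<^esub> z \<otimes>\<^bsub>?L\<^esub> inv\<^bsub>?L\<^esub> t = \<one>\<^bsub>?L\<^esub> \<longleftrightarrow> z = \<one>\<^bsub>?L\<^esub>" if "z \<in> carrier ?L" for z
      using c(1) that by (metis PM.sdp.inv_closed PM.sdp.inv_mult_cancel(1) PM.sdp.inv_solve_right PM.sdp.l_one PM.sdp.m_closed PM.sdp.r_inv PM.sdp.r_one)
    ultimately show ?thesis using i c by (simp add: kernel_def)
  qed
  moreover have "int q dvd int s * (\<Sum>t<\<pi>.H.ord (\<pi> (\<delta> i)). f i (inv\<^bsub>Q\<^esub> (\<pi> (\<delta> i) [^]\<^bsub>Q\<^esub> t)))"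
    if i: "i < length ns" and M: "\<delta> i [^] (\<pi>.H.ord (\<pi> (\<delta> i)) * s) \<in> ?M" for i s
  proof -
    have "d i [^]\<^bsub>?L\<^esub> (s * \<pi>.H.ord (\<pi> (\<delta> i))) = \<one>\<^bsub>?L\<^esub>" using M pow_iff[OF i] by (simp add: mult.commute)
    then have "\<forall>y\<in>carrier Q. (\<Sum>t<s * \<pi>.H.ord (\<pi> (\<delta> i)). ?F i y t) mod int q = 0"
      using i unfolding d_def by (simp add: PM.el_pow PM.one_sdp PM.el_eq_iff)
    \<comment> \<open>Only the coordinate at the identity is used, that is, the cycle of
      \<open>\<pi> (\<delta> i)\<close> through it. The applications place their values so that this
      cycle has sum 1.\<close>
    from bspec[OF this \<pi>.H.one_closed]
    have "(\<Sum>t<s * \<pi>.H.ord (\<pi> (\<delta> i)). ?F i \<one>\<^bsub>Q\<^esub> t) mod int q = 0" .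
    then show ?thesis unfolding persum[OF i] using i by (simp add: dvd_eq_mod_eq_0)
  qed
  moreover have "\<delta> i [^] s \<in> ?M" if i: "i < length ns" and 0: "f i = (\<lambda>_. 0)" and K: "\<delta> i [^] s \<in> kernel G Q \<pi>" for i and s :: nat
  proof -
    have "\<pi> (\<delta> i) [^]\<^bsub>Q\<^esub> s = \<one>\<^bsub>Q\<^esub>" using K i by (simp add: kernel_def \<pi>.hom_nat_pow)
    then have "d i [^]\<^bsub>?L\<^esub> s = \<one>\<^bsub>?L\<^esub>" using i 0 by (simp add: d_def PM.el_pow PM.one_sdp PM.el_eq_iff)
    then show ?thesis using pow_iff[OF i] by simp
  qed
  ultimately show thesis using that[OF \<phi>(2) MK] by blast
qed

lemma pow_in_kernel_iff:
  assumes "x \<in> carrier G"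
  shows "x [^] (i::nat) \<in> kernel G Q \<pi> \<longleftrightarrow> \<pi>.H.ord (\<pi> x) dvd i"
  using assms by (simp add: kernel_def \<pi>.hom_nat_pow \<pi>.H.pow_eq_id)

lemma ord_\<delta>_dvd:
  assumes "l < length ns" shows "\<pi>.H.ord (\<pi> (\<delta> l)) dvd ns ! l"
  using pow_in_kernel_iff[of "\<delta> l" "ns ! l"] assms \<delta>_pow[OF assms] by (simp add: kernel_def)

text \<open>Two points in different \<open>\<delta> l\<close>-cycles carry opposite residues.\<close>
lemma refine_one:
  assumes r: "r = 0" and l: "l < length ns" and y: "y \<in> carrier Q" "\<And>i::nat. y \<noteq> \<pi> (\<delta> l) [^]\<^bsub>Q\<^esub> i"
  obtains M where "open_normal M" "M \<subseteq> kernel G Q \<pi>" "derived G (kernel G Q \<pi>) \<subseteq> M"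
    "\<And>s::nat. \<delta> l [^] s \<in> M \<Longrightarrow> ns ! l dvd s"
    "\<And>i s. i < length ns \<Longrightarrow> i \<noteq> l \<Longrightarrow> \<delta> i [^] s \<in> kernel G Q \<pi> \<Longrightarrow> \<delta> i [^] (s::nat) \<in> M"
proof -
  let ?o = "\<pi>.H.ord (\<pi> (\<delta> l))"
  have \<delta>l: "\<pi> (\<delta> l) \<in> carrier Q" using l by simp
  \<comment> \<open>\<open>q\<close> is the entire remaining period, so \<open>\<delta> l\<close>
    reaches its full order in a single refinement.\<close>
  obtain q where q: "ns ! l = q * ?o" using ord_\<delta>_dvd[OF l] by (metis dvdE mult.commute)
  have q0: "q > 0" using q period_ge_2[OF l] by (cases q) auto
  define f :: "nat \<Rightarrow> 'q \<Rightarrow> int" where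
    "f i = (if i = l then (\<lambda>z. (if z = \<one>\<^bsub>Q\<^esub> then 1 else 0) - (if z = y then 1 else 0)) else (\<lambda>_. 0))" for i
  have "(\<Sum>z\<in>carrier Q. f i z) = 0" for i
    using finite_Q y(1) by (simp add: f_def sum_subtractf)
  then have sum0: "(\<Sum>i<length ns. \<Sum>z\<in>carrier Q. f i z) = 0" by simp
  have ord: "q * \<pi>.H.ord (\<pi> (\<delta> i)) dvd ns ! i" if "f i \<noteq> (\<lambda>_. 0)" for i
    using that q by (auto simp: f_def split: if_splits)
  obtain M where M: "open_normal M" "M \<subseteq> kernel G Q \<pi>" "derived G (kernel G Q \<pi>) \<subseteq> M"
    "\<And>i s. i < length ns \<Longrightarrow> \<delta> i [^] (\<pi>.H.ord (\<pi> (\<delta> i)) * s) \<in> M \<Longrightarrow>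
      int q dvd int s * (\<Sum>t<\<pi>.H.ord (\<pi> (\<delta> i)). f i (inv\<^bsub>Q\<^esub> (\<pi> (\<delta> i) [^]\<^bsub>Q\<^esub> t)))"
    "\<And>i s. i < length ns \<Longrightarrow> f i = (\<lambda>_. 0) \<Longrightarrow> \<delta> i [^] s \<in> kernel G Q \<pi> \<Longrightarrow> \<delta> i [^] (s::nat) \<in> M"
  proof (rule refine_core[OF q0])
    show "q * \<pi>.H.ord (\<pi> (\<delta> i)) dvd ns ! i" if "f i \<noteq> (\<lambda>_. 0)" for i
      using that by (rule ord)
    show "(\<Sum>i<length ns. \<Sum>z\<in>carrier Q. f i z) = 0" by (rule sum0)
  qed (rule that, assumption+)
  \<comment> \<open>As \<open>y\<close> is not a power of \<open>\<pi> (\<delta> l)\<close>, the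
    compensating value at \<open>y\<close> lies off the cycle through the identity.\<close>
  have "f l (inv\<^bsub>Q\<^esub> (\<pi> (\<delta> l) [^]\<^bsub>Q\<^esub> t)) = (if t = 0 then 1 else 0)" if t: "t < ?o" for t
  proof -
    have "inv\<^bsub>Q\<^esub> (\<pi> (\<delta> l) [^]\<^bsub>Q\<^esub> t) \<noteq> y"
      using \<pi>.H.inv_nat_pow_finite[OF finite_Q \<delta>l, of t] y(2) by metis
    moreover have "inv\<^bsub>Q\<^esub> (\<pi> (\<delta> l) [^]\<^bsub>Q\<^esub> t) = \<one>\<^bsub>Q\<^esub> \<longleftrightarrow> t = 0"
      using t \<delta>l \<pi>.H.pow_eq_id[OF \<delta>l, of t] by (auto simp: \<pi>.H.inv_eq_1_iff dest: dvd_imp_le)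
    ultimately show ?thesis by (simp add: f_def)
  qed
  then have sum1: "(\<Sum>t<?o. f l (inv\<^bsub>Q\<^esub> (\<pi> (\<delta> l) [^]\<^bsub>Q\<^esub> t))) = 1"
    using \<pi>.H.ord_ge_1[OF finite_Q \<delta>l] by simp
  have "ns ! l dvd s" if s: "\<delta> l [^] s \<in> M" for s :: nat
  proof -
    have "?o dvd s" using s M(2) pow_in_kernel_iff[of "\<delta> l" s] l by auto
    then obtain s' where s': "s = ?o * s'" by blast
    then have "int q dvd int s'" using M(4)[OF l] s sum1 by simp
    then show ?thesis unfolding q s' by (simp add: mult.commute)
  qed
  then show thesis using that[OF M(1-3)] M(5) by (simp add: f_def)
qed

text \<open>If \<open>\<delta> l\<close> has one cycle only, the residue 1 on it has to be
  compensated at another generator: \<open>\<delta> j\<close> receives the residue -1. Both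
  generators must have room for \<open>q\<close>, and so \<open>q\<close> divides both remaining
  periods.\<close>

lemma refine_two:
  assumes r: "r = 0" and l: "l < length ns" and j: "j < length ns" "j \<noteq> l" and q: "q > 0"
    and ql: "q * \<pi>.H.ord (\<pi> (\<delta> l)) dvd ns ! l" and qj: "q * \<pi>.H.ord (\<pi> (\<delta> j)) dvd ns ! j"
  obtains M where "open_normal M" "M \<subseteq> kernel G Q \<pi>" "derived G (kernel G Q \<pi>) \<subseteq> M"
    "\<And>s::nat. \<delta> l [^] (\<pi>.H.ord (\<pi> (\<delta> l)) * s) \<in> M \<Longrightarrow> q dvd s"
    "\<And>i s. i < length ns \<Longrightarrow> i \<noteq> l \<Longrightarrow> i \<noteq> j \<Longrightarrow> \<delta> i [^] s \<in> kernel G Q \<pi> \<Longrightarrow> \<delta> i [^] (s::nat) \<in> M"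
proof -
  let ?o = "\<pi>.H.ord (\<pi> (\<delta> l))"
  have \<delta>l: "\<pi> (\<delta> l) \<in> carrier Q" using l by simp
  define e :: "'q \<Rightarrow> int" where "e z = (if z = \<one>\<^bsub>Q\<^esub> then 1 else 0)" for z
  define f :: "nat \<Rightarrow> 'q \<Rightarrow> int" where
    "f i = (if i = l then e else if i = j then (\<lambda>z. - e z) else (\<lambda>_. 0))" for i
  have e: "(\<Sum>z\<in>carrier Q. e z) = 1" using finite_Q by (simp add: e_def)
  have "(\<Sum>z\<in>carrier Q. f i z) = (if i = l then 1 else 0) - (if i = j then 1 else 0)" for i
    using e j(2) by (simp add: f_def sum_negf)
  then have sum0: "(\<Sum>i<length ns. \<Sum>z\<in>carrier Q. f i z) = 0"
    using l j by (simp add: sum_subtractf)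
  have ord: "q * \<pi>.H.ord (\<pi> (\<delta> i)) dvd ns ! i" if "f i \<noteq> (\<lambda>_. 0)" for i
    using that ql qj by (auto simp: f_def split: if_splits)
  obtain M where M: "open_normal M" "M \<subseteq> kernel G Q \<pi>" "derived G (kernel G Q \<pi>) \<subseteq> M"
    "\<And>i s. i < length ns \<Longrightarrow> \<delta> i [^] (\<pi>.H.ord (\<pi> (\<delta> i)) * s) \<in> M \<Longrightarrow>
      int q dvd int s * (\<Sum>t<\<pi>.H.ord (\<pi> (\<delta> i)). f i (inv\<^bsub>Q\<^esub> (\<pi> (\<delta> i) [^]\<^bsub>Q\<^esub> t)))"
    "\<And>i s. i < length ns \<Longrightarrow> f i = (\<lambda>_. 0) \<Longrightarrow> \<delta> i [^] s \<in> kernel G Q \<pi> \<Longrightarrow> \<delta> i [^] (s::nat) \<in> M"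
  proof (rule refine_core[OF q])
    show "q * \<pi>.H.ord (\<pi> (\<delta> i)) dvd ns ! i" if "f i \<noteq> (\<lambda>_. 0)" for i
      using that by (rule ord)
    show "(\<Sum>i<length ns. \<Sum>z\<in>carrier Q. f i z) = 0" by (rule sum0)
  qed (rule that, assumption+)
  have "f l (inv\<^bsub>Q\<^esub> (\<pi> (\<delta> l) [^]\<^bsub>Q\<^esub> t)) = (if t = 0 then 1 else 0)" if t: "t < ?o" for t
    using t \<delta>l \<pi>.H.pow_eq_id[OF \<delta>l, of t] by (auto simp: f_def e_def \<pi>.H.inv_eq_1_iff dest: dvd_imp_le)
  then have sum1: "(\<Sum>t<?o. f l (inv\<^bsub>Q\<^esub> (\<pi> (\<delta> l) [^]\<^bsub>Q\<^esub> t))) = 1"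
    using \<pi>.H.ord_ge_1[OF finite_Q \<delta>l] by simp
  have "q dvd s" if s: "\<delta> l [^] (?o * s) \<in> M" for s
    using M(4)[OF l s] sum1 by simp
  then show thesis using that[OF M(1-3)] M(5) by (simp add: f_def)
qed

text \<open>With a cusp the sum of residues is unconstrained, so the trivial quotient can be refined
  with a single residue 1 at \<open>\<delta> l\<close>. This gives an abelian quotient in which
  \<open>\<delta> l\<close> has full order.\<close>

lemma refine_cusps:
  assumes r: "r > 0" and l: "l < length ns" and triv: "carrier Q = {\<one>\<^bsub>Q\<^esub>}"
  obtains M where "open_normal M" "derived G (carrier G) \<subseteq> M" "\<And>s::nat. \<delta> l [^] s \<in> M \<Longrightarrow> ns ! l dvd s"
proof -
  have \<delta>l: "\<pi> (\<delta> l) = \<one>\<^bsub>Q\<^esub>" using \<pi>.hom_closed[of "\<delta> l"] l triv by auto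
  have o: "\<pi>.H.ord \<one>\<^bsub>Q\<^esub> = 1" by simp
  have ker: "kernel G Q \<pi> = carrier G"
  proof -
    have "\<pi> x = \<one>\<^bsub>Q\<^esub>" if "x \<in> carrier G" for x using \<pi>.hom_closed[OF that] triv by auto
    then show ?thesis by (auto simp: kernel_def)
  qed
  define f :: "nat \<Rightarrow> 'q \<Rightarrow> int" where "f i = (if i = l then (\<lambda>_. 1) else (\<lambda>_. 0))" for i
  have q0: "ns ! l > 0" using period_ge_2[OF l] by simp
  have ord: "ns ! l * \<pi>.H.ord (\<pi> (\<delta> i)) dvd ns ! i" if "f i \<noteq> (\<lambda>_. 0)" for i
    using that \<delta>l o by (auto simp: f_def split: if_splits)
  obtain M where M: "open_normal M" "derived G (kernel G Q \<pi>) \<subseteq> M"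
    "\<And>i s. i < length ns \<Longrightarrow> \<delta> i [^] (\<pi>.H.ord (\<pi> (\<delta> i)) * s) \<in> M \<Longrightarrow>
      int (ns ! l) dvd int s * (\<Sum>t<\<pi>.H.ord (\<pi> (\<delta> i)). f i (inv\<^bsub>Q\<^esub> (\<pi> (\<delta> i) [^]\<^bsub>Q\<^esub> t)))"
  proof (rule refine_core[of "ns ! l" f, OF q0])
    show "ns ! l * \<pi>.H.ord (\<pi> (\<delta> i)) dvd ns ! i" if "f i \<noteq> (\<lambda>_. 0)" for i
      using that by (rule ord)
    show "(\<Sum>i<length ns. \<Sum>z\<in>carrier Q. f i z) = 0" if "r = 0" using r that by simp
  qed (rule that, assumption+)
  have "ns ! l dvd s" if "\<delta> l [^] s \<in> M" for s :: nat
    using M(3)[OF l, of s] that \<delta>l o by (simp add: f_def)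
  then show thesis using that M ker by simp
qed

end

section \<open>Separating the periods\<close>

lemma (in group) finite_cyclic_subgroup:
  assumes "x \<in> carrier G" "x [^] (n::nat) = \<one>" "n > 0"
  shows "subgroup (range (\<lambda>a::nat. x [^] a)) G" "finite (range (\<lambda>a::nat. x [^] a))"
proof -
  have mod: "x [^] a = x [^] (a mod n)" for a
  proof -
    have "x [^] a = x [^] (n * (a div n) + a mod n)" by simp
    also have "\<dots> = (x [^] n) [^] (a div n) \<otimes> x [^] (a mod n)"
      using assms(1) by (simp only: nat_pow_mult[symmetric] nat_pow_pow)
    finally show ?thesis using assms by simp
  qed
  then have "range (\<lambda>a::nat. x [^] a) \<subseteq> (\<lambda>a. x [^] a) ` {..<n}"
    using assms(3) by (auto simp: image_iff intro!: bexI[of _ "_ mod n"])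
  then show "finite (range (\<lambda>a::nat. x [^] a))" using finite_subset by blast
  show "subgroup (range (\<lambda>a::nat. x [^] a)) G"
  proof
    show "range (\<lambda>a::nat. x [^] a) \<subseteq> carrier G" using assms(1) by auto
    show "y \<otimes> z \<in> range (\<lambda>a::nat. x [^] a)" if "y \<in> range (\<lambda>a::nat. x [^] a)" "z \<in> range (\<lambda>a::nat. x [^] a)" for y z
      using that assms(1) by (auto simp: nat_pow_mult)
    show "\<one> \<in> range (\<lambda>a::nat. x [^] a)" by (intro image_eqI[of _ _ 0]) auto
    show "inv y \<in> range (\<lambda>a::nat. x [^] a)" if y: "y \<in> range (\<lambda>a::nat. x [^] a)" for y
    proof -
      obtain a :: nat where a: "y = x [^] a" using y by blast
      have "a \<le> n * a" using assms(3) by simp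
      then have "n * a - a + a = n * a" by (rule le_add_diff_inverse2)
      then have "x [^] (n * a - a) \<otimes> y = x [^] (n * a)" unfolding a using assms(1) by (simp only: nat_pow_mult)
      also have "\<dots> = \<one>" using assms by (simp flip: nat_pow_pow)
      finally have "inv y = x [^] (n * a - a)" using assms(1) a by (metis inv_equality nat_pow_closed)
      then show ?thesis by blast
    qed
  qed
qed

text \<open>In an abelian group the product of finitely many finite cyclic subgroups is a finite
  subgroup. This bounds the quotient by \<open>cder\<close> when there are no cusps and no
  genus.\<close>

lemma (in comm_group) finite_torsion_generated:
  fixes k :: nat
  assumes "\<And>j. j < k \<Longrightarrow> x j \<in> carrier G \<and> x j [^] (n j :: nat) = \<one> \<and> n j > 0"
  shows "\<exists>P. finite P \<and> subgroup P G \<and> x ` {..<k} \<subseteq> P"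
  using assms
proof (induction k)
  case 0 then show ?case using triv_subgroup by (intro exI[of _ "{\<one>}"]) auto
next
  case (Suc k)
  then obtain P where P: "finite P" "subgroup P G" "x ` {..<k} \<subseteq> P" by auto
  let ?C = "range (\<lambda>a::nat. x k [^] a)"
  have C: "subgroup ?C G" "finite ?C" using finite_cyclic_subgroup[of "x k" "n k"] Suc.prems[of k] by auto
  have "finite (P <#> ?C)" unfolding set_mult_def by (intro finite_UN_I P(1) C(2) finite.intros)
  moreover have "subgroup (P <#> ?C) G" using P(2) C(1) by (rule mult_subgroups)
  moreover have "x j \<in> P <#> ?C" if j: "j < Suc k" for j
  proof (cases "j = k")
    case True
    have "x k [^] (1::nat) \<in> ?C" by blast
    then have "\<one> \<otimes> x k [^] (1::nat) \<in> P <#> ?C" using subgroup.one_closed[OF P(2)] by (rule set_mult_memI[rotated])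
    then show ?thesis using True Suc.prems[of k] by simp
  next
    case False
    have "x k [^] (0::nat) \<in> ?C" by blast
    moreover have "x j \<in> P" using False j P(3) by auto
    ultimately have "x j \<otimes> x k [^] (0::nat) \<in> P <#> ?C" by (rule set_mult_memI[rotated])
    then show ?thesis using j Suc.prems[of j] by simp
  qed
  ultimately show ?case by (intro exI[of _ "P <#> ?C"]) auto
qed

section \<open>The closed commutator subgroup\<close>

context top_group
begin

lemma closure_of_normal:
  assumes "S \<lhd> G" shows "T closure_of S \<lhd> G"
proof -
  interpret S: normal S G by fact
  let ?C = "T closure_of S"
  have C: "?C \<subseteq> carrier G" using closure_of_subset_topspace[of T S] by simp
  have S: "S \<subseteq> ?C" using S.subset by (intro closure_of_subset) simp
  have map: "a \<otimes> x \<otimes> b \<in> ?C" if ab: "a \<in> carrier G" "b \<in> carrier G" and x: "x \<in> ?C"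
    and sub: "\<And>s. s \<in> S \<Longrightarrow> a \<otimes> s \<otimes> b \<in> ?C" for a b x
  proof -
    have "a \<otimes> x \<otimes> b \<in> (\<lambda>x. a \<otimes> x \<otimes> b) ` (T closure_of S)" using x by blast
    also have "\<dots> \<subseteq> T closure_of ((\<lambda>x. a \<otimes> x \<otimes> b) ` S)"
      by (rule continuous_map_image_closure_subset[OF continuous_translation[OF ab]])
    also have "\<dots> \<subseteq> T closure_of ?C" using sub by (intro closure_of_mono) auto
    finally show ?thesis by simp
  qed
  have "subgroup ?C G"
  proof
    show "?C \<subseteq> carrier G" by (rule C)
    show "\<one> \<in> ?C" using S S.one_closed by blast
    show "x \<otimes> y \<in> ?C" if xy: "x \<in> ?C" "y \<in> ?C" for x y
    proof -
      \<comment> \<open>The product is handled one variable at a time, first with the right factor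
        in \<open>S\<close> and then in its closure, so that only translations of the group are
        used.\<close>
      have 1: "x \<otimes> s \<in> ?C" if s: "s \<in> S" for s
      proof -
        have xc: "x \<in> carrier G" and sc: "s \<in> carrier G" using xy(1) C s S.subset by blast+
        have "\<one> \<otimes> t \<otimes> s \<in> ?C" if t: "t \<in> S" for t
        proof -
          have "t \<otimes> s \<in> ?C" using S.m_closed[OF t s] S by blast
          moreover have "t \<in> carrier G" using t S.subset by blast
          ultimately show ?thesis by simp
        qed
        then have "\<one> \<otimes> x \<otimes> s \<in> ?C" by (rule map[OF one_closed sc xy(1)])
        then show ?thesis using xc by simp
      qed
      have xc: "x \<in> carrier G" and yc: "y \<in> carrier G" using xy C by blast+
      have "x \<otimes> s \<otimes> \<one> \<in> ?C" if s: "s \<in> S" for s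
      proof -
        have "s \<in> carrier G" using s S.subset by blast
        then show ?thesis using 1[OF s] xc by simp
      qed
      then have "x \<otimes> y \<otimes> \<one> \<in> ?C" by (rule map[OF xc one_closed xy(2)])
      then show ?thesis using xc yc by simp
    qed
    show "inv x \<in> ?C" if x: "x \<in> ?C" for x
    proof -
      have cont: "continuous_map T T (\<lambda>x. inv x)"
        using topological_group unfolding topological_group_def by blast
      have "inv x \<in> (\<lambda>x. inv x) ` (T closure_of S)" using x by blast
      also have "\<dots> \<subseteq> T closure_of ((\<lambda>x. inv x) ` S)"
        by (rule continuous_map_image_closure_subset[OF cont])
      also have "\<dots> \<subseteq> ?C" using S.m_inv_closed by (intro closure_of_mono) auto
      finally show ?thesis .
    qed
  qed
  moreover have "h \<otimes> x \<otimes> inv h \<in> ?C" if "h \<in> carrier G" "x \<in> ?C" for h x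
    using S.inv_op_closed2[OF that(1)] S by (intro map[OF that(1) inv_closed[OF that(1)] that(2)]) blast
  ultimately show ?thesis by (auto simp: normal_inv_iff)
qed

definition cder :: "'a set" where "cder = T closure_of (der G 1)"

lemma closed_derived_1: "closed_derived G T 1 = cder"
  by (simp add: cder_def der_def)

lemma cder_normal: "cder \<lhd> G"
  unfolding cder_def by (rule closure_of_normal[OF der_normal])

lemma closedin_cder: "closedin T cder"
  unfolding cder_def by simp

lemma der_subset_cder: "der G 1 \<subseteq> cder"
  unfolding cder_def using der_carrier by (intro closure_of_subset) simp

lemma cder_least:
  assumes "open_normal N" "der G 1 \<subseteq> N" shows "cder \<subseteq> N"
  unfolding cder_def using assms open_normalD by (intro closure_of_minimal)

lemma supergroup_der_open_normal:
  assumes "openin T N" "subgroup N G" "der G 1 \<subseteq> N" shows "open_normal N"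
proof -
  have "h \<otimes> x \<otimes> inv h \<in> N" if x: "x \<in> N" and h: "h \<in> carrier G" for x h
  proof -
    have xc: "x \<in> carrier G" using subgroup.subset[OF assms(2)] x by blast
    have "commutator G h x \<in> N"
      using assms(3) commutator_in_derived[of h "carrier G" x] h xc by (auto simp: der_def)
    then have "commutator G h x \<otimes> x \<in> N" using x assms(2) by (intro subgroup.m_closed)
    then show ?thesis using h xc by (simp add: commutator_def word_simps)
  qed
  then show ?thesis using assms by (auto simp: open_normal_def normal_inv_iff)
qed

end

context F_group
begin

definition rord :: "'a set \<Rightarrow> 'a \<Rightarrow> nat" where "rord N x = group.ord (G Mod N) (N #> x)"

text \<open>For \<open>x = \<delta> l\<close> and an open normal \<open>N\<close> this means that
  \<open>\<delta> l\<close> has a single cycle on the quotient (\<open>coset_cycles_cder\<close>),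
  which is precisely when \<open>refine_one\<close> finds no second cycle.\<close>

definition cyclic_mod :: "'a set \<Rightarrow> 'a \<Rightarrow> bool" where
  "cyclic_mod N x \<longleftrightarrow> (\<forall>y\<in>carrier G. \<exists>i::nat. N #> y = N #> (x [^] i))"

lemma rord_iff:
  assumes "open_normal N" "x \<in> carrier G"
  shows "x [^] (i::nat) \<in> N \<longleftrightarrow> rord N x dvd i"
proof -
  interpret Q: F_quotient G T g r ns \<alpha> \<beta> \<gamma> \<delta> "G Mod N" "\<lambda>x. N #> x" by (rule F_quotient_Mod[OF assms(1)])
  show ?thesis using Q.pow_in_kernel_iff[OF assms(2)] F_quotient_Mod(2)[OF assms(1)] by (simp add: rord_def)
qed

lemma rord_dvd_period:
  assumes "open_normal N" "l < length ns" shows "rord N (\<delta> l) dvd ns ! l"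
  using rord_iff[OF assms(1), of "\<delta> l" "ns ! l"] assms \<delta>_pow open_normalD(3) by (simp add: subgroup.one_closed)

lemma rord_pos:
  assumes "open_normal N" "l < length ns" shows "rord N (\<delta> l) > 0"
  using rord_dvd_period[OF assms] period_ge_2[OF assms(2)] by (auto intro: Nat.gr0I)

lemma Mod_refine_one:
  assumes r: "r = 0" and N: "open_normal N" and l: "l < length ns" and nc: "\<not> cyclic_mod N (\<delta> l)"
  obtains M where "open_normal M" "M \<subseteq> N" "derived G N \<subseteq> M" "\<And>s::nat. \<delta> l [^] s \<in> M \<Longrightarrow> ns ! l dvd s"
    "\<And>i s. i < length ns \<Longrightarrow> i \<noteq> l \<Longrightarrow> \<delta> i [^] s \<in> N \<Longrightarrow> \<delta> i [^] (s::nat) \<in> M"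
proof -
  interpret Q: F_quotient G T g r ns \<alpha> \<beta> \<gamma> \<delta> "G Mod N" "\<lambda>x. N #> x" by (rule F_quotient_Mod[OF N])
  note ker = F_quotient_Mod(2)[OF N]
  obtain y where y: "y \<in> carrier G" "\<And>i::nat. N #> y \<noteq> N #> (\<delta> l [^] i)"
    using nc unfolding cyclic_mod_def by blast
  have "N #> y \<noteq> (N #> \<delta> l) [^]\<^bsub>G Mod N\<^esub> i" for i :: nat
    using y(2)[of i] l by (simp add: Q.\<pi>.hom_nat_pow)
  then show thesis
    using Q.refine_one[OF r l Q.\<pi>.hom_closed[OF y(1)], unfolded ker] that by metis
qed

lemma Mod_refine_two:
  assumes r: "r = 0" and N: "open_normal N" and l: "l < length ns" and j: "j < length ns" "j \<noteq> l" and q: "q > 0"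
    and ql: "q * rord N (\<delta> l) dvd ns ! l" and qj: "q * rord N (\<delta> j) dvd ns ! j"
  obtains M where "open_normal M" "M \<subseteq> N" "derived G N \<subseteq> M"
    "\<And>s::nat. \<delta> l [^] (rord N (\<delta> l) * s) \<in> M \<Longrightarrow> q dvd s"
    "\<And>i s. i < length ns \<Longrightarrow> i \<noteq> l \<Longrightarrow> i \<noteq> j \<Longrightarrow> \<delta> i [^] s \<in> N \<Longrightarrow> \<delta> i [^] (s::nat) \<in> M"
proof -
  interpret Q: F_quotient G T g r ns \<alpha> \<beta> \<gamma> \<delta> "G Mod N" "\<lambda>x. N #> x" by (rule F_quotient_Mod[OF N])
  note ker = F_quotient_Mod(2)[OF N]
  show thesis
    using Q.refine_two[OF r l j q ql[unfolded rord_def] qj[unfolded rord_def], unfolded ker] that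
    unfolding rord_def by metis
qed

lemma rord_whole [simp]: "l < length ns \<Longrightarrow> rord (carrier G) (\<delta> l) = 1"
  using rord_iff[OF open_normal_carrier, of "\<delta> l" 1] by simp

text \<open>\<open>separated m\<close> means that every \<open>\<delta> l\<close> has order exactly \<open>ns ! l\<close> modulo some open normal
  subgroup with quotient of derived length at most \<open>m\<close>; by the torsion-freeness criterion this
  is what the theorem asks for.\<close>
definition separated :: "nat \<Rightarrow> bool" where
  "separated m \<longleftrightarrow> (\<forall>l<length ns. \<forall>i::nat. \<not> ns ! l dvd i \<longrightarrow>
     (\<exists>N. open_normal N \<and> der G m \<subseteq> N \<and> \<delta> l [^] i \<notin> N))"

lemma separated_mono: "separated m \<Longrightarrow> m \<le> n \<Longrightarrow> separated n"
  unfolding separated_def using der_decreasing by (meson subset_trans)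

text \<open>Membership of \<open>\<delta> l [^] i\<close> in an open normal subgroup depends on
  \<open>i\<close> only modulo \<open>ns ! l\<close>. So finitely many pairs matter, and the
  intersection of their subgroups is still open.\<close>

lemma separated_uniform:
  assumes "separated m"
  obtains N where "open_normal N" "der G m \<subseteq> N"
    "\<And>l i. l < length ns \<Longrightarrow> \<delta> l [^] (i::nat) \<in> N \<Longrightarrow> ns ! l dvd i"
proof -
  define I where "I = {(l, i). l < length ns \<and> i < ns ! l \<and> \<not> ns ! l dvd i}"
  have "I \<subseteq> Sigma {..<length ns} (\<lambda>l. {..<ns ! l})" unfolding I_def by auto
  then have fin: "finite I" by (rule finite_subset) simp
  have "\<forall>p\<in>I. \<exists>N. open_normal N \<and> der G m \<subseteq> N \<and> \<delta> (fst p) [^] snd p \<notin> N"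
    using assms unfolding separated_def I_def by auto
  from bchoice[OF this] obtain N where
    N: "\<forall>p\<in>I. open_normal (N p) \<and> der G m \<subseteq> N p \<and> \<delta> (fst p) [^] snd p \<notin> N p" ..
  define M where "M = carrier G \<inter> (\<Inter>p\<in>I. N p)"
  have M: "open_normal M" unfolding M_def using fin N by (intro open_normal_INT) auto
  show thesis
  proof (rule that[OF M])
    show "der G m \<subseteq> M" unfolding M_def using N der_carrier by blast
    fix l and i :: nat assume l: "l < length ns" and i: "\<delta> l [^] i \<in> M"
    show "ns ! l dvd i"
    proof (rule ccontr)
      assume nd: "\<not> ns ! l dvd i"
      have "rord M (\<delta> l) dvd i mod ns ! l"
        using rord_iff[OF M, of "\<delta> l" i] i l rord_dvd_period[OF M l] by (simp add: dvd_mod)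
      then have "\<delta> l [^] (i mod ns ! l) \<in> M" using rord_iff[OF M] l by simp
      moreover have "(l, i mod ns ! l) \<in> I"
        using l nd period_ge_2[OF l] by (auto simp: I_def dvd_mod_iff)
      ultimately show False using N unfolding M_def by auto
    qed
  qed
qed

lemma separated_characteristic:
  assumes "separated m"
  obtains N where "torsion_free_open_characteristic G T N" "torsion_free_open_normal G T N" "der G m \<subseteq> N"
proof -
  obtain N where N: "open_normal N" "der G m \<subseteq> N"
    "\<And>l i. l < length ns \<Longrightarrow> \<delta> l [^] (i::nat) \<in> N \<Longrightarrow> ns ! l dvd i"
    using separated_uniform[OF assms] by blast
  obtain M where M: "open_normal M" "characteristic_subgroup G T M" "M \<subseteq> N"
    "der G m \<subseteq> N \<Longrightarrow> der G m \<subseteq> M"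
    using characteristic_core[OF N(1)] by metis
  have "torsion_free_subgroup G M"
    using N(3) M(3) by (intro torsion_free_criterion[OF M(1)]) blast
  then show thesis
    using that[of M] M N(2)
    unfolding torsion_free_open_characteristic_def torsion_free_open_normal_def open_normal_def by blast
qed

text \<open>A power of \<open>\<delta> l\<close> in a torsion-free \<open>N\<close> is trivial. To
  conclude that the period divides the exponent, \<open>\<delta> l\<close> must have order exactly
  \<open>ns ! l\<close> in \<open>G\<close>; this is what \<open>separated m\<close> supplies, for
  whatever \<open>m\<close> it is known.\<close>

lemma torsion_free_separated:
  assumes "separated m" "open_normal N" "torsion_free_subgroup G N" "der G n \<subseteq> N"
  shows "separated n"
proof -
  have "\<delta> l [^] i \<notin> N" if l: "l < length ns" and i: "\<not> ns ! l dvd i" for l and i :: nat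
  proof
    assume "\<delta> l [^] i \<in> N"
    moreover have "(\<delta> l [^] i) [^] (ns ! l) = \<one>"
      using l \<delta>_pow[OF l] by (metis gen_closed(4) nat_pow_one nat_pow_pow mult.commute)
    moreover have "ns ! l > 0" using period_ge_2[OF l] by simp
    ultimately have "\<delta> l [^] i = \<one>"
      using assms(3) unfolding torsion_free_subgroup_def by blast
    moreover obtain M where M: "open_normal M" "\<delta> l [^] i \<notin> M"
      using assms(1) l i unfolding separated_def by blast
    ultimately show False using open_normalD(3)[OF M(1)] subgroup.one_closed by metis
  qed
  then show ?thesis using assms(2,4) unfolding separated_def by blast
qed

lemma separated_cusps: "r > 0 \<Longrightarrow> separated 1"
proof -
  assume r: "r > 0"
  interpret Q: F_quotient G T g r ns \<alpha> \<beta> \<gamma> \<delta> "G Mod (carrier G)" "\<lambda>x. carrier G #> x"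
    by (rule F_quotient_Mod[OF open_normal_carrier])
  have triv: "carrier (G Mod carrier G) = {\<one>\<^bsub>G Mod carrier G\<^esub>}"
    using coset_join2[OF _ subgroup_self] by (auto simp: carrier_FactGroup image_iff)
  show "separated 1"
    unfolding separated_def
  proof (intro allI impI)
    fix l and i :: nat assume l: "l < length ns" "\<not> ns ! l dvd i"
    obtain M where "open_normal M" "derived G (carrier G) \<subseteq> M" "\<And>s::nat. \<delta> l [^] s \<in> M \<Longrightarrow> ns ! l dvd s"
      using Q.refine_cusps[OF r l(1) triv] by blast
    then show "\<exists>N. open_normal N \<and> der G 1 \<subseteq> N \<and> \<delta> l [^] i \<notin> N" using l by (auto simp: der_def)
  qed
qed

text \<open>Sending \<open>\<alpha> 0\<close> to the generator of a group of order 2 and all other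
  generators to the identity respects the relations. In this quotient every
  \<open>\<delta> l\<close> is trivial, so none generates it and \<open>refine_one\<close> applies
  to each.\<close>

lemma separated_genus:
  assumes g: "g > 0" and r: "r = 0" shows "separated 2"
proof -
  let ?K = "integer_mod_group 2"
  interpret K: comm_group ?K by (rule abelian_integer_mod_group)
  have cK: "carrier ?K = {0..<2}" by (simp add: carrier_integer_mod_group)
  let ?a = "\<lambda>i::nat. if i = 0 then (1::int) else 0"
  have comm: "commutator ?K x y = \<one>\<^bsub>?K\<^esub>" if xy: "x \<in> carrier ?K" "y \<in> carrier ?K" for x y
  proof -
    have "commutator ?K x y \<in> derived ?K (carrier ?K)" using xy by (rule commutator_in_derived)
    then show ?thesis using K.derived_eq_singleton[of "carrier ?K"] by auto
  qed
  have one: "ordered_prod ?K f n = \<one>\<^bsub>?K\<^esub>" if f: "\<And>i. i < n \<Longrightarrow> f i = \<one>\<^bsub>?K\<^esub>" for f and n :: nat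
    using f by (intro K.ordered_prod_ind[where P = "\<lambda>x. x = \<one>\<^bsub>?K\<^esub>"]) auto
  have F: "F_relations ?K g r ns ?a (\<lambda>_. \<one>\<^bsub>?K\<^esub>) (\<lambda>_. \<one>\<^bsub>?K\<^esub>) (\<lambda>_. \<one>\<^bsub>?K\<^esub>)"
    unfolding F_relations_def using cK one comm by auto
  have fin: "finite (carrier ?K)" using cK by simp
  obtain \<phi> where \<phi>: "\<phi> \<in> hom G ?K" "open_normal (kernel G ?K \<phi>)"
    "\<And>i. i < g \<Longrightarrow> \<phi> (\<alpha> i) = ?a i \<and> \<phi> (\<beta> i) = \<one>\<^bsub>?K\<^esub>"
    "\<And>l. l < length ns \<Longrightarrow> \<phi> (\<delta> l) = \<one>\<^bsub>?K\<^esub>"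
    by (rule hom_exists[OF K.is_group fin F]) (rule that; assumption)
  interpret \<phi>: group_hom G ?K \<phi> using \<phi>(1) by unfold_locales
  let ?N = "kernel G ?K \<phi>"
  have N1: "der G 1 \<subseteq> ?N"
    by (rule \<phi>.der_subset_kernel) (simp add: der_def K.derived_eq_singleton)
  have \<alpha>: "\<alpha> 0 \<notin> ?N" using \<phi>(3)[OF g] by (simp add: kernel_def)
  show ?thesis
    unfolding separated_def
  proof (intro allI impI)
    fix l and i :: nat assume l: "l < length ns" "\<not> ns ! l dvd i"
    have "\<delta> l [^] i \<in> ?N" for i :: nat using l \<phi>(4) by (simp add: kernel_def \<phi>.hom_nat_pow)
    then have "?N #> (\<delta> l [^] i) = ?N" for i :: nat
      using quotient_one_iff[OF \<phi>.subgroup_kernel, of "\<delta> l [^] i"] l by simp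
    moreover have "?N #> \<alpha> 0 \<noteq> ?N"
      using quotient_one_iff[OF \<phi>.subgroup_kernel, of "\<alpha> 0"] \<alpha> g by simp
    ultimately have "\<exists>y\<in>carrier G. \<forall>i::nat. ?N #> y \<noteq> ?N #> (\<delta> l [^] i)"
      using g by (intro bexI[of _ "\<alpha> 0"]) (simp_all del: one_FactGroup)
    then have "\<not> cyclic_mod ?N (\<delta> l)" unfolding cyclic_mod_def by simp
    then obtain M where M: "open_normal M" "derived G ?N \<subseteq> M" "\<And>s::nat. \<delta> l [^] s \<in> M \<Longrightarrow> ns ! l dvd s"
      using Mod_refine_one[OF r \<phi>(2) l(1)] by metis
    have "der G 2 \<subseteq> derived G ?N"
      using mono_derived[OF N1] by (simp add: der_def numeral_2_eq_2)
    then show "\<exists>N. open_normal N \<and> der G 2 \<subseteq> N \<and> \<delta> l [^] i \<notin> N" using M l by blast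
  qed
qed

text \<open>Without genus and cusps the quotient is topologically generated by finitely many torsion
  elements. They lie in a finite subgroup \<open>P\<close>, whose preimage is a finite union of
  closed cosets, hence closed, hence everything. The complement of \<open>cder\<close> is then also
  a finite union of closed cosets.\<close>

lemma cder_open:
  assumes "g = 0" "r = 0" shows "open_normal cder"
proof -
  let ?D = "cder"
  interpret D: normal ?D G by (rule cder_normal)
  interpret A: comm_group "G Mod ?D"
    using der_subset_cder by (simp only: D.comm_quotient_iff)
  interpret q: group_hom G "G Mod ?D" "\<lambda>x. ?D #> x" by (rule D.quotient_hom)
  have "(?D #> \<delta> j) [^]\<^bsub>G Mod ?D\<^esub> (ns ! j) = \<one>\<^bsub>G Mod ?D\<^esub>" if j: "j < length ns" for j
    using q.hom_nat_pow[of "\<delta> j" "ns ! j"] \<delta>_pow[OF j] j q.hom_one by simp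
  then have "\<exists>P. finite P \<and> subgroup P (G Mod ?D) \<and> (\<lambda>j. ?D #> \<delta> j) ` {..<length ns} \<subseteq> P"
    using q.hom_closed period_ge_2 by (intro A.finite_torsion_generated[where n = "\<lambda>j. ns ! j"] conjI) (auto dest: period_ge_2)
  then obtain P where P: "finite P" "subgroup P (G Mod ?D)" "(\<lambda>j. ?D #> \<delta> j) ` {..<length ns} \<subseteq> P" by blast
  have closed_coset: "closedin T C" if C: "C \<in> carrier (G Mod ?D)" for C
  proof -
    from C obtain a where a: "a \<in> carrier G" "C = ?D #> a" by (auto simp: carrier_FactGroup)
    have "closedin T {x \<in> topspace T. \<one> \<otimes> x \<otimes> inv a \<in> ?D}"
      by (rule closedin_continuous_map_preimage[OF continuous_translation[OF one_closed inv_closed[OF a(1)]] closedin_cder])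
    also have "{x \<in> topspace T. \<one> \<otimes> x \<otimes> inv a \<in> ?D} = C"
      unfolding a(2) r_coset_preimage[OF D.subset a(1)] by (auto simp: a(1))
    finally show ?thesis .
  qed
  let ?S = "{x \<in> carrier G. ?D #> x \<in> P}"
  have S: "subgroup ?S G"
    using subgroup.m_closed[OF P(2)] subgroup.m_inv_closed[OF P(2)] subgroup.one_closed[OF P(2)] q.hom_one q.hom_inv q.hom_mult
    by unfold_locales (auto simp del: mult_FactGroup one_FactGroup)
  have PC: "P \<subseteq> carrier (G Mod ?D)" by (rule subgroup.subset[OF P(2)])
  have "?S = \<Union>P"
  proof
    show "?S \<subseteq> \<Union>P" using rcos_self[OF _ D.subgroup_axioms] by blast
    show "\<Union>P \<subseteq> ?S"
    proof
      fix x assume "x \<in> \<Union>P"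
      then obtain C where C: "C \<in> P" "x \<in> C" by blast
      then obtain a where a: "a \<in> carrier G" "C = ?D #> a" using PC by (auto simp: carrier_FactGroup)
      then have "x \<in> carrier G" using C(2) r_coset_subset_G[OF D.subset a(1)] by blast
      moreover have "?D #> x = C" using repr_independence[OF _ a(1) D.subgroup_axioms, of x] C(2) a(2) by simp
      ultimately show "x \<in> ?S" using C(1) by simp
    qed
  qed
  moreover have "closedin T (\<Union>P)" using P(1) PC closed_coset by (intro closedin_Union) auto
  ultimately have "closedin T ?S" by simp
  moreover have "gens \<subseteq> ?S" unfolding gens_def using assms P(3) by auto
  then have "generate G gens \<subseteq> ?S" by (rule generate_subgroup_incl[OF _ S])
  ultimately have "carrier G \<subseteq> ?S" using closure_of_minimal dense by metis
  then have carA: "carrier (G Mod ?D) \<subseteq> P" by (auto simp: carrier_FactGroup)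
  have "carrier G - ?D = \<Union>(carrier (G Mod ?D) - {?D})"
  proof
    show "carrier G - ?D \<subseteq> \<Union>(carrier (G Mod ?D) - {?D})"
    proof
      fix x assume x: "x \<in> carrier G - ?D"
      then have "?D #> x \<noteq> ?D" using quotient_one_iff[OF D.subgroup_axioms] by blast
      moreover have "x \<in> ?D #> x" using x rcos_self[OF _ D.subgroup_axioms] by blast
      ultimately show "x \<in> \<Union>(carrier (G Mod ?D) - {?D})" using x by (auto simp: carrier_FactGroup)
    qed
    show "\<Union>(carrier (G Mod ?D) - {?D}) \<subseteq> carrier G - ?D"
    proof
      fix x assume "x \<in> \<Union>(carrier (G Mod ?D) - {?D})"
      then obtain a where a: "a \<in> carrier G" "?D #> a \<noteq> ?D" "x \<in> ?D #> a" by (auto simp: carrier_FactGroup)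
      then have xc: "x \<in> carrier G" using r_coset_subset_G[OF D.subset a(1)] by blast
      have "?D #> x = ?D #> a" using repr_independence[OF a(3,1) D.subgroup_axioms] by simp
      then show "x \<in> carrier G - ?D" using a(2) xc quotient_one_iff[OF D.subgroup_axioms xc] by auto
    qed
  qed
  moreover have "closedin T (\<Union>(carrier (G Mod ?D) - {?D}))"
    using finite_subset[OF carA P(1)] closed_coset by (intro closedin_Union) auto
  ultimately have "closedin T (carrier G - ?D)" by simp
  then have "openin T (topspace T - (carrier G - ?D))" by (rule openin_diff[OF openin_topspace])
  moreover have "topspace T - (carrier G - ?D) = ?D" using D.subset by auto
  ultimately have "openin T ?D" by simp
  then show ?thesis using D.normal_axioms by (simp add: open_normal_def)
qed

lemma separated_step:
  assumes r: "r = 0" and N: "open_normal N" "der G m \<subseteq> N" and l: "l < length ns" "\<not> cyclic_mod N (\<delta> l)"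
    and i: "\<not> ns ! l dvd i"
  shows "\<exists>M. open_normal M \<and> der G (Suc m) \<subseteq> M \<and> \<delta> l [^] (i::nat) \<notin> M"
proof -
  obtain M where M: "open_normal M" "derived G N \<subseteq> M" "\<And>s::nat. \<delta> l [^] s \<in> M \<Longrightarrow> ns ! l dvd s"
    using Mod_refine_one[OF r N(1) l] by metis
  have "der G (Suc m) \<subseteq> M" using mono_derived[OF N(2)] M(2) unfolding der_Suc by blast
  then show ?thesis using M i by blast
qed

text \<open>A common divisor \<open>p\<close> of the periods at \<open>j1\<close> and
  \<open>j2\<close> yields an abelian quotient by \<open>refine_two\<close> in which
  \<open>\<delta> l\<close> is trivial, while the order of \<open>\<delta> j1\<close> is divisible
  by \<open>p\<close>. As \<open>\<delta> l\<close> generates all abelian quotients by open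
  subgroups, \<open>p\<close> must be 1.\<close>

lemma periods_coprime:
  assumes gr: "g = 0" "r = 0" and l: "l < length ns" "cyclic_mod cder (\<delta> l)"
    and j: "j1 < length ns" "j2 < length ns" "j1 \<noteq> j2" "j1 \<noteq> l" "j2 \<noteq> l"
  shows "coprime (ns ! j1) (ns ! j2)"
proof (rule coprimeI)
  let ?D = "cder"
  note Do = open_normalD[OF cder_open[OF gr]]
  fix p assume p: "p dvd ns ! j1" "p dvd ns ! j2"
  have p0: "p > 0" using p(1) period_ge_2[OF j(1)] by (auto intro: Nat.gr0I)
  obtain M where M: "open_normal M" "derived G (carrier G) \<subseteq> M"
    "\<And>s::nat. \<delta> j1 [^] (rord (carrier G) (\<delta> j1) * s) \<in> M \<Longrightarrow> p dvd s"
    "\<And>i s. i < length ns \<Longrightarrow> i \<noteq> j1 \<Longrightarrow> i \<noteq> j2 \<Longrightarrow> \<delta> i [^] s \<in> carrier G \<Longrightarrow> \<delta> i [^] (s::nat) \<in> M"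
    using Mod_refine_two[OF gr(2) open_normal_carrier j(1,2) j(3)[symmetric] p0] p j by (metis mult_1_right rord_whole)
  have DM: "?D \<subseteq> M" using M(1,2) by (intro cder_least) (simp_all add: der_def)
  obtain i :: nat where "?D #> \<delta> j1 = ?D #> (\<delta> l [^] i)" using l(2) j(1) unfolding cyclic_mod_def by force
  then have "\<delta> j1 \<otimes> inv (\<delta> l [^] i) \<in> M" using r_coset_eq_iff[OF Do(3)] j l DM by auto
  moreover have "\<delta> l [^] i \<in> M" using M(4)[of l i] l j by auto
  ultimately have "(\<delta> j1 \<otimes> inv (\<delta> l [^] i)) \<otimes> \<delta> l [^] i \<in> M"
    by (rule subgroup.m_closed[OF open_normalD(3)[OF M(1)]])
  then have "\<delta> j1 [^] (rord (carrier G) (\<delta> j1) * 1) \<in> M" using j l by (simp add: m_assoc)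
  then show "is_unit p" using M(3) by blast
qed

text \<open>If \<open>\<delta> l\<close> generates \<open>G\<close> modulo \<open>cder\<close>, pass to a quotient by another \<open>\<delta> j\<close> and refine there: this
  yields a metabelian quotient that is not generated by \<open>\<delta> l\<close>.\<close>
lemma separated_three:
  assumes gr: "g = 0" "r = 0" and k: "length ns \<ge> 3" and np: "cder \<noteq> carrier G"
  shows "separated 3"
  unfolding separated_def
proof (intro allI impI)
  let ?D = "cder"
  have D: "open_normal ?D" by (rule cder_open[OF gr])
  note Do = open_normalD[OF D]
  have d1: "der G 1 \<subseteq> ?D" by (rule der_subset_cder)
  fix l and i :: nat assume l: "l < length ns" "\<not> ns ! l dvd i"
  show "\<exists>N. open_normal N \<and> der G 3 \<subseteq> N \<and> \<delta> l [^] i \<notin> N"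
  proof (cases "cyclic_mod ?D (\<delta> l)")
    case False
    then obtain M where "open_normal M" "der G (Suc 1) \<subseteq> M" "\<delta> l [^] i \<notin> M"
      using separated_step[OF gr(2) D d1 l(1) _ l(2)] by blast
    moreover have "der G 3 \<subseteq> der G (Suc 1)" by (rule der_decreasing) simp
    ultimately show ?thesis by blast
  next
    case cyc: True
    have "\<exists>j1 j2. j1 < length ns \<and> j2 < length ns \<and> j1 \<noteq> j2 \<and> j1 \<noteq> l \<and> j2 \<noteq> l"
    proof -
      consider "l = 0" | "l = 1" | "l \<ge> 2" by linarith
      then show ?thesis
      proof cases
        case 1 then show ?thesis using k by (intro exI[of _ 1] exI[of _ 2]) auto
      next
        case 2 then show ?thesis using k by (intro exI[of _ 0] exI[of _ 2]) auto
      next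
        case 3 then show ?thesis using k by (intro exI[of _ 0] exI[of _ 1]) auto
      qed
    qed
    then obtain j1 j2 where j: "j1 < length ns" "j2 < length ns" "j1 \<noteq> j2" "j1 \<noteq> l" "j2 \<noteq> l" by blast
    \<comment> \<open>If both generated the quotient, they would have the same order there. It would
      divide the coprime periods at \<open>j1\<close> and \<open>j2\<close>, so the quotient would
      be trivial, against non-perfectness.\<close>
    have "\<not> cyclic_mod ?D (\<delta> j1) \<or> \<not> cyclic_mod ?D (\<delta> j2)"
    proof (rule ccontr)
      assume "\<not> (\<not> cyclic_mod ?D (\<delta> j1) \<or> \<not> cyclic_mod ?D (\<delta> j2))"
      then have c: "cyclic_mod ?D (\<delta> j1)" "cyclic_mod ?D (\<delta> j2)" by auto
      interpret Q: F_quotient G T g r ns \<alpha> \<beta> \<gamma> \<delta> "G Mod ?D" "\<lambda>x. ?D #> x" by (rule F_quotient_Mod[OF D])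
      obtain t :: nat where t: "?D #> \<delta> j2 = ?D #> (\<delta> j1 [^] t)" using c(1) j(2) unfolding cyclic_mod_def by force
      let ?o = "rord ?D (\<delta> j1)"
      have "?D #> (\<delta> j2 [^] ?o) = ?D #> (\<delta> j1 [^] (t * ?o))"
        using t j by (simp add: Q.\<pi>.hom_nat_pow Q.\<pi>.H.nat_pow_pow)
      also have "\<delta> j1 [^] (t * ?o) \<in> ?D" using rord_iff[OF D, of "\<delta> j1"] j by simp
      then have "?D #> (\<delta> j1 [^] (t * ?o)) = ?D" using quotient_one_iff[OF Do(3)] j by simp
      finally have "\<delta> j2 [^] ?o \<in> ?D" using quotient_one_iff[OF Do(3)] j by simp
      then have "rord ?D (\<delta> j2) dvd ?o" using rord_iff[OF D] j by simp
      then have "rord ?D (\<delta> j2) dvd ns ! j1" "rord ?D (\<delta> j2) dvd ns ! j2"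
        using rord_dvd_period[OF D] j dvd_trans by blast+
      then have "rord ?D (\<delta> j2) = 1"
        using periods_coprime[OF gr l(1) cyc j] by (metis coprime_common_divisor nat_dvd_1_iff_1)
      then have all: "\<delta> j2 [^] t \<in> ?D" for t :: nat using rord_iff[OF D, of "\<delta> j2" t] j by simp
      have "y \<in> ?D" if y: "y \<in> carrier G" for y
      proof -
        obtain t :: nat where "?D #> y = ?D #> (\<delta> j2 [^] t)" using c(2) y unfolding cyclic_mod_def by blast
        then show ?thesis using all[of t] quotient_one_iff[OF Do(3)] j y by (metis gen_closed(4) nat_pow_closed)
      qed
      then show False using np subgroup.subset[OF Do(3)] by blast
    qed
    then obtain j where j: "j < length ns" "j \<noteq> l" "\<not> cyclic_mod ?D (\<delta> j)" using j by blast
    \<comment> \<open>The preimage of the subgroup generated by \<open>\<delta> j\<close> modulo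
      \<open>?D\<close>. It is proper because \<open>\<delta> j\<close> does not generate, and
      \<open>\<delta> j\<close> is trivial modulo \<open>N\<close>, so it has a second cycle
      there.\<close>
    define N where "N = {y \<in> carrier G. \<exists>t::nat. ?D #> y = ?D #> (\<delta> j [^] t)}"
    interpret Q: F_quotient G T g r ns \<alpha> \<beta> \<gamma> \<delta> "G Mod ?D" "\<lambda>x. ?D #> x" by (rule F_quotient_Mod[OF D])
    have \<delta>j: "?D #> (\<delta> j [^] t) = (?D #> \<delta> j) [^]\<^bsub>G Mod ?D\<^esub> t" for t :: nat
      using j by (simp add: Q.\<pi>.hom_nat_pow)
    have C: "subgroup (range (\<lambda>a::nat. (?D #> \<delta> j) [^]\<^bsub>G Mod ?D\<^esub> a)) (G Mod ?D)"
      using Q.\<pi>.H.finite_cyclic_subgroup(1)[of "?D #> \<delta> j" "ns ! j"] \<delta>j[of "ns ! j"] \<delta>_pow[OF j(1)]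
        Q.\<pi>.hom_closed[of "\<delta> j"] Q.\<pi>.hom_one j period_ge_2[OF j(1)] by simp
    have N_alt: "N = {y \<in> carrier G. ?D #> y \<in> range (\<lambda>a::nat. (?D #> \<delta> j) [^]\<^bsub>G Mod ?D\<^esub> a)}"
      unfolding N_def \<delta>j by auto
    have Nsub: "subgroup N G"
      unfolding N_alt
      using subgroup.m_closed[OF C] subgroup.m_inv_closed[OF C] subgroup.one_closed[OF C] Q.\<pi>.hom_one Q.\<pi>.hom_inv Q.\<pi>.hom_mult
      by unfold_locales (auto simp del: mult_FactGroup one_FactGroup rangeE)
    have DN: "?D \<subseteq> N"
    proof
      fix x assume x: "x \<in> ?D"
      then have xc: "x \<in> carrier G" using subgroup.subset[OF Do(3)] by blast
      then have "?D #> x = ?D #> (\<delta> j [^] (0::nat))"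
        using x quotient_one_iff[OF Do(3) xc] coset_mult_one[OF subgroup.subset[OF Do(3)]] by simp
      then show "x \<in> N" unfolding N_def using xc by blast
    qed
    have N: "open_normal N"
      using d1 DN by (intro supergroup_der_open_normal open_supergroup[OF Do(1,3) Nsub DN] Nsub) blast
    have \<delta>N: "\<delta> j [^] t \<in> N" for t :: nat unfolding N_def using j by auto
    have ncN: "\<not> cyclic_mod N (\<delta> j)"
    proof
      assume c: "cyclic_mod N (\<delta> j)"
      have "\<exists>t::nat. ?D #> y = ?D #> (\<delta> j [^] t)" if y: "y \<in> carrier G" for y
      proof -
        obtain t :: nat where "N #> y = N #> (\<delta> j [^] t)" using c y unfolding cyclic_mod_def by blast
        then have "y \<in> N" using \<delta>N[of t] quotient_one_iff[OF Nsub] j y by (metis gen_closed(4) nat_pow_closed)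
        then show ?thesis unfolding N_def by blast
      qed
      then show False using j(3) unfolding cyclic_mod_def by blast
    qed
    obtain M where M: "open_normal M" "M \<subseteq> N" "derived G N \<subseteq> M" "\<And>s::nat. \<delta> j [^] s \<in> M \<Longrightarrow> ns ! j dvd s"
      "\<And>i s. i < length ns \<Longrightarrow> i \<noteq> j \<Longrightarrow> \<delta> i [^] s \<in> N \<Longrightarrow> \<delta> i [^] (s::nat) \<in> M"
      using Mod_refine_one[OF gr(2) N j(1) ncN] by blast
    note Mo = open_normalD[OF M(1)]
    have M2: "der G 2 \<subseteq> M"
    proof -
      have "der G 1 \<subseteq> N" using d1 DN by blast
      then have "der G 2 \<subseteq> derived G N" using mono_derived by (simp add: der_def numeral_2_eq_2)
      then show ?thesis using M(3) by blast
    qed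
    \<comment> \<open>The refinement gave \<open>\<delta> j\<close> its full order but left the
      order of \<open>\<delta> l\<close> as it was modulo \<open>N\<close>. If
      \<open>\<delta> j\<close> agreed with a power of \<open>\<delta> l\<close> modulo
      \<open>M\<close>, that power would lie in \<open>N\<close>, hence in \<open>M\<close>, and so
      would \<open>\<delta> j\<close>.\<close>
    have "\<not> cyclic_mod M (\<delta> l)"
    proof
      assume "cyclic_mod M (\<delta> l)"
      then obtain t :: nat where t: "M #> \<delta> j = M #> (\<delta> l [^] t)" using j(1) unfolding cyclic_mod_def by force
      then have 1: "\<delta> j \<otimes> inv (\<delta> l [^] t) \<in> M" using r_coset_eq_iff[OF Mo(3)] j l by simp
      then have "\<delta> j \<otimes> inv (\<delta> l [^] t) \<in> N" using M(2) by blast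
      then have "inv (\<delta> j \<otimes> inv (\<delta> l [^] t)) \<otimes> \<delta> j [^] (1::nat) \<in> N"
        by (rule subgroup.m_closed[OF Nsub subgroup.m_inv_closed[OF Nsub] \<delta>N])
      then have "\<delta> l [^] t \<in> N" using j l by (simp add: word_simps)
      then have "\<delta> l [^] t \<in> M" using M(5) l j by blast
      then have "(\<delta> j \<otimes> inv (\<delta> l [^] t)) \<otimes> \<delta> l [^] t \<in> M" by (rule subgroup.m_closed[OF Mo(3) 1])
      then have "\<delta> j [^] (1::nat) \<in> M" using j l by (simp add: m_assoc)
      then have "ns ! j dvd 1" using M(4) by blast
      then show False using period_ge_2[OF j(1)] by simp
    qed
    then show ?thesis using separated_step[OF gr(2) M(1) M2 l(1) _ l(2)] by (simp add: numeral_3_eq_3)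
  qed
qed

lemma nonperfect_length:
  assumes gr: "g = 0" "r = 0" and np: "cder \<noteq> carrier G" shows "length ns \<ge> 2"
proof (rule ccontr)
  assume "\<not> length ns \<ge> 2"
  then consider "length ns = 0" | "length ns = 1" by linarith
  then have "gens \<subseteq> {\<one>}"
  proof cases
    case 1 then show ?thesis unfolding gens_def using gr by auto
  next
    case 2
    then have "\<delta> 0 = \<one>" using relation gr ordered_prod_Suc[of 0 \<delta>] by simp
    then show ?thesis unfolding gens_def using gr 2 by auto
  qed
  moreover have "\<one> \<in> cder" using open_normalD(3)[OF cder_open[OF gr]] by (rule subgroup.one_closed)
  ultimately have "cder = carrier G"
    using open_normalD[OF cder_open[OF gr]] by (intro open_subgroup_eq_carrier) auto
  then show False using np by simp
qed

text \<open>The relation makes \<open>\<delta> 1\<close> the inverse of \<open>\<delta> 0\<close>,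
  so \<open>G\<close> is finite cyclic and the trivial subgroup is open. This covers two different
  periods, where the common order of \<open>\<delta> 0\<close> and \<open>\<delta> 1\<close> divides
  both periods and \<open>separated m\<close> fails for every \<open>m\<close>.\<close>

lemma two_periods_finite_cyclic:
  assumes gr: "g = 0" "r = 0" and k: "length ns = 2"
  shows "torsion_free_open_characteristic G T {\<one>}" "der G 1 \<subseteq> {\<one>}"
proof -
  have "\<delta> 0 \<otimes> \<delta> 1 = \<one>"
    using relation gr k by (simp add: numeral_2_eq_2 ordered_prod_Suc)
  then have "inv (\<delta> 1) = \<delta> 0" using k by (intro inv_equality) auto
  then have \<delta>1: "\<delta> 1 = inv (\<delta> 0)" using k by (metis gen_closed(4) inv_inv one_less_numeral_iff semiring_norm(76))
  let ?C = "range (\<lambda>a::nat. \<delta> 0 [^] a)"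
  have C: "subgroup ?C G" "finite ?C"
    using finite_cyclic_subgroup[of "\<delta> 0" "ns ! 0"] \<delta>_pow[of 0] period_ge_2[of 0] k by auto
  have closed: "closedin T A" if "finite A" "A \<subseteq> carrier G" for A
    using that hausdorff Hausdorff_imp_t1_space t1_space_closedin_finite by (metis topspace_eq)
  have "\<delta> 0 [^] (1::nat) \<in> ?C" by blast
  then have "\<delta> 0 \<in> ?C" using k by simp
  then have "gens \<subseteq> ?C"
    unfolding gens_def using gr k \<delta>1 subgroup.m_inv_closed[OF C(1)] by (auto simp: less_2_cases_iff numeral_2_eq_2 less_Suc_eq)
  then have "generate G gens \<subseteq> ?C" by (rule generate_subgroup_incl[OF _ C(1)])
  then have car: "carrier G \<subseteq> ?C"
    using closure_of_minimal[OF _ closed[OF C(2) subgroup.subset[OF C(1)]]] dense by blast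
  have fin: "finite (carrier G)" using finite_subset[OF car C(2)] .
  have "openin T (topspace T - (carrier G - {\<one>}))"
    using closed[of "carrier G - {\<one>}"] fin by (intro openin_diff[OF openin_topspace]) auto
  moreover have "topspace T - (carrier G - {\<one>}) = {\<one>}" by auto
  ultimately have op: "openin T {\<one>}" by simp
  have "\<phi> ` {\<one>} = {\<one>}" if "\<phi> \<in> iso G G" for \<phi>
    using that by (auto simp: iso_def hom_one)
  then show "torsion_free_open_characteristic G T {\<one>}"
    unfolding torsion_free_open_characteristic_def torsion_free_subgroup_def characteristic_subgroup_def
    using op triv_subgroup by auto
  have "x \<otimes> y = y \<otimes> x" if xy: "x \<in> carrier G" "y \<in> carrier G" for x y
  proof -
    obtain a b :: nat where "x = \<delta> 0 [^] a" "y = \<delta> 0 [^] b" using xy car by blast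
    then show ?thesis using k by (simp add: nat_pow_mult add.commute)
  qed
  then interpret comm_group G by (intro group_comm_groupI)
  show "der G 1 \<subseteq> {\<one>}" by (simp add: der_def derived_eq_singleton)
qed

end

section \<open>Period conditions and the transfer\<close>

lemma prime_power_dvd_lcm:
  fixes x y :: nat
  assumes "prime p" "p ^ a dvd lcm x y" shows "p ^ a dvd x \<or> p ^ a dvd y"
proof (cases "x = 0 \<or> y = 0")
  case False
  then have xy: "x \<noteq> 0" "y \<noteq> 0" by auto
  have u: "\<not> is_unit p" using assms(1) by auto
  have "a \<le> multiplicity p (lcm x y)"
    using assms(2) power_dvd_iff_le_multiplicity[of "lcm x y" p a] xy u by simp
  also have "\<dots> = max (multiplicity p x) (multiplicity p y)"
    using assms(1) xy by (simp add: multiplicity_lcm)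
  finally show ?thesis using multiplicity_dvd'[of a p x] multiplicity_dvd'[of a p y] by linarith
qed auto

lemma prime_power_dvd_Lcm:
  fixes A :: "nat set"
  assumes "finite A" "prime p" "p ^ a dvd Lcm A" "a > 0" shows "\<exists>x\<in>A. p ^ a dvd x"
  using assms
proof (induction A rule: finite_induct)
  case empty
  then show ?case using prime_gt_1_nat[of p] by (simp add: is_unit_power_iff)
next
  case (insert x A)
  then show ?case using prime_power_dvd_lcm[of p a x "Lcm A"] by auto
qed

text \<open>\<open>q\<close> is the full power in \<open>n\<close> of a prime that obstructs
  \<open>n dvd i\<close>. A prime power divides a least common multiple only by dividing one of its
  members, so a condition on an \<open>Lcm\<close> yields a single partner for
  \<open>q\<close>.\<close>

lemma non_dvd_witness:
  fixes n i :: nat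
  assumes "n > 0" "\<not> n dvd i"
  obtains q where "q > 0" "q dvd n" "\<not> q dvd i" "\<And>A. finite A \<Longrightarrow> n dvd Lcm A \<Longrightarrow> \<exists>x\<in>A. q dvd x"
proof -
  obtain p where p: "prime p" "\<not> multiplicity p n \<le> multiplicity p i"
    using multiplicity_le_imp_dvd[of n i] assms by blast
  let ?q = "p ^ multiplicity p n"
  have qn: "?q dvd n" by (rule multiplicity_dvd)
  have pos: "multiplicity p n > 0" using p(2) by linarith
  show thesis
  proof (rule that[of ?q])
    show "?q > 0" using p(1) prime_gt_0_nat by simp
    have "i \<noteq> 0" using assms(2) by (metis dvd_0_right)
    moreover have "\<not> is_unit p" using p(1) by auto
    ultimately show "\<not> ?q dvd i" using power_dvd_iff_le_multiplicity[of i p] p(2) by blast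
    show "\<exists>x\<in>A. ?q dvd x" if "finite A" "n dvd Lcm A" for A
      using prime_power_dvd_Lcm[OF that(1) p(1) _ pos] qn that(2) dvd_trans by blast
  qed (rule qn)
qed

text \<open>A period contributed by at least two cycles of one generator divides another copy of
  itself, so only those \<open>l\<close> with \<open>w l = 1\<close> impose a condition. Entries
  equal to 1 do not affect an \<open>Lcm\<close>. A lone period would have to divide the empty
  \<open>Lcm\<close>, which is 1, and this accounts for the clause on the size.\<close>

lemma period_condition_multiset:
  fixes p w :: "nat \<Rightarrow> nat"
  assumes w: "\<And>l. l < k \<Longrightarrow> w l > 0"
  defines "P \<equiv> filter_mset (\<lambda>n. n \<noteq> 1) (\<Sum>l<k. replicate_mset (w l) (p l))"
  shows "(size P \<noteq> 1 \<and> (\<forall>n. n \<in># P \<longrightarrow> n dvd Lcm (set_mset (P - {#n#}))))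
    \<longleftrightarrow> (\<forall>l<k. w l = 1 \<longrightarrow> p l dvd Lcm (p ` ({..<k} - {l})))"
proof -
  define R where "R l = filter_mset (\<lambda>n. n \<noteq> 1) (\<Sum>i\<in>{..<k} - {l}. replicate_mset (w i) (p i))" for l
  have P: "P = filter_mset (\<lambda>n. n \<noteq> 1) (replicate_mset (w l) (p l)) + R l" if "l < k" for l
    using that unfolding P_def R_def by (subst sum.remove[of "{..<k}" l]) auto
  have rep: "filter_mset (\<lambda>n. n \<noteq> 1) (replicate_mset a b) = replicate_mset a b" if "b \<noteq> 1" for a b :: nat
    using that by (induction a) auto
  have setsum: "set_mset (\<Sum>i\<in>I. replicate_mset (w i) (p i)) = p ` I" if "I \<subseteq> {..<k}" for I
    using finite_subset[OF that finite_lessThan] that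
  proof (induction I rule: finite_induct)
    case (insert i I) then show ?case using w[of i] by auto
  qed simp
  have setP: "set_mset P = p ` {..<k} - {1}"
    unfolding P_def using setsum[of "{..<k}"] by auto
  have setR: "set_mset (R l) = p ` ({..<k} - {l}) - {1}" for l
    unfolding R_def using setsum[of "{..<k} - {l}"] by auto
  have Lcm1: "Lcm (A - {1}) = Lcm A" for A :: "nat set"
    by (cases "1 \<in> A") (metis Lcm_insert insert_Diff lcm_1_left normalize_nat_def id_apply Lcm_nat_def normalize_Lcm, simp)
  show ?thesis
  proof (intro iffI allI impI conjI)
    fix l assume h: "size P \<noteq> 1 \<and> (\<forall>n. n \<in># P \<longrightarrow> n dvd Lcm (set_mset (P - {#n#})))" and l: "l < k" "w l = 1"
    show "p l dvd Lcm (p ` ({..<k} - {l}))"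
    proof (cases "p l = 1")
      case False
      then have "P = {#p l#} + R l" using P[OF l(1)] l(2) by simp
      then have "p l \<in># P" "P - {#p l#} = R l" by simp_all
      then have "p l dvd Lcm (set_mset (R l))" using h by metis
      then show ?thesis unfolding setR Lcm1 .
    qed simp
  next
    assume h: "\<forall>l<k. w l = 1 \<longrightarrow> p l dvd Lcm (p ` ({..<k} - {l}))"
    have main: "n dvd Lcm (set_mset (P - {#n#}))" if n: "n \<in># P" for n
    proof -
      obtain l where l: "l < k" "n = p l" "p l \<noteq> 1" using n unfolding setP by auto
      have PP: "P = replicate_mset (w l) n + R l" using P[OF l(1)] rep[OF l(3), of "w l"] l(2) by simp
      show ?thesis
      proof (cases "w l = 1")
        case True
        then have "P - {#n#} = R l" using PP by simp
        then show ?thesis using h l True unfolding l(2) by (simp only: setR Lcm1) 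
      next
        case False
        then obtain v where "w l = Suc (Suc v)" using w[OF l(1)] by (metis One_nat_def gr0_implies_Suc not0_implies_Suc)
        then have "n \<in># P - {#n#}" using PP by simp
        then show ?thesis by (rule dvd_Lcm)
      qed
    qed
    then show "n dvd Lcm (set_mset (P - {#n#}))" if "n \<in># P" for n using that by blast
    show "size P \<noteq> 1"
    proof
      assume "size P = 1"
      then obtain n where n: "P = {#n#}" using size_1_singleton_mset by blast
      then have "n dvd 1" using main[of n] by simp
      moreover have "n \<noteq> 1" using n setP by auto
      ultimately show False by simp
    qed
  qed
qed

section \<open>Cycles on coset spaces and the transfer\<close>

context normal
begin

lemma lcosetsE:
  assumes "C \<in> lcosets H" obtains a where "a \<in> carrier G" "C = a <# H"
  using assms by (auto simp: LCOSETS_def)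

lemma lcos_closed [simp]:
  assumes "x \<in> carrier G" "C \<in> lcosets H" shows "x <# C \<in> lcosets H"
proof -
  from assms(2) obtain a where "a \<in> carrier G" "C = a <# H" by (rule lcosetsE)
  then show ?thesis using assms(1) lcos_m_assoc[OF subset] by (auto simp: LCOSETS_def)
qed

lemma lcos_mult:
  assumes "x \<in> carrier G" "y \<in> carrier G" "C \<in> lcosets H" shows "(x \<otimes> y) <# C = x <# (y <# C)"
  using assms lcosets_carrier[OF is_group assms(3)] by (simp add: lcos_m_assoc)

lemma lcos_one: "C \<in> lcosets H \<Longrightarrow> \<one> <# C = C"
  using lcosets_carrier[OF is_group] by (simp add: lcos_mult_one)

lemma lcos_eq_iff:
  assumes "x \<in> carrier G" "y \<in> carrier G" shows "x <# H = y <# H \<longleftrightarrow> inv x \<otimes> y \<in> H"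
proof
  assume "x <# H = y <# H"
  then have "y \<in> x <# H" using lcos_self[OF assms(2) subgroup_axioms] by simp
  then show "inv x \<otimes> y \<in> H" by (rule lcos_module_imp[OF is_group assms(1)])
next
  assume "inv x \<otimes> y \<in> H"
  then have "y \<in> x <# H" by (rule lcos_module_rev[OF is_group assms])
  then show "x <# H = y <# H" by (rule l_repr_independence[OF _ assms(1) subgroup_axioms])
qed

lemma lcos_fixed_iff:
  assumes "x \<in> carrier G" "C \<in> lcosets H" shows "x <# C = C \<longleftrightarrow> x \<in> H"
proof -
  from assms(2) obtain a where a: "a \<in> carrier G" "C = a <# H" by (rule lcosetsE)
  have "x <# C = (x \<otimes> a) <# H" unfolding a(2) by (rule lcos_m_assoc[OF subset assms(1) a(1)])
  then have "x <# C = C \<longleftrightarrow> inv a \<otimes> (x \<otimes> a) \<in> H"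
    using a assms(1) lcos_eq_iff[of a "x \<otimes> a"] by auto
  also have "\<dots> \<longleftrightarrow> x \<in> H"
  proof
    assume "inv a \<otimes> (x \<otimes> a) \<in> H"
    then have "a \<otimes> (inv a \<otimes> (x \<otimes> a)) \<otimes> inv a \<in> H" using a(1) by (intro inv_op_closed2)
    then show "x \<in> H" using a(1) assms(1) by (simp add: word_simps)
  next
    assume "x \<in> H"
    then show "inv a \<otimes> (x \<otimes> a) \<in> H" using inv_op_closed1[OF a(1)] a(1) assms(1) by (simp add: m_assoc)
  qed
  finally show ?thesis .
qed

lemma lcos_pow_Suc:
  assumes "x \<in> carrier G" "C \<in> lcosets H" shows "x [^] Suc n <# C = x <# (x [^] n <# C)"
proof -
  have "x [^] Suc n = x \<otimes> x [^] n" using assms(1) by (rule nat_pow_Suc2)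
  then show ?thesis using lcos_mult[OF assms(1) _ assms(2)] assms(1) by simp
qed

lemma lcos_pow_inj:
  assumes x: "x \<in> carrier G" and C: "C \<in> lcosets H" and f: "\<And>i::nat. x [^] i \<in> H \<longleftrightarrow> f dvd i"
  shows "inj_on (\<lambda>i::nat. x [^] i <# C) {..<f}"
proof (rule linorder_inj_onI)
  fix i j :: nat assume ij: "i < j" "i \<in> {..<f}" "j \<in> {..<f}"
  show "x [^] i <# C \<noteq> x [^] j <# C"
  proof
    assume eq: "x [^] i <# C = x [^] j <# C"
    have "x [^] j = x [^] (j - i) \<otimes> x [^] i" using x ij by (simp add: nat_pow_mult)
    then have "x [^] (j - i) <# (x [^] i <# C) = x [^] i <# C"
      using eq lcos_mult[OF _ _ C, of "x [^] (j - i)" "x [^] i"] x by simp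
    then have "f dvd j - i" using f lcos_fixed_iff[of "x [^] (j - i)" "x [^] i <# C"] x C by simp
    then show False using ij by (auto dest: dvd_imp_le)
  qed
qed auto

lemma lcos_pow_period:
  assumes x: "x \<in> carrier G" and C: "C \<in> lcosets H" and f: "\<And>i::nat. x [^] i \<in> H \<longleftrightarrow> f dvd i" "f > 0"
  shows "range (\<lambda>i::nat. x [^] i <# C) = (\<lambda>i. x [^] i <# C) ` {..<f}"
proof
  show "range (\<lambda>i::nat. x [^] i <# C) \<subseteq> (\<lambda>i. x [^] i <# C) ` {..<f}"
  proof
    fix D assume "D \<in> range (\<lambda>i::nat. x [^] i <# C)"
    then obtain i :: nat where i: "D = x [^] i <# C" by blast
    have "x [^] i = x [^] (i mod f) \<otimes> x [^] (f * (i div f))" using x by (simp add: nat_pow_mult)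
    then have "D = x [^] (i mod f) <# (x [^] (f * (i div f)) <# C)"
      unfolding i using lcos_mult[OF _ _ C] x by (metis nat_pow_closed)
    also have "x [^] (f * (i div f)) <# C = C" using lcos_fixed_iff[OF _ C] x f(1) by simp
    finally show "D \<in> (\<lambda>i. x [^] i <# C) ` {..<f}" using f(2) by auto
  qed
qed auto

text \<open>Because \<open>H\<close> is normal, a power of \<open>x\<close> fixes one coset exactly
  if it lies in \<open>H\<close>. All cycles therefore have the same length
  \<open>f\<close>.\<close>

lemma coset_cycle:
  assumes x: "x \<in> carrier G" and C: "C \<in> lcosets H" and f: "\<And>i::nat. x [^] i \<in> H \<longleftrightarrow> f dvd i" "f > 0"
  shows "orbit (\<lambda>C. x <# C) C = range (\<lambda>i::nat. x [^] i <# C)"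
    and "card (orbit (\<lambda>C. x <# C) C) = f" and "C \<in> orbit (\<lambda>C. x <# C) C"
proof -
  have pow: "((\<lambda>C. x <# C) ^^ n) C = x [^] n <# C" for n
  proof (induction n)
    case 0 show ?case using lcos_one[OF C] by simp
  next
    case (Suc n) then show ?case using lcos_pow_Suc[OF x C] by simp
  qed
  have "((\<lambda>C. x <# C) ^^ f) C = C" unfolding pow using lcos_fixed_iff[OF _ C] x f(1) by simp
  then show self: "C \<in> orbit (\<lambda>C. x <# C) C"
    unfolding orbit_altdef using f(2) by (intro CollectI exI[of _ f]) simp
  show eq: "orbit (\<lambda>C. x <# C) C = range (\<lambda>i::nat. x [^] i <# C)"
    unfolding orbit_altdef_self_in[OF self] pow by auto
  show "card (orbit (\<lambda>C. x <# C) C) = f"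
    unfolding eq lcos_pow_period[OF x C f] using card_image[OF lcos_pow_inj[OF x C f(1)]] by simp
qed

end

context abelian_normal
begin

text \<open>Along a cycle of \<open>x\<close> on \<open>L/B\<close> the defining product of the transfer telescopes to a conjugate
  of \<open>x [^] f\<close>.\<close>
theorem transfer:
  assumes fin: "finite (carrier L)"
  obtains \<tau> where "\<tau> \<in> hom L (L\<lparr>carrier := B\<rparr>)"
    "\<And>x f m. x \<in> carrier L \<Longrightarrow> (\<And>i::nat. x [^] i \<in> B \<longleftrightarrow> f dvd i) \<Longrightarrow> f > 0 \<Longrightarrow> x [^] (f * m) = \<one> \<Longrightarrow> \<tau> x [^] (m::nat) = \<one>"
    "\<And>x f. x \<in> carrier L \<Longrightarrow> (\<And>i::nat. x [^] i \<in> B \<longleftrightarrow> f dvd i) \<Longrightarrow> f > 0 \<Longrightarrow>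
      (\<And>y. y \<in> carrier L \<Longrightarrow> \<exists>i::nat. y <# B = x [^] i <# B) \<Longrightarrow> \<exists>u\<in>carrier L. \<tau> x = u \<otimes> x [^] f \<otimes> inv u"
proof -
  let ?B = "L\<lparr>carrier := B\<rparr>" and ?X = "lcosets B"
  interpret Bg: group ?B by (rule subgroup_is_group[OF is_group])
  interpret Bc: comm_group ?B
    using B_comm by (intro Bg.group_comm_groupI) simp
  have finX: "finite ?X" using fin unfolding LCOSETS_def by simp
  define t where "t C = (SOME z. z \<in> C)" for C :: "'a set"
  have t: "t C \<in> carrier L" "C = t C <# B" if C: "C \<in> ?X" for C
  proof -
    from C obtain a where a: "a \<in> carrier L" "C = a <# B" by (rule lcosetsE)
    then have "a \<in> C" using lcos_self[OF a(1) subgroup_axioms] by simp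
    then have "t C \<in> C" unfolding t_def by (rule someI)
    then show "t C \<in> carrier L" "C = t C <# B"
      using lcosets_carrier[OF is_group C] l_repr_independence[OF _ a(1) subgroup_axioms, of "t C"] a(2) by auto
  qed
  \<comment> \<open>The usual transfer factor: it measures by how much translation by
    \<open>x\<close> misses the representatives chosen by \<open>t\<close>.\<close>
  define c where "c x C = inv (t (x <# C)) \<otimes> (x \<otimes> t C)" for x C
  have cB: "c x C \<in> B" if x: "x \<in> carrier L" and C: "C \<in> ?X" for x C
  proof -
    have "t (x <# C) <# B = (x \<otimes> t C) <# B"
      using t[OF C] t(2)[OF lcos_closed[OF x C]] lcos_m_assoc[OF subset x t(1)[OF C]] by metis
    then show ?thesis
      unfolding c_def using lcos_eq_iff t(1) lcos_closed x C by simp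
  qed
  have cPi: "c x \<in> Y \<rightarrow> carrier ?B" if "x \<in> carrier L" "Y \<subseteq> ?X" for x Y using that cB by auto
  have cX: "c x \<in> ?X \<rightarrow> carrier ?B" if "x \<in> carrier L" for x using cPi[OF that] by blast
  define \<tau> where "\<tau> x = finprod ?B (c x) ?X" for x
  have \<tau>B: "\<tau> x \<in> B" if "x \<in> carrier L" for x
    unfolding \<tau>_def using Bc.finprod_closed[OF cX[OF that]] by simp
  have hom: "\<tau> (x \<otimes> x') = \<tau> x \<otimes> \<tau> x'" if x: "x \<in> carrier L" "x' \<in> carrier L" for x x'
  proof -
    have step: "c (x \<otimes> x') C = c x (x' <# C) \<otimes> c x' C" if C: "C \<in> ?X" for C
      unfolding c_def lcos_mult[OF x C]
      using t(1) x C lcos_closed by (simp add: word_simps)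
    have img: "(\<lambda>C. x' <# C) ` ?X = ?X"
    proof
      show "?X \<subseteq> (\<lambda>C. x' <# C) ` ?X"
      proof
        fix C assume C: "C \<in> ?X"
        then have "C = x' <# (inv x' <# C)" using lcos_mult[of x' "inv x'" C] lcos_one[OF C] x(2) by simp
        then show "C \<in> (\<lambda>C. x' <# C) ` ?X" using C x(2) lcos_closed[of "inv x'" C] by blast
      qed
    qed (use x(2) in auto)
    have inj: "inj_on (\<lambda>C. x' <# C) ?X" using finX img by (simp add: eq_card_imp_inj_on)
    have "\<tau> (x \<otimes> x') = finprod ?B (\<lambda>C. c x (x' <# C) \<otimes>\<^bsub>?B\<^esub> c x' C) ?X"
      unfolding \<tau>_def using step cB x by (intro Bc.finprod_cong') auto
    also have "\<dots> = finprod ?B (\<lambda>C. c x (x' <# C)) ?X \<otimes>\<^bsub>?B\<^esub> finprod ?B (c x') ?X"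
      using cB x by (intro Bc.finprod_multf) auto
    also have "finprod ?B (\<lambda>C. c x (x' <# C)) ?X = finprod ?B (c x) ((\<lambda>C. x' <# C) ` ?X)"
      using inj cX[OF x(1)] img by (subst Bc.finprod_reindex) auto
    finally show ?thesis unfolding img by (simp add: \<tau>_def)
  qed
  have tele: "finprod ?B (\<lambda>i. c x (x [^] i <# C)) {..<n} = inv (t (x [^] n <# C)) \<otimes> (x [^] n \<otimes> t C)"
    if x: "x \<in> carrier L" and C: "C \<in> ?X" for x C and n :: nat
  proof (induction n)
    case 0
    then show ?case using lcos_one[OF C] t(1)[OF C] by simp
  next
    case (Suc n)
    have Cn: "x [^] n <# C \<in> ?X" using x C by simp
    have "finprod ?B (\<lambda>i. c x (x [^] i <# C)) {..<Suc n}
      = c x (x [^] n <# C) \<otimes> finprod ?B (\<lambda>i. c x (x [^] i <# C)) {..<n}"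
      unfolding lessThan_Suc using cB x C by (subst Bc.finprod_insert) auto
    also have "\<dots> = c x (x [^] n <# C) \<otimes> (inv (t (x [^] n <# C)) \<otimes> (x [^] n \<otimes> t C))"
      by (simp only: Suc)
    also have "\<dots> = inv (t (x <# (x [^] n <# C))) \<otimes> (x \<otimes> x [^] n \<otimes> t C)"
      unfolding c_def using x t(1)[OF Cn] t(1)[OF C] t(1)[OF lcos_closed[OF x Cn]] by (simp add: word_simps)
    also have "x \<otimes> x [^] n = x [^] Suc n" using nat_pow_Suc2[OF x] by simp
    finally show ?case using lcos_pow_Suc[OF x C] by simp
  qed
  have cyc: "finprod ?B (c x) (range (\<lambda>i::nat. x [^] i <# C)) = inv (t C) \<otimes> (x [^] f \<otimes> t C)"
    if x: "x \<in> carrier L" and C: "C \<in> ?X" and f: "\<And>i::nat. x [^] i \<in> B \<longleftrightarrow> f dvd i" "f > 0" for x C f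
  proof -
    have "finprod ?B (c x) ((\<lambda>i::nat. x [^] i <# C) ` {..<f}) = finprod ?B (\<lambda>i. c x (x [^] i <# C)) {..<f}"
      using cB x C by (intro Bc.finprod_reindex lcos_pow_inj[OF x C f(1)]) auto
    moreover have "x [^] f <# C = C" using lcos_fixed_iff[OF _ C] x f(1) by simp
    ultimately show ?thesis unfolding lcos_pow_period[OF x C f] using tele[OF x C, of f] by simp
  qed
  show thesis
  proof (rule that[of \<tau>])
    show "\<tau> \<in> hom L ?B" using \<tau>B hom by (auto simp: hom_def)
    fix x f assume x: "x \<in> carrier L" and f: "\<And>i::nat. x [^] i \<in> B \<longleftrightarrow> f dvd i" "f > 0"
    {
      fix m :: nat assume m: "x [^] (f * m) = \<one>"
      \<comment> \<open>The product over all cosets is treated by removing one cycle at a time from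
        an \<open>x\<close>-stable set. Each cycle contributes a conjugate of
        \<open>x [^] f\<close>, whose power with exponent \<open>m\<close> is trivial.\<close>
      have "finprod ?B (c x) Y [^] m = \<one>" if "Y \<subseteq> ?X" "\<And>C. C \<in> Y \<Longrightarrow> x <# C \<in> Y" for Y
        using finite_subset[OF that(1) finX] that
      proof (induction Y rule: finite_psubset_induct)
        case (psubset Y)
        show ?case
        proof (cases "Y = {}")
          case False
          then obtain C where C: "C \<in> Y" by blast
          let ?O = "range (\<lambda>i::nat. x [^] i <# C)"
          have CX: "C \<in> ?X" using C psubset.prems(1) by blast
          have OY: "?O \<subseteq> Y"
          proof -
            have "x [^] i <# C \<in> Y" for i :: nat
            proof (induction i)
              case 0 then show ?case using C lcos_one[OF CX] by simp
            next
              case (Suc i) then show ?case using lcos_pow_Suc[OF x CX] psubset.prems(2) by simp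
            qed
            then show ?thesis by blast
          qed
          have "x [^] (0::nat) <# C \<in> ?O" by blast
          then have CO: "C \<in> ?O" using lcos_one[OF CX] by simp
          have "x <# D \<in> Y - ?O" if D: "D \<in> Y - ?O" for D
          proof -
            have DX: "D \<in> ?X" using D psubset.prems(1) by blast
            have "D \<in> ?O" if "x <# D \<in> ?O"
            proof -
              from that obtain i :: nat where i: "x <# D = x [^] i <# C" by blast
              have "x [^] f <# D = D" using lcos_fixed_iff[OF _ DX, of "x [^] f"] x f(1)[of f] by simp
              then have "D = x [^] f <# D" by (rule sym)
              also have "x [^] f = x [^] (f - 1) \<otimes> x" using f(2) by (cases f) auto
              also have "(x [^] (f - 1) \<otimes> x) <# D = x [^] (f - 1) <# (x [^] i <# C)"
                using lcos_mult[OF _ x DX] x i by simp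
              also have "\<dots> = x [^] (f - 1 + i) <# C" using lcos_mult[OF _ _ CX] x by (simp flip: nat_pow_mult)
              finally show ?thesis by blast
            qed
            then show ?thesis using D psubset.prems(2) by blast
          qed
          then have 1: "finprod ?B (c x) (Y - ?O) [^] m = \<one>"
            using CO C psubset.prems(1) by (intro psubset.IH) auto
          have "finprod ?B (c x) ?O [^] m = \<one>"
          proof -
            have tC: "t C \<in> carrier L" by (rule t(1)[OF CX])
            have "(inv (t C) \<otimes> x [^] f \<otimes> inv (inv (t C))) [^] m = inv (t C) \<otimes> (x [^] f) [^] m \<otimes> inv (inv (t C))"
              using x tC by (intro conj_nat_pow) auto
            also have "\<dots> = \<one>" using x tC m by (simp add: nat_pow_pow)
            finally show ?thesis unfolding cyc[OF x CX f] using x tC by (simp add: m_assoc)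
          qed
          moreover have Y: "finprod ?B (c x) Y = finprod ?B (c x) ?O \<otimes>\<^bsub>?B\<^esub> finprod ?B (c x) (Y - ?O)"
          proof -
            have Y: "Y = ?O \<union> (Y - ?O)" using OY by blast
            have "finprod ?B (c x) (?O \<union> (Y - ?O)) = finprod ?B (c x) ?O \<otimes>\<^bsub>?B\<^esub> finprod ?B (c x) (Y - ?O)"
              using psubset.hyps psubset.prems(1) OY finite_subset[OF OY] cB x
              by (intro Bc.finprod_Un_disjoint) auto
            then show ?thesis using Y by simp
          qed
          have "finprod ?B (c x) ?O \<in> carrier ?B" "finprod ?B (c x) (Y - ?O) \<in> carrier ?B"
            by (rule Bc.finprod_closed, rule cPi[OF x], use OY psubset.prems(1) in blast)+
          then have "(finprod ?B (c x) ?O \<otimes>\<^bsub>?B\<^esub> finprod ?B (c x) (Y - ?O)) [^]\<^bsub>?B\<^esub> m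
            = finprod ?B (c x) ?O [^]\<^bsub>?B\<^esub> m \<otimes>\<^bsub>?B\<^esub> finprod ?B (c x) (Y - ?O) [^]\<^bsub>?B\<^esub> m"
            by (rule Bc.nat_pow_distrib)
          ultimately show ?thesis
            unfolding Y nat_pow_consistent[where H = B, symmetric] using 1 by simp
        qed simp
      qed
      then show "\<tau> x [^] m = \<one>" unfolding \<tau>_def using x lcos_closed by blast
    }
    {
      assume gen: "\<And>y. y \<in> carrier L \<Longrightarrow> \<exists>i::nat. y <# B = x [^] i <# B"
      have BX: "B \<in> ?X" using lcos_mult_one[OF subset] unfolding LCOSETS_def by force
      \<comment> \<open>Here \<open>x\<close> permutes the cosets in one cycle, so the transfer
        consists of a single telescoping product.\<close>
      have "?X = range (\<lambda>i::nat. x [^] i <# B)"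
      proof
        show "?X \<subseteq> range (\<lambda>i::nat. x [^] i <# B)"
        proof
          fix D assume "D \<in> ?X"
          then obtain a where a: "a \<in> carrier L" "D = a <# B" by (rule lcosetsE)
          obtain i :: nat where "a <# B = x [^] i <# B" using gen[OF a(1)] by blast
          then show "D \<in> range (\<lambda>i::nat. x [^] i <# B)" unfolding a(2) by simp
        qed
        show "range (\<lambda>i::nat. x [^] i <# B) \<subseteq> ?X" using x BX by auto
      qed
      then have "\<tau> x = inv (t B) \<otimes> x [^] f \<otimes> inv (inv (t B))"
        unfolding \<tau>_def using cyc[OF x BX f] x t(1)[OF BX] by (simp add: m_assoc)
      then show "\<exists>u\<in>carrier L. \<tau> x = u \<otimes> x [^] f \<otimes> inv u" using t(1)[OF BX] by blast
    }
  qed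
qed

end

lemma (in group) ordered_prod_single:
  assumes "l < n" "f l \<in> carrier G" "\<And>i. i < n \<Longrightarrow> i \<noteq> l \<Longrightarrow> f i = \<one>"
  shows "ordered_prod G f n = f l"
proof -
  have c: "f i \<in> carrier G" if "i < n" for i using assms that by (cases "i = l") auto
  have "ordered_prod G f i = (if l < i then f l else \<one>)" if "i \<le> n" for i
    using that
  proof (induction i)
    case (Suc i)
    then have "ordered_prod G f (Suc i) = ordered_prod G f i \<otimes> f i" using c by (intro ordered_prod_Suc) auto
    then show ?case using Suc assms by (cases "i = l") (auto simp: less_Suc_eq)
  qed simp
  then show ?thesis using assms(1) by simp
qed

section \<open>Torsion-free open subgroups\<close>

lemma (in group) commutator_one_imp_commute:
  assumes "commutator G x y = \<one>" "x \<in> carrier G" "y \<in> carrier G"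
  shows "x \<otimes> y = y \<otimes> x"
proof -
  have "commutator G x y \<otimes> (y \<otimes> x) = x \<otimes> y"
    using assms(2,3) by (simp add: commutator_def word_simps)
  then show ?thesis using assms by simp
qed

lemma (in group) conj_eq_one_iff:
  assumes "u \<in> carrier G" "z \<in> carrier G" "u \<otimes> z \<otimes> inv u = \<one>" shows "z = \<one>"
proof -
  have "inv u \<otimes> (u \<otimes> z \<otimes> inv u) \<otimes> u = z" using assms(1,2) by (simp add: word_simps)
  then show ?thesis using assms by simp
qed

context F_group
begin

text \<open>The period that each cycle of \<open>\<delta> l\<close> on the quotient contributes to
  the signature of \<open>N\<close>, including the value 1 that the induced signature omits.\<close>

definition rperiod :: "'a set \<Rightarrow> nat \<Rightarrow> nat" where "rperiod N l = ns ! l div rord N (\<delta> l)"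

lemma rperiod_mult:
  assumes "open_normal N" "l < length ns" shows "ns ! l = rord N (\<delta> l) * rperiod N l"
  using rord_dvd_period[OF assms] by (simp add: rperiod_def)

text \<open>The period condition is needed only for a \<open>\<delta> l\<close> that generates the
  quotient, since otherwise a second cycle is available. For such \<open>l\<close> a prime power
  \<open>q\<close> witnesses that the remaining period does not divide the remaining exponent; the
  condition then provides another generator with room for \<open>q\<close>, and
  \<open>refine_two\<close> applies.\<close>

lemma separated_if_period_condition:
  assumes r: "r = 0" and N: "open_normal N" "der G m \<subseteq> N"
    and cond: "\<And>l. l < length ns \<Longrightarrow> cyclic_mod N (\<delta> l) \<Longrightarrow> rperiod N l dvd Lcm (rperiod N ` ({..<length ns} - {l}))"
  shows "separated (Suc m)"
  unfolding separated_def
proof (intro allI impI)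
  fix l and i :: nat assume l: "l < length ns" "\<not> ns ! l dvd i"
  show "\<exists>N. open_normal N \<and> der G (Suc m) \<subseteq> N \<and> \<delta> l [^] i \<notin> N"
  proof (cases "cyclic_mod N (\<delta> l)")
    case False
    then show ?thesis by (rule separated_step[OF r N l(1) _ l(2)])
  next
    case cyc: True
    show ?thesis
    proof (cases "\<delta> l [^] i \<in> N")
      case False
      moreover have "der G (Suc m) \<subseteq> N" using der_decreasing[of m "Suc m"] N(2) by auto
      ultimately show ?thesis using N(1) by blast
    next
      case True
      then obtain s where s: "i = rord N (\<delta> l) * s" using rord_iff[OF N(1)] l(1) by (auto elim: dvdE)
      have nl: "ns ! l = rord N (\<delta> l) * rperiod N l" by (rule rperiod_mult[OF N(1) l(1)])
      have "\<not> rperiod N l dvd s" using l(2) unfolding s nl by (auto dest: mult_dvd_mono[OF dvd_refl])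
      moreover have "rperiod N l > 0" using nl period_ge_2[OF l(1)] by (auto intro: Nat.gr0I)
      ultimately obtain q where q: "q > 0" "q dvd rperiod N l" "\<not> q dvd s"
        "\<And>A. finite A \<Longrightarrow> rperiod N l dvd Lcm A \<Longrightarrow> \<exists>x\<in>A. q dvd x"
        using non_dvd_witness by blast
      obtain j where j: "j < length ns" "j \<noteq> l" "q dvd rperiod N j"
        using q(4)[OF _ cond[OF l(1) cyc]] by auto
      have ql: "q * rord N (\<delta> l) dvd ns ! l" unfolding nl using q(2) by (simp add: mult.commute)
      have qj: "q * rord N (\<delta> j) dvd ns ! j" unfolding rperiod_mult[OF N(1) j(1)] using j(3) by (simp add: mult.commute)
      obtain M where M: "open_normal M" "derived G N \<subseteq> M"
        "\<And>s::nat. \<delta> l [^] (rord N (\<delta> l) * s) \<in> M \<Longrightarrow> q dvd s"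
        using Mod_refine_two[OF r N(1) l(1) j(1,2) q(1) ql qj] by metis
      have "\<delta> l [^] i \<notin> M" using M(3) q(3) unfolding s by blast
      moreover have "der G (Suc m) \<subseteq> M" using mono_derived[OF N(2)] M(2) unfolding der_Suc by blast
      ultimately show ?thesis using M(1) by blast
    qed
  qed
qed

end

context F_quotient
begin

text \<open>The image \<open>A\<close> of \<open>N\<close> in \<open>Q\<close> is abelian and
  normal, so the transfer from \<open>Q\<close> to \<open>A\<close> is defined. As
  \<open>\<delta> l\<close> has a single cycle on the quotient by \<open>N\<close>, its transfer is
  a conjugate of \<open>\<delta> l [^] rord N (\<delta> l)\<close> in \<open>Q\<close>, and a bound
  on the order of the transfer becomes one on \<open>\<delta> l\<close> itself.\<close>

lemma period_condition_if_exact: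
  assumes r: "r = 0" and N: "open_normal N" and MN: "kernel G Q \<pi> \<subseteq> N"
    and dM: "derived G N \<subseteq> kernel G Q \<pi>"
    and exact: "\<And>l i. l < length ns \<Longrightarrow> \<delta> l [^] (i::nat) \<in> kernel G Q \<pi> \<Longrightarrow> ns ! l dvd i"
    and l: "l < length ns" and cyc: "cyclic_mod N (\<delta> l)"
  shows "rperiod N l dvd Lcm (rperiod N ` ({..<length ns} - {l}))"
proof -
  let ?k = "length ns"
  note No = open_normalD[OF N]
  define A where "A = \<pi> ` N"
  have A_iff: "\<pi> x \<in> A \<longleftrightarrow> x \<in> N" if x: "x \<in> carrier G" for x
  proof
    assume "\<pi> x \<in> A"
    then obtain y where y: "y \<in> N" "\<pi> x = \<pi> y" unfolding A_def by blast
    have yc: "y \<in> carrier G" using y(1) subgroup.subset[OF No(3)] by blast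
    then have "x \<otimes> inv y \<in> kernel G Q \<pi>" using x y(2) by (simp add: kernel_def)
    then have "x \<otimes> inv y \<in> N" using MN by blast
    then have "x \<otimes> inv y \<otimes> y \<in> N" using y(1) by (rule subgroup.m_closed[OF No(3)])
    then show "x \<in> N" using x yc by (simp add: m_assoc)
  qed (auto simp: A_def)
  have Asub: "subgroup A Q" unfolding A_def by (rule \<pi>.subgroup_img_is_subgroup[OF No(3)])
  have "A \<lhd> Q"
    unfolding A_def by (rule normal.surj_hom_normal_subgroup[OF No(2) hom_\<pi> \<pi>_onto])
  moreover have "X \<otimes>\<^bsub>Q\<^esub> Y = Y \<otimes>\<^bsub>Q\<^esub> X" if XY: "X \<in> A" "Y \<in> A" for X Y
  proof -
    from XY obtain x y where xy: "x \<in> N" "y \<in> N" "X = \<pi> x" "Y = \<pi> y" unfolding A_def by blast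
    then have c: "x \<in> carrier G" "y \<in> carrier G" using subgroup.subset[OF No(3)] by auto
    have "commutator G x y \<in> kernel G Q \<pi>"
      using dM commutator_in_derived[OF xy(1,2), of G] by blast
    then have "commutator Q X Y = \<one>\<^bsub>Q\<^esub>"
      using \<pi>.hom_commutator[OF c] xy(3,4) by (simp add: kernel_def)
    moreover have "X \<in> carrier Q" "Y \<in> carrier Q" using subgroup.subset[OF Asub] XY by auto
    ultimately show ?thesis by (rule \<pi>.H.commutator_one_imp_commute)
  qed
  ultimately interpret A: abelian_normal A Q
    by (simp add: abelian_normal_def abelian_normal_axioms_def)
  obtain \<tau> where \<tau>: "\<tau> \<in> hom Q (Q\<lparr>carrier := A\<rparr>)"
    "\<And>x f m. x \<in> carrier Q \<Longrightarrow> (\<And>i::nat. x [^]\<^bsub>Q\<^esub> i \<in> A \<longleftrightarrow> f dvd i) \<Longrightarrow> f > 0 \<Longrightarrow>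
      x [^]\<^bsub>Q\<^esub> (f * m) = \<one>\<^bsub>Q\<^esub> \<Longrightarrow> \<tau> x [^]\<^bsub>Q\<^esub> (m::nat) = \<one>\<^bsub>Q\<^esub>"
    "\<And>x f. x \<in> carrier Q \<Longrightarrow> (\<And>i::nat. x [^]\<^bsub>Q\<^esub> i \<in> A \<longleftrightarrow> f dvd i) \<Longrightarrow> f > 0 \<Longrightarrow>
      (\<And>y. y \<in> carrier Q \<Longrightarrow> \<exists>i::nat. y <#\<^bsub>Q\<^esub> A = x [^]\<^bsub>Q\<^esub> i <#\<^bsub>Q\<^esub> A) \<Longrightarrow>
      \<exists>u\<in>carrier Q. \<tau> x = u \<otimes>\<^bsub>Q\<^esub> x [^]\<^bsub>Q\<^esub> f \<otimes>\<^bsub>Q\<^esub> inv\<^bsub>Q\<^esub> u"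
  proof (rule A.transfer[OF finite_Q])
    fix \<tau> assume t: "\<tau> \<in> hom Q (Q\<lparr>carrier := A\<rparr>)"
    "\<And>x f m. x \<in> carrier Q \<Longrightarrow> (\<And>i::nat. x [^]\<^bsub>Q\<^esub> i \<in> A \<longleftrightarrow> f dvd i) \<Longrightarrow> f > 0 \<Longrightarrow>
      x [^]\<^bsub>Q\<^esub> (f * m) = \<one>\<^bsub>Q\<^esub> \<Longrightarrow> \<tau> x [^]\<^bsub>Q\<^esub> (m::nat) = \<one>\<^bsub>Q\<^esub>"
    "\<And>x f. x \<in> carrier Q \<Longrightarrow> (\<And>i::nat. x [^]\<^bsub>Q\<^esub> i \<in> A \<longleftrightarrow> f dvd i) \<Longrightarrow> f > 0 \<Longrightarrow>
      (\<And>y. y \<in> carrier Q \<Longrightarrow> \<exists>i::nat. y <#\<^bsub>Q\<^esub> A = x [^]\<^bsub>Q\<^esub> i <#\<^bsub>Q\<^esub> A) \<Longrightarrow>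
      \<exists>u\<in>carrier Q. \<tau> x = u \<otimes>\<^bsub>Q\<^esub> x [^]\<^bsub>Q\<^esub> f \<otimes>\<^bsub>Q\<^esub> inv\<^bsub>Q\<^esub> u"
    show thesis
    proof (rule that)
    qed (fact t(1), fact t(2), fact t(3))
  qed
  let ?A = "Q\<lparr>carrier := A\<rparr>"
  interpret Ag: group ?A by (rule A.subgroup_is_group[OF \<pi>.H.is_group])
  interpret Ac: comm_group ?A using A.B_comm by (intro Ag.group_comm_groupI) simp
  \<comment> \<open>The power of the transfer with exponent \<open>K\<close> kills every
    \<open>\<delta> j\<close> with \<open>j \<noteq> l\<close>, since \<open>K\<close> is a multiple
    of their remaining periods. It also kills commutators because \<open>A\<close> is abelian. By
    the surface relation it then kills \<open>\<delta> l\<close>.\<close>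
  define K where "K = Lcm (rperiod N ` ({..<?k} - {l}))"
  define \<sigma> where "\<sigma> x = \<tau> x [^]\<^bsub>?A\<^esub> K" for x
  have \<tau>c: "\<tau> x \<in> carrier ?A" if "x \<in> carrier Q" for x using \<tau>(1) that by (rule hom_in_carrier)
  have "\<sigma> \<in> hom Q ?A"
  proof (rule homI)
    show "\<sigma> x \<in> carrier ?A" if "x \<in> carrier Q" for x unfolding \<sigma>_def using \<tau>c[OF that] by (rule Ag.nat_pow_closed)
    show "\<sigma> (x \<otimes>\<^bsub>Q\<^esub> y) = \<sigma> x \<otimes>\<^bsub>?A\<^esub> \<sigma> y" if "x \<in> carrier Q" "y \<in> carrier Q" for x y
      unfolding \<sigma>_def hom_mult[OF \<tau>(1) that] by (rule Ac.nat_pow_distrib[OF \<tau>c[OF that(1)] \<tau>c[OF that(2)]])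
  qed
  then interpret \<sigma>: group_hom Q ?A \<sigma> by unfold_locales
  have \<delta>c: "\<pi> (\<delta> j) \<in> carrier Q" if "j < ?k" for j using that by (intro \<pi>.hom_closed) simp
  have \<delta>A: "\<pi> (\<delta> j) [^]\<^bsub>Q\<^esub> i \<in> A \<longleftrightarrow> rord N (\<delta> j) dvd i" if j: "j < ?k" for j and i :: nat
    using A_iff[of "\<delta> j [^] i"] rord_iff[OF N, of "\<delta> j" i] \<pi>.hom_nat_pow[of "\<delta> j" i] j by simp
  have one: "\<sigma> (\<pi> (\<delta> j)) = \<one>\<^bsub>?A\<^esub>" if j: "j < ?k" "j \<noteq> l" for j
  proof -
    have "rperiod N j dvd K" unfolding K_def using j by (intro dvd_Lcm) auto
    then have "ns ! j dvd rord N (\<delta> j) * K" unfolding rperiod_mult[OF N j(1)] by (rule mult_dvd_mono[OF dvd_refl])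
    then obtain e where e: "rord N (\<delta> j) * K = ns ! j * e" by (rule dvdE)
    have "\<delta> j [^] (rord N (\<delta> j) * K) = \<one>"
      unfolding e using \<delta>_pow[OF j(1)] gen_closed(4)[OF j(1)] by (metis nat_pow_one nat_pow_pow)
    then have "\<pi> (\<delta> j) [^]\<^bsub>Q\<^esub> (rord N (\<delta> j) * K) = \<one>\<^bsub>Q\<^esub>"
      using \<pi>.hom_nat_pow[of "\<delta> j" "rord N (\<delta> j) * K"] j(1) \<pi>.hom_one by simp
    then have "\<tau> (\<pi> (\<delta> j)) [^]\<^bsub>Q\<^esub> K = \<one>\<^bsub>Q\<^esub>"
      by (rule \<tau>(2)[OF \<delta>c[OF j(1)] \<delta>A[OF j(1)] rord_pos[OF N j(1)]])
    then show ?thesis unfolding \<sigma>_def \<pi>.H.nat_pow_consistent[where H = A, symmetric] by simp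
  qed
  have rel: "ordered_prod Q (\<lambda>i. commutator Q (\<pi> (\<alpha> i)) (\<pi> (\<beta> i))) g \<otimes>\<^bsub>Q\<^esub> ordered_prod Q (\<lambda>j. \<pi> (\<delta> j)) ?k = \<one>\<^bsub>Q\<^esub>"
    (is "?C \<otimes>\<^bsub>Q\<^esub> ?D = _")
  proof -
    have "?C \<in> carrier Q"
      by (intro \<pi>.H.ordered_prod_closed \<pi>.H.commutator_closed \<pi>.hom_closed) auto
    then show ?thesis using Q_relations r unfolding F_relations_def
      by (simp)
  qed
  have Cc: "?C \<in> carrier Q" and Dc: "?D \<in> carrier Q"
    by (intro \<pi>.H.ordered_prod_closed \<pi>.H.commutator_closed \<pi>.hom_closed; simp)+
  have \<sigma>C: "\<sigma> ?C = \<one>\<^bsub>?A\<^esub>"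
  proof -
    have "commutator ?A (\<sigma> (\<pi> (\<alpha> i))) (\<sigma> (\<pi> (\<beta> i))) = \<one>\<^bsub>?A\<^esub>" if i: "i < g" for i
    proof -
      have "commutator ?A (\<sigma> (\<pi> (\<alpha> i))) (\<sigma> (\<pi> (\<beta> i))) \<in> derived ?A (carrier ?A)"
        using i by (intro commutator_in_derived \<sigma>.hom_closed \<pi>.hom_closed) auto
      then show ?thesis using Ac.derived_eq_singleton[OF order_refl] by blast
    qed
    then have "\<sigma> (commutator Q (\<pi> (\<alpha> i)) (\<pi> (\<beta> i))) = \<one>\<^bsub>?A\<^esub>" if i: "i < g" for i
      using \<sigma>.hom_commutator[OF \<pi>.hom_closed \<pi>.hom_closed, of "\<alpha> i" "\<beta> i"] i by simp
    then have "ordered_prod ?A (\<lambda>i. \<sigma> (commutator Q (\<pi> (\<alpha> i)) (\<pi> (\<beta> i)))) g = \<one>\<^bsub>?A\<^esub>"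
      by (intro Ag.ordered_prod_ind[where P = "\<lambda>x. x = \<one>\<^bsub>?A\<^esub>"]) (auto)
    then show ?thesis
      by (subst \<sigma>.hom_ordered_prod) (auto intro!: \<pi>.H.commutator_closed \<pi>.hom_closed)
  qed
  have "\<sigma> ?D = \<sigma> (\<pi> (\<delta> l))"
    using one l \<delta>c by (subst \<sigma>.hom_ordered_prod) (auto intro!: Ag.ordered_prod_single \<sigma>.hom_closed)
  moreover have "\<sigma> ?C \<otimes>\<^bsub>?A\<^esub> \<sigma> ?D = \<one>\<^bsub>?A\<^esub>"
    using \<sigma>.hom_mult[OF Cc Dc] rel \<sigma>.hom_one by simp
  ultimately have "\<sigma> (\<pi> (\<delta> l)) = \<one>\<^bsub>?A\<^esub>"
    using \<sigma>C \<sigma>.hom_closed[OF \<delta>c[OF l]] Ag.l_one by metis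
  then have \<tau>1: "\<tau> (\<pi> (\<delta> l)) [^]\<^bsub>Q\<^esub> K = \<one>\<^bsub>Q\<^esub>"
    unfolding \<sigma>_def \<pi>.H.nat_pow_consistent[where H = A, symmetric] by simp
  let ?o = "rord N (\<delta> l)"
  have "\<exists>i::nat. Y <#\<^bsub>Q\<^esub> A = \<pi> (\<delta> l) [^]\<^bsub>Q\<^esub> i <#\<^bsub>Q\<^esub> A" if Y: "Y \<in> carrier Q" for Y
  proof -
    from Y obtain y where y: "y \<in> carrier G" "Y = \<pi> y" unfolding \<pi>_onto[symmetric] by blast
    obtain i :: nat where "N #> y = N #> (\<delta> l [^] i)" using cyc y unfolding cyclic_mod_def by blast
    then have "y \<otimes> inv (\<delta> l [^] i) \<in> N" using r_coset_eq_iff[OF No(3)] y(1) l by simp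
    then have "inv y \<otimes> (y \<otimes> inv (\<delta> l [^] i)) \<otimes> y \<in> N" using normal.inv_op_closed1[OF No(2) y(1)] by blast
    then have "inv (\<delta> l [^] i) \<otimes> y \<in> N" using y(1) l by (simp add: word_simps)
    then have "inv (inv (\<delta> l [^] i) \<otimes> y) \<in> N" by (rule subgroup.m_inv_closed[OF No(3)])
    then have "inv y \<otimes> \<delta> l [^] i \<in> N" using y(1) l by (simp add: inv_mult_group)
    then have "\<pi> (inv y \<otimes> \<delta> l [^] i) \<in> A" unfolding A_def by (rule imageI)
    then have "inv\<^bsub>Q\<^esub> Y \<otimes>\<^bsub>Q\<^esub> \<pi> (\<delta> l) [^]\<^bsub>Q\<^esub> i \<in> A"
      using y l \<pi>.hom_mult[of "inv y" "\<delta> l [^] i"] \<pi>.hom_inv[of y] \<pi>.hom_nat_pow[of "\<delta> l" i]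
      by (simp)
    then show ?thesis using A.lcos_eq_iff[OF Y] \<delta>c[OF l] by blast
  qed
  then obtain u where u: "u \<in> carrier Q" "\<tau> (\<pi> (\<delta> l)) = u \<otimes>\<^bsub>Q\<^esub> \<pi> (\<delta> l) [^]\<^bsub>Q\<^esub> ?o \<otimes>\<^bsub>Q\<^esub> inv\<^bsub>Q\<^esub> u"
    using \<tau>(3)[OF \<delta>c[OF l] \<delta>A[OF l] rord_pos[OF N l]] by blast
  let ?z = "(\<pi> (\<delta> l) [^]\<^bsub>Q\<^esub> ?o) [^]\<^bsub>Q\<^esub> K"
  have zc: "?z \<in> carrier Q" using \<delta>c[OF l] by (intro \<pi>.H.nat_pow_closed)
  have "u \<otimes>\<^bsub>Q\<^esub> ?z \<otimes>\<^bsub>Q\<^esub> inv\<^bsub>Q\<^esub> u = \<one>\<^bsub>Q\<^esub>"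
    using \<tau>1 \<pi>.H.conj_nat_pow[OF u(1) \<pi>.H.nat_pow_closed[OF \<delta>c[OF l]]] unfolding u(2) by simp
  then have "?z = \<one>\<^bsub>Q\<^esub>" by (rule \<pi>.H.conj_eq_one_iff[OF u(1) zc])
  then have "\<pi> (\<delta> l [^] (?o * K)) = \<one>\<^bsub>Q\<^esub>"
    using \<pi>.hom_nat_pow[of "\<delta> l" "?o * K"] l \<delta>c[OF l] by (simp add: \<pi>.H.nat_pow_pow)
  then have "\<delta> l [^] (?o * K) \<in> kernel G Q \<pi>" using l by (simp add: kernel_def)
  then have "ns ! l dvd ?o * K" by (rule exact[OF l])
  then have "?o * rperiod N l dvd ?o * K" unfolding rperiod_mult[OF N l, symmetric] .
  then show ?thesis using rord_pos[OF N l] unfolding K_def by simp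
qed

end

context F_group
begin

text \<open>The hypothesis \<open>der\<close> replaces an inclusion of \<open>derived G N\<close> in
  \<open>der G (Suc m)\<close>. That inclusion may fail for \<open>N = cder\<close>, which is a
  closure, while the stated one holds modulo every open normal \<open>M\<close>. Intersecting with
  \<open>N\<close> places the kernel inside \<open>N\<close>.\<close>

lemma period_condition_if_separated:
  assumes r: "r = 0" and N: "open_normal N"
    and der: "\<And>M. open_normal M \<Longrightarrow> der G (Suc m) \<subseteq> M \<Longrightarrow> derived G N \<subseteq> M"
    and sep: "separated (Suc m)"
    and l: "l < length ns" and cyc: "cyclic_mod N (\<delta> l)"
  shows "rperiod N l dvd Lcm (rperiod N ` ({..<length ns} - {l}))"
proof -
  obtain M0 where M0: "open_normal M0" "der G (Suc m) \<subseteq> M0"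
    "\<And>l i. l < length ns \<Longrightarrow> \<delta> l [^] (i::nat) \<in> M0 \<Longrightarrow> ns ! l dvd i"
    using separated_uniform[OF sep] by blast
  define M where "M = M0 \<inter> N"
  have M: "open_normal M" unfolding M_def by (rule open_normal_Int[OF M0(1) N])
  interpret Q: F_quotient G T g r ns \<alpha> \<beta> \<gamma> \<delta> "G Mod M" "\<lambda>x. M #> x" by (rule F_quotient_Mod[OF M])
  have "derived G N \<subseteq> M"
    unfolding M_def using der[OF M0(1,2)] derived_incl[OF order_refl open_normalD(3)[OF N]] by blast
  then show ?thesis
    using M0(3) by (intro Q.period_condition_if_exact[unfolded F_quotient_Mod(2)[OF M]] r N l cyc) (auto simp: M_def)
qed

text \<open>The two period criteria are applied with \<open>N = carrier G\<close>. The quotient is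
  trivial, so every \<open>\<delta> l\<close> generates it and the remaining periods are the
  original ones.\<close>

lemma separated_one_iff:
  assumes r: "r = 0"
  shows "separated 1 \<longleftrightarrow> abelian_period_condition (Signature g r (mset ns))"
proof -
  let ?k = "length ns"
  have per: "rperiod (carrier G) l = ns ! l" if "l < ?k" for l using that by (simp add: rperiod_def)
  have cyc: "cyclic_mod (carrier G) x" for x
    unfolding cyclic_mod_def using coset_join2[OF _ subgroup_self]
  proof (intro ballI exI[of _ "0::nat"])
  qed (simp add: coset_join2[OF _ subgroup_self])
  have img: "rperiod (carrier G) ` ({..<?k} - {l}) = (\<lambda>l. ns ! l) ` ({..<?k} - {l})" for l
    using per by (intro image_cong) auto
  have "separated 1 \<longleftrightarrow> (\<forall>l<?k. ns ! l dvd Lcm ((\<lambda>l. ns ! l) ` ({..<?k} - {l})))"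
  proof
    assume "separated 1"
    then have "rperiod (carrier G) l dvd Lcm (rperiod (carrier G) ` ({..<?k} - {l}))" if "l < ?k" for l
      using that cyc by (intro period_condition_if_separated[OF r open_normal_carrier, of 0]) (auto simp: der_def)
    then show "\<forall>l<?k. ns ! l dvd Lcm ((\<lambda>l. ns ! l) ` ({..<?k} - {l}))" using per img by auto
  next
    assume "\<forall>l<?k. ns ! l dvd Lcm ((\<lambda>l. ns ! l) ` ({..<?k} - {l}))"
    then show "separated 1"
      using separated_if_period_condition[OF r open_normal_carrier, of 0] per img by simp
  qed
  also have "\<dots> \<longleftrightarrow> abelian_period_condition (Signature g r (mset ns))"
  proof -
    have "(\<Sum>l<n. {#ns ! l#}) = mset (take n ns)" if "n \<le> ?k" for n
      using that by (induction n) (simp_all add: take_Suc_conv_app_nth)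
    then have "(\<Sum>l<?k. replicate_mset 1 (ns ! l)) = mset ns" by simp
    moreover have "filter_mset (\<lambda>n. n \<noteq> 1) (mset ns) = mset ns"
    proof -
      have "n \<noteq> 1" if "n \<in># mset ns" for n
      proof -
        from that obtain l where "l < ?k" "n = ns ! l" by (auto simp: in_set_conv_nth)
        then show ?thesis using period_ge_2[of l] by simp
      qed
      then show ?thesis by (simp only: filter_mset_eq_conv) simp
    qed
    ultimately show ?thesis
      using period_condition_multiset[of ?k "\<lambda>_. 1" "\<lambda>l. ns ! l"] by (simp add: abelian_period_condition_def)
  qed
  finally show ?thesis .
qed

lemma coset_cycles_cder:
  assumes D: "open_normal D" and l: "l < length ns"
  defines "Z \<equiv> coset_cycles G D (\<delta> l)"
  shows "finite Z" "Z \<noteq> {}" "\<And>z. z \<in> Z \<Longrightarrow> card z = rord D (\<delta> l)" "card Z = 1 \<longleftrightarrow> cyclic_mod D (\<delta> l)"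
proof -
  note Do = open_normalD[OF D]
  interpret D: normal D G by (rule Do(2))
  let ?f = "\<lambda>C. \<delta> l <# C"
  have x: "\<delta> l \<in> carrier G" using l by simp
  note cyc = D.coset_cycle[OF x _ rord_iff[OF D x] rord_pos[OF D l]]
  have lr: "a <# D = D #> a" if "a \<in> carrier G" for a using that D.coset_eq by blast
  have LR: "lcosets D = carrier (G Mod D)"
    unfolding LCOSETS_def carrier_FactGroup using lr by auto
  show "finite Z" unfolding Z_def coset_cycles_def LR using finite_quotient[OF Do(1,3)] by simp
  have DL: "D \<in> lcosets D" using lcos_mult_one[OF D.subset] unfolding LCOSETS_def by force
  then show "Z \<noteq> {}" unfolding Z_def coset_cycles_def by blast
  show "card z = rord D (\<delta> l)" if "z \<in> Z" for z
    using that cyc(2) unfolding Z_def coset_cycles_def by blast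
  show "card Z = 1 \<longleftrightarrow> cyclic_mod D (\<delta> l)"
  proof
    assume "card Z = 1"
    then obtain z where z: "Z = {z}" by (auto simp: card_1_singleton_iff)
    have "\<exists>i::nat. D #> y = D #> (\<delta> l [^] i)" if y: "y \<in> carrier G" for y
    proof -
      have yL: "y <# D \<in> lcosets D" using y unfolding LCOSETS_def by blast
      have "orbit ?f (y <# D) = orbit ?f D" using z yL DL unfolding Z_def coset_cycles_def by blast
      then have "y <# D \<in> range (\<lambda>i::nat. \<delta> l [^] i <# D)" using cyc(3)[OF yL] cyc(1)[OF DL] by simp
      then show ?thesis using lr y x by auto
    qed
    then show "cyclic_mod D (\<delta> l)" unfolding cyclic_mod_def by blast
  next
    assume c: "cyclic_mod D (\<delta> l)"
    have "orbit ?f C = orbit ?f D" if C: "C \<in> lcosets D" for C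
    proof -
      from C obtain y where y: "y \<in> carrier G" "C = y <# D" by (rule D.lcosetsE)
      obtain i :: nat where "D #> y = D #> (\<delta> l [^] i)" using c y unfolding cyclic_mod_def by blast
      then have "C = \<delta> l [^] i <# D" using lr y x by simp
      then have CD: "C \<in> orbit ?f D" using cyc(1)[OF DL] by simp
      have DC: "D \<in> orbit ?f C" by (rule orbit_swap[OF cyc(3)[OF DL] CD])
      show ?thesis
      proof (intro subset_antisym subsetI)
        show "z \<in> orbit ?f D" if "z \<in> orbit ?f C" for z using that CD by (rule orbit_trans)
        show "z \<in> orbit ?f C" if "z \<in> orbit ?f D" for z using that DC by (rule orbit_trans)
      qed
    qed
    then have "Z = {orbit ?f D}" unfolding Z_def coset_cycles_def using DL by blast
    then show "card Z = 1" by simp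
  qed
qed

text \<open>The two period criteria are applied with \<open>N = cder\<close>. The generators with
  one cycle are those whose remaining period occurs once in their contribution to the induced
  signature, and \<open>period_condition_multiset\<close> says that only these matter.\<close>

lemma separated_two_iff:
  assumes gr: "g = 0" "r = 0"
  shows "separated 2 \<longleftrightarrow> abelian_period_condition (induced_signature G g r ns \<gamma> \<delta> cder)"
proof -
  let ?k = "length ns"
  have D: "open_normal cder" by (rule cder_open[OF gr])
  let ?w = "\<lambda>l. card (coset_cycles G cder (\<delta> l))"
  \<comment> \<open>Modulo an open normal \<open>M\<close> each element of the closure
    \<open>cder\<close> agrees with an element of \<open>der G 1\<close>. Commutators of elements of
    \<open>cder\<close> therefore agree modulo \<open>M\<close> with elements of the second derived
    subgroup.\<close>
  have sub: "derived G cder \<subseteq> M" if M: "open_normal M" "der G (Suc 1) \<subseteq> M" for M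
  proof -
    note Mo = open_normalD[OF M(1)] and Do = open_normalD[OF D]
    have SM: "der G 1 <#> M \<lhd> G" by (rule normal_subgroup_set_mult_closed[OF der_normal Mo(2)])
    have inM: "M \<subseteq> der G 1 <#> M"
    proof
      fix x assume x: "x \<in> M"
      then have "\<one> \<otimes> x \<in> der G 1 <#> M" using subgroup.one_closed[OF der_subgroup] by (intro set_mult_memI)
      then show "x \<in> der G 1 <#> M" using x subgroup.subset[OF Mo(3)] by auto
    qed
    have inS: "der G 1 \<subseteq> der G 1 <#> M"
    proof
      fix x assume x: "x \<in> der G 1"
      then have "x \<otimes> \<one> \<in> der G 1 <#> M" using subgroup.one_closed[OF Mo(3)] by (intro set_mult_memI)
      moreover have "x \<in> carrier G" using x der_carrier by blast
      ultimately show "x \<in> der G 1 <#> M" by (simp only: r_one)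
    qed
    have "open_normal (der G 1 <#> M)"
      unfolding open_normal_def using SM open_supergroup[OF Mo(1,3) _ inM] normal_imp_subgroup by blast
    then have DS: "cder \<subseteq> der G 1 <#> M" using inS by (rule cder_least)
    interpret M: normal M G by (rule Mo(2))
    interpret q: group_hom G "G Mod M" "\<lambda>x. M #> x" by (rule M.quotient_hom)
    show ?thesis
    proof (rule derived_subset_normalI[OF subgroup.subset[OF Do(3)] Mo(3)])
      fix x y assume xy: "x \<in> cder" "y \<in> cder"
      have img: "\<exists>s\<in>der G 1. M #> x = M #> s" if x: "x \<in> cder" for x
      proof -
        from x DS obtain s m where s: "s \<in> der G 1" "m \<in> M" "x = s \<otimes> m" unfolding set_mult_def by blast
        have c: "s \<in> carrier G" "m \<in> carrier G" using s der_carrier M.subset by auto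
        have "s \<otimes> m \<otimes> inv s \<in> M" using M.inv_op_closed2[OF c(1) s(2)] .
        then have "M #> x = M #> s" unfolding s(3) using r_coset_eq_iff[OF Mo(3), of "s \<otimes> m" s] c by simp
        then show ?thesis using s(1) by blast
      qed
      obtain s where s: "s \<in> der G 1" "M #> x = M #> s" using img[OF xy(1)] by blast
      obtain t where t: "t \<in> der G 1" "M #> y = M #> t" using img[OF xy(2)] by blast
      have c: "x \<in> carrier G" "y \<in> carrier G" "s \<in> carrier G" "t \<in> carrier G"
        using xy s t der_carrier subgroup.subset[OF Do(3)] by auto
      have "commutator G s t \<in> M" using M(2) commutator_in_derived[OF s(1) t(1), of G] unfolding der_Suc by blast
      moreover have "M #> commutator G x y = M #> commutator G s t"
        using q.hom_commutator[OF c(1,2)] q.hom_commutator[OF c(3,4)] s(2) t(2) by simp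
      ultimately show "commutator G x y \<in> M"
        using quotient_one_iff[OF Mo(3)] c by (metis commutator_closed)
    qed
  qed
  have "separated 2 \<longleftrightarrow> (\<forall>l<?k. ?w l = 1 \<longrightarrow> rperiod cder l dvd Lcm (rperiod cder ` ({..<?k} - {l})))"
  proof
    assume "separated 2"
    then have s: "separated (Suc 1)" by (simp only: Suc_1)
    show "\<forall>l<?k. ?w l = 1 \<longrightarrow> rperiod cder l dvd Lcm (rperiod cder ` ({..<?k} - {l}))"
      using period_condition_if_separated[OF gr(2) D sub s] coset_cycles_cder(4)[OF D] by blast
  next
    assume "\<forall>l<?k. ?w l = 1 \<longrightarrow> rperiod cder l dvd Lcm (rperiod cder ` ({..<?k} - {l}))"
    then have "separated (Suc 1)"
      using separated_if_period_condition[OF gr(2) D der_subset_cder] coset_cycles_cder(4)[OF D] by blast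
    then show "separated 2" by (simp only: Suc_1)
  qed
  also have "\<dots> \<longleftrightarrow> abelian_period_condition (induced_signature G g r ns \<gamma> \<delta> cder)"
  proof -
    have "image_mset (\<lambda>Z. ns ! l div card Z) (mset_set (coset_cycles G cder (\<delta> l)))
      = replicate_mset (?w l) (rperiod cder l)" if l: "l < ?k" for l
    proof -
      have "image_mset (\<lambda>Z. ns ! l div card Z) (mset_set (coset_cycles G cder (\<delta> l)))
        = image_mset (\<lambda>Z. rperiod cder l) (mset_set (coset_cycles G cder (\<delta> l)))"
        using coset_cycles_cder(1,3)[OF D l] by (intro image_mset_cong) (simp add: rperiod_def)
      then show ?thesis by (simp add: image_mset_const_eq)
    qed
    then have "induced_periods G ns \<delta> cder = filter_mset (\<lambda>n. n \<noteq> 1) (\<Sum>l<?k. replicate_mset (?w l) (rperiod cder l))"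
      unfolding induced_periods_def by (intro arg_cong[where f = "filter_mset _"] sum.cong) auto
    moreover have "?w l > 0" if "l < ?k" for l
      using coset_cycles_cder(1,2)[OF D that] by (simp add: card_gt_0_iff)
    ultimately show ?thesis
      using period_condition_multiset[of ?k ?w "rperiod cder"]
      by (simp add: abelian_period_condition_def induced_signature_def)
  qed
  finally show ?thesis .
qed

text \<open>Inner automorphisms are homeomorphisms, so they are among the automorphisms tested in
  the definition.\<close>

lemma characteristic_imp_normal:
  assumes "characteristic_subgroup G T N" shows "N \<lhd> G"
proof -
  have N: "subgroup N G" "\<And>\<phi>. \<phi> \<in> iso G G \<Longrightarrow> homeomorphic_map T T \<phi> \<Longrightarrow> \<phi> ` N = N"
    using assms unfolding characteristic_subgroup_def by auto
  have "h \<otimes> x \<otimes> inv h \<in> N" if h: "h \<in> carrier G" and x: "x \<in> N" for h x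
  proof -
    let ?\<phi> = "\<lambda>x. h \<otimes> x \<otimes> inv h" and ?\<psi> = "\<lambda>x. inv h \<otimes> x \<otimes> h"
    have inv: "?\<psi> (?\<phi> x) = x" "?\<phi> (?\<psi> x) = x" if "x \<in> carrier G" for x
      using that h by (simp_all add: word_simps)
    have "homeomorphic_maps T T ?\<phi> ?\<psi>"
      unfolding homeomorphic_maps_def using h inv by (auto intro!: continuous_translation)
    then have hm: "homeomorphic_map T T ?\<phi>" by (rule homeomorphic_maps_imp_map)
    moreover have "bij_betw ?\<phi> (carrier G) (carrier G)"
      using h inv by (intro bij_betw_byWitness[where f' = ?\<psi>]) auto
    then have "?\<phi> \<in> iso G G" using h by (auto simp: iso_def hom_def word_simps)
    ultimately have "?\<phi> ` N = N" by (intro N(2))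
    then show ?thesis using x by blast
  qed
  then show ?thesis using N(1) by (auto simp: normal_inv_iff)
qed

text \<open>The assumption gives each \<open>\<delta> l\<close> exact order \<open>ns ! l\<close> in
  \<open>G\<close>, as \<open>torsion_free_separated\<close> requires. The converse direction is
  \<open>separated_characteristic\<close>, whose subgroup is both characteristic and normal; so the
  two variants have the same answer.\<close>

lemma torsion_free_open_iff:
  assumes "separated 3"
  shows "(\<exists>N. torsion_free_open_characteristic G T N \<and> derived_length (G Mod N) (quotient_topology G T N) \<le> enat m) \<longleftrightarrow> separated m"
    "(\<exists>N. torsion_free_open_normal G T N \<and> derived_length (G Mod N) (quotient_topology G T N) \<le> enat m) \<longleftrightarrow> separated m"
    "(\<exists>N. torsion_free_open_characteristic G T N \<and> comm_group (G Mod N)) \<longleftrightarrow> separated 1"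
    "(\<exists>N. torsion_free_open_normal G T N \<and> comm_group (G Mod N)) \<longleftrightarrow> separated 1"
proof -
  have n: "open_normal N \<and> torsion_free_subgroup G N" if "torsion_free_open_normal G T N" for N
    using that unfolding torsion_free_open_normal_def open_normal_def by blast
  have c: "torsion_free_open_normal G T N" if "torsion_free_open_characteristic G T N" for N
    using that characteristic_imp_normal
    unfolding torsion_free_open_characteristic_def torsion_free_open_normal_def by blast
  have "separated m" if "torsion_free_open_normal G T N" "der G m \<subseteq> N" for N m
    using torsion_free_separated[OF assms] n[OF that(1)] that(2) by blast
  then have *: "(\<exists>N. torsion_free_open_characteristic G T N \<and> der G m \<subseteq> N) \<longleftrightarrow> separated m"
    "(\<exists>N. torsion_free_open_normal G T N \<and> der G m \<subseteq> N) \<longleftrightarrow> separated m" for m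
    using separated_characteristic[of m] c by metis+
  have dl: "derived_length (G Mod N) (quotient_topology G T N) \<le> enat m \<longleftrightarrow> der G m \<subseteq> N"
    if "torsion_free_open_normal G T N" for N
    using n[OF that] derived_length_quotient by blast
  have cm: "comm_group (G Mod N) \<longleftrightarrow> der G 1 \<subseteq> N" if "torsion_free_open_normal G T N" for N
    using n[OF that] open_normalD(2) normal.comm_quotient_iff by blast
  show "(\<exists>N. torsion_free_open_characteristic G T N \<and> derived_length (G Mod N) (quotient_topology G T N) \<le> enat m) \<longleftrightarrow> separated m"
    using *(1)[of m] dl c by blast
  show "(\<exists>N. torsion_free_open_normal G T N \<and> derived_length (G Mod N) (quotient_topology G T N) \<le> enat m) \<longleftrightarrow> separated m"
    using *(2)[of m] dl by blast
  show "(\<exists>N. torsion_free_open_characteristic G T N \<and> comm_group (G Mod N)) \<longleftrightarrow> separated 1"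
    using *(1)[of 1] cm c by blast
  show "(\<exists>N. torsion_free_open_normal G T N \<and> comm_group (G Mod N)) \<longleftrightarrow> separated 1"
    using *(2)[of 1] cm by blast
qed

text \<open>With only two periods there is no third generator for the detour of
  \<open>separated_three\<close>. If the periods agree, each divides the other and an abelian
  quotient already suffices.\<close>

lemma separated_three_general:
  assumes np: "cder \<noteq> carrier G" and ex: "\<not> (g = 0 \<and> r = 0 \<and> length ns = 2 \<and> ns ! 0 \<noteq> ns ! 1)"
  shows "separated 3"
proof -
  consider "r > 0" | "r = 0" "g > 0" | "r = 0" "g = 0" by linarith
  then show ?thesis
  proof cases
    case 1
    then show ?thesis using separated_mono[OF separated_cusps] by simp
  next
    case 2
    then show ?thesis using separated_mono[OF separated_genus] by simp
  next
    case 3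
    consider "length ns \<ge> 3" | "length ns = 2" using nonperfect_length[OF 3(2,1) np] by linarith
    then show ?thesis
    proof cases
      case 1 then show ?thesis using separated_three[OF 3(2,1) _ np] by blast
    next
      case 2
      have eq: "ns ! 0 = ns ! 1" using ex 2 3 by blast
      have "rperiod (carrier G) l dvd Lcm (rperiod (carrier G) ` ({..<length ns} - {l}))" if l: "l < length ns" for l
      proof (rule dvd_Lcm)
        have l01: "l = 0 \<or> l = 1" using l 2 by auto
        then have "rperiod (carrier G) l = rperiod (carrier G) (1 - l)" using eq 2 by (auto simp: rperiod_def)
        then show "rperiod (carrier G) l \<in> rperiod (carrier G) ` ({..<length ns} - {l})"
          using l01 2 by (intro image_eqI[of _ _ "1 - l"]) auto
      qed
      then have "separated (Suc 0)"
        by (intro separated_if_period_condition[OF 3(1) open_normal_carrier]) auto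
      then show ?thesis by (rule separated_mono) simp
    qed
  qed
qed

end

text \<open>The excluded signature is a genuine exception to the equivalences. For
  \<open>g = r = 0\<close> and periods 2 and 4 the group has order 2, so the trivial subgroup has an
  abelian quotient, while 4 does not divide 2 and the abelian-period condition fails.\<close>

theorem theorem2p18:
  fixes G :: "('a, 'm) monoid_scheme" and T :: "'a topology"
    and g r :: nat and ns :: "nat list" and \<alpha> \<beta> \<gamma> \<delta> :: "nat \<Rightarrow> 'a"
  assumes "F_presentation G T g r ns \<alpha> \<beta> \<gamma> \<delta>"
    and "\<not> perfect_group G T"
  shows
    "(\<exists>N. torsion_free_open_characteristic G T N \<and>
          derived_length (G Mod N) (quotient_topology G T N) \<le> 3)
     \<and>
     (\<not> (g = 0 \<and> r = 0 \<and> length ns = 2 \<and> ns ! 0 \<noteq> ns ! 1) \<longrightarrow>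
       ((\<exists>N. torsion_free_open_characteristic G T N \<and> comm_group (G Mod N)) \<longleftrightarrow>
          r \<ge> 1 \<or> r = 0 \<and> abelian_period_condition (Signature g r (mset ns)))
       \<and>
       ((\<exists>N. torsion_free_open_characteristic G T N \<and>
             derived_length (G Mod N) (quotient_topology G T N) \<le> 2) \<longleftrightarrow>
          (g, r) \<noteq> (0, 0) \<or>
          (g, r) = (0, 0) \<and>
            abelian_period_condition (induced_signature G g r ns \<gamma> \<delta> (closed_derived G T 1)))
       \<and>
       ((\<exists>N. torsion_free_open_normal G T N \<and> comm_group (G Mod N)) \<longleftrightarrow>
          r \<ge> 1 \<or> r = 0 \<and> abelian_period_condition (Signature g r (mset ns)))
       \<and>
       ((\<exists>N. torsion_free_open_normal G T N \<and>
             derived_length (G Mod N) (quotient_topology G T N) \<le> 2) \<longleftrightarrow>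
          (g, r) \<noteq> (0, 0) \<or>
          (g, r) = (0, 0) \<and>
            abelian_period_condition (induced_signature G g r ns \<gamma> \<delta> (closed_derived G T 1))))"
    (is "?first \<and> (\<not> ?exc \<longrightarrow> ?rest)")
proof -
  interpret F_group G T g r ns \<alpha> \<beta> \<gamma> \<delta> by unfold_locales (rule assms(1))
  have np: "cder \<noteq> carrier G" using assms(2) unfolding perfect_group_def closed_derived_1 .
  have num: "(3::enat) = enat 3" "(2::enat) = enat 2" by (simp_all add: numeral_eq_enat)
  have first: ?first if "\<not> ?exc"
    unfolding num torsion_free_open_iff(1)[OF separated_three_general[OF np that]]
    by (rule separated_three_general[OF np that])
  have exc: ?first if ?exc
  proof -
    note tp = two_periods_finite_cyclic[OF conjunct1[OF that] conjunct1[OF conjunct2[OF that]]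
        conjunct1[OF conjunct2[OF conjunct2[OF that]]]]
    have "open_normal {\<one>\<^bsub>G\<^esub>}"
      using tp(1) characteristic_imp_normal unfolding torsion_free_open_characteristic_def open_normal_def by blast
    moreover have "der G 3 \<subseteq> {\<one>\<^bsub>G\<^esub>}" using der_decreasing[of 1 3] tp(2) by auto
    ultimately have "derived_length (G Mod {\<one>\<^bsub>G\<^esub>}) (quotient_topology G T {\<one>\<^bsub>G\<^esub>}) \<le> enat 3"
      by (simp only: derived_length_quotient)
    then show ?thesis unfolding num using tp(1) by blast
  qed
  have one: "separated 1 \<longleftrightarrow> r \<ge> 1 \<or> r = 0 \<and> abelian_period_condition (Signature g r (mset ns))"
    using separated_cusps separated_one_iff by (cases "r = 0") auto
  have two: "separated 2 \<longleftrightarrow> (g, r) \<noteq> (0, 0) \<or> (g, r) = (0, 0) \<and>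
      abelian_period_condition (induced_signature G g r ns \<gamma> \<delta> (closed_derived G T 1))"
  proof (cases "(g, r) = (0, 0)")
    case True
    then show ?thesis using separated_two_iff unfolding closed_derived_1 by simp
  next
    case False
    then have "separated 2"
      using separated_mono[OF separated_cusps, of 2] separated_genus by (cases "r = 0") auto
    then show ?thesis using False by blast
  qed
  have ?rest if "\<not> ?exc"
    unfolding num one[symmetric] two[symmetric] torsion_free_open_iff[OF separated_three_general[OF np that]]
    by blast
  then show ?thesis using first exc by blast
qed

end
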